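(* Let $n\in\mathbb{N}$, let $\sigma\in(0,1)$, let $\delta\in(0,\sigma\bar\rho)$ and let $\gamma\in(\max\{2\delta,\bar\rho\},\operatorname{diam}(\Omega)/2)$. Let $z=(z_1,z')\in\mathcal{D}_{n,\delta,\gamma}$. Then, if $s\in\partial\Omega$ is the boundary point closest to $z_1$ and $\nu(s)$ is the outward-pointing unit normal to $\partial\Omega$ at $s$, the Peach--Koehler force $f_1(z)=-\nabla_{z_1}\mathcal{E}_n(z)$ on the dislocation $z_1$ satisfies $$f_1(z)=\frac{\nu(s)}{4\pi d_1(z_1)}+O(1),$$ where $O(1)$ denotes a term which is uniformly bounded for all $z\in\mathcal{D}_{n,\delta,\gamma}$ and which is quantified by $$\left|f_1(z)-\frac{\nu(s)}{4\pi d_1(z_1)}\right|\le \frac{2(1+\sigma)(n-1)\gamma(\gamma+2\bar\rho)}{\pi\bar\rho(\gamma-2\sigma\bar\rho)^2}+\frac{C_\sigma}{2\pi\bar\rho}=\frac{C_{n,\sigma}(\gamma)}{2\pi\bar\rho},$$ with $$C_{n,\sigma}(\gamma):=C_\sigma+\frac{4(1+\sigma)(n-1)\gamma(\gamma+2\bar\rho)}{(\gamma-2\sigma\bar\rho)^2},\qquad C_\sigma:=\log 2+\frac{2\sigma^2-9\sigma+8}{4(1-\sigma)(2-\sigma)^2}.$$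
   Context: $\Omega\subset\mathbb{R}^2$ is a bounded open connected set with $C^2$ boundary. $\bar\rho>0$ is a fixed radius for which the uniform interior and exterior disk conditions hold: for every $x\in\partial\Omega$ there are unique points $x_{\mathrm{int}},x_{\mathrm{ext}}$ with $B_{\bar\rho}(x_{\mathrm{int}})\subseteq\Omega$, $B_{\bar\rho}(x_{\mathrm{ext}})\subset\Omega^c$ and $\partial B_{\bar\rho}(x_{\mathrm{int}})\cap\partial\Omega\cap\partial B_{\bar\rho}(x_{\mathrm{ext}})=\{x\}$, where $B_r(x)$ is the open disk of radius $r$ centred at $x$ and the superscript $c$ denotes the complement. (In particular each $x\in\Omega$ with $\operatorname{dist}(x,\partial\Omega)<\bar\rho$ has a unique closest boundary point.) The function $k_\Omega(x,y)$, for $y\in\Omega$, is the solution of $-\Delta_x k_\Omega(x,y)=0$ for $x\in\Omega$ and $k_\Omega(x,y)=\frac1{2\pi}\log|x-y|$ for $x\in\partial\Omega$; it is smooth and symmetric on $\Omega\times\Omega$. Set $h_\Omega(x):=k_\Omega(x,x)$. For $n$ dislocations at positions $z_1,\dots,z_n\in\Omega$ with fixed Burgers moduli $b_1,\dots,b_n\in\{-1,+1\}$ the renormalised energy is $$\mathcal{E}_n(z_1,\dots,z_n)=\sum_{i<j}b_ib_j\Big(k_\Omega(z_i,z_j)-\frac1{2\pi}\log|z_i-z_j|\Big)+\frac12\sum_{i=1}^n b_i^2h_\Omega(z_i).$$ Distances: $d_1(x)=\operatorname{dist}(x,\partial\Omega)$, and for $m\ge2$, $d_m(x_1,\dots,x_m)=\min\{\min_i\operatorname{dist}(x_i,\partial\Omega),\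 \min_{i\ne j}|x_i-x_j|\}$. Write $z'=(z_2,\dots,z_n)$. For $0<\delta<\gamma<\operatorname{diam}(\Omega)/2$, $$\mathcal{D}_{n,\delta,\gamma}:=\{(z_1,z')\in\Omega^n : d_1(z_1)<\delta,\ d_{n-1}(z')>\gamma\},$$ where for $n=1$ the condition on $z'$ is void.
   Formalization: For n ≥ 2 the explicit bound and its equality with C_{n,σ}(γ)/(2πρ̄) are claimed only when γ ≠ 2σρ̄, since otherwise the denominator (γ−2σρ̄)² vanishes and the bound is undefined; the uniform O(1) bound is claimed in all cases. *)

theory Defs
  imports "HOL-Analysis.Analysis"
begin

definition gradient :: "('a::real_inner \<Rightarrow> real) \<Rightarrow> 'a \<Rightarrow> 'a" where
  "gradient f x = (THE g. GDERIV f x :> g)"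

(* H x is the Hessian of f at x, as the linear map h |-> D^2 f(x) h; in finite dimension its
   continuity in x may be stated vector by vector. *)
definition C2_on :: "'a::euclidean_space set \<Rightarrow> ('a \<Rightarrow> real) \<Rightarrow> bool" where
  "C2_on S f \<longleftrightarrow>
     (\<exists>g H. (\<forall>x\<in>S. (GDERIV f x :> g x) \<and> (g has_derivative H x) (at x)) \<and>
            (\<forall>v. continuous_on S (\<lambda>x. H x v)))"

definition laplacian :: "('a::euclidean_space \<Rightarrow> real) \<Rightarrow> 'a \<Rightarrow> real" where
  "laplacian f x = (\<Sum>e\<in>Basis. deriv (deriv (\<lambda>t. f (x + t *\<^sub>R e))) 0)"

definition harmonic_on :: "'a::euclidean_space set \<Rightarrow> ('a \<Rightarrow> real) \<Rightarrow> bool" where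
  "harmonic_on S u \<longleftrightarrow> C2_on S u \<and> (\<forall>x\<in>S. - laplacian u x = 0)"

(* psi describes Omega near its boundary point s as a regular sublevel set. *)
definition C2_defining_function ::
  "'a::euclidean_space set \<Rightarrow> 'a \<Rightarrow> 'a set \<Rightarrow> ('a \<Rightarrow> real) \<Rightarrow> bool" where
  "C2_defining_function \<Omega> s U \<psi> \<longleftrightarrow>
     open U \<and> s \<in> U \<and> C2_on U \<psi> \<and> gradient \<psi> s \<noteq> 0 \<and>
     \<Omega> \<inter> U = {x\<in>U. \<psi> x < 0} \<and> frontier \<Omega> \<inter> U = {x\<in>U. \<psi> x = 0}"

definition C2_boundary :: "'a::euclidean_space set \<Rightarrow> bool" where
  "C2_boundary \<Omega> \<longleftrightarrow> (\<forall>s\<in>frontier \<Omega>. \<exists>U \<psi>. C2_defining_function \<Omega> s U \<psi>)"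

(* The value does not depend on the choice of the defining function. *)
definition outward_normal :: "'a::euclidean_space set \<Rightarrow> 'a \<Rightarrow> 'a" where
  "outward_normal \<Omega> s =
     (THE v. \<exists>U \<psi>. C2_defining_function \<Omega> s U \<psi> \<and>
                   v = gradient \<psi> s /\<^sub>R norm (gradient \<psi> s))"

(* p = (x_int, x_ext) *)
definition uniform_disk_conditions :: "'a::euclidean_space set \<Rightarrow> real \<Rightarrow> bool" where
  "uniform_disk_conditions \<Omega> \<rho> \<longleftrightarrow>
     (\<forall>x\<in>frontier \<Omega>. \<exists>!p. ball (fst p) \<rho> \<subseteq> \<Omega> \<and> ball (snd p) \<rho> \<subseteq> - \<Omega> \<and>
        sphere (fst p) \<rho> \<inter> frontier \<Omega> \<inter> sphere (snd p) \<rho> = {x})"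

(* k is the function k_Omega: for each y in Omega, k(.,y) is the classical (C^2 inside, continuous
   up to the boundary) solution of the Dirichlet problem. This determines k on
   closure Omega x Omega. *)
definition is_k :: "'a::euclidean_space set \<Rightarrow> ('a \<Rightarrow> 'a \<Rightarrow> real) \<Rightarrow> bool" where
  "is_k \<Omega> k \<longleftrightarrow>
     (\<forall>y\<in>\<Omega>. continuous_on (closure \<Omega>) (\<lambda>x. k x y) \<and>
            harmonic_on \<Omega> (\<lambda>x. k x y) \<and>
            (\<forall>x\<in>frontier \<Omega>. k x y = 1 / (2 * pi) * ln (norm (x - y))))"

definition h_of :: "('a \<Rightarrow> 'a \<Rightarrow> real) \<Rightarrow> 'a \<Rightarrow> real" where
  "h_of k x = k x x"

(* A configuration (z_1, ..., z_n) is a function z on the index set {1..n}. *)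
definition energy ::
  "nat \<Rightarrow> (nat \<Rightarrow> real) \<Rightarrow> ('a::euclidean_space \<Rightarrow> 'a \<Rightarrow> real) \<Rightarrow> (nat \<Rightarrow> 'a) \<Rightarrow> real" where
  "energy n b k z =
     (\<Sum>(i, j)\<in>{(i, j). 1 \<le> i \<and> i < j \<and> j \<le> n}.
        b i * b j * (k (z i) (z j) - 1 / (2 * pi) * ln (norm (z i - z j)))) +
     1 / 2 * (\<Sum>i=1..n. (b i)\<^sup>2 * h_of k (z i))"

definition force1 ::
  "nat \<Rightarrow> (nat \<Rightarrow> real) \<Rightarrow> ('a::euclidean_space \<Rightarrow> 'a \<Rightarrow> real) \<Rightarrow> (nat \<Rightarrow> 'a) \<Rightarrow> 'a" where
  "force1 n b k z = - gradient (\<lambda>x. energy n b k (z(1 := x))) (z 1)"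

definition d1 :: "'a::euclidean_space set \<Rightarrow> 'a \<Rightarrow> real" where
  "d1 \<Omega> x = infdist x (frontier \<Omega>)"

(* d_m for the m points x_i with i in I, m = card I > 0; for m = 1 there are no pairs and this is
   d_1. *)
definition dm :: "'a::euclidean_space set \<Rightarrow> nat set \<Rightarrow> (nat \<Rightarrow> 'a) \<Rightarrow> real" where
  "dm \<Omega> I x =
     Min ((\<lambda>i. infdist (x i) (frontier \<Omega>)) ` I \<union>
          {norm (x i - x j) | i j. i \<in> I \<and> j \<in> I \<and> i \<noteq> j})"

definition D_set :: "'a::euclidean_space set \<Rightarrow> nat \<Rightarrow> real \<Rightarrow> real \<Rightarrow> (nat \<Rightarrow> 'a) set" where
  "D_set \<Omega> n \<delta> \<gamma> =
     {z \<in> {1..n} \<rightarrow>\<^sub>E \<Omega>. d1 \<Omega> (z 1) < \<delta> \<and> (n \<ge> 2 \<longrightarrow> dm \<Omega> {2..n} z > \<gamma>)}"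

definition C_sig :: "real \<Rightarrow> real" where
  "C_sig \<sigma> = ln 2 + (2 * \<sigma>\<^sup>2 - 9 * \<sigma> + 8) / (4 * (1 - \<sigma>) * (2 - \<sigma>)\<^sup>2)"

(* For gamma = 2 sigma rho and n >= 2 the formula is meaningless mathematically (infinite), but HOL
   sets x / 0 = 0; statements using it as a bound must exclude that case. *)
definition C_nsig :: "nat \<Rightarrow> real \<Rightarrow> real \<Rightarrow> real \<Rightarrow> real" where
  "C_nsig n \<sigma> \<rho> \<gamma> =
     C_sig \<sigma> + 4 * (1 + \<sigma>) * (real n - 1) * \<gamma> * (\<gamma> + 2 * \<rho>) / (\<gamma> - 2 * \<sigma> * \<rho>)\<^sup>2"

end

theory Submission
  imports Defs "HOL-Complex_Analysis.Conformal_Mappings"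
begin

text \<open>
  Comparison of \<open>k\<close> with the explicit kernels of the interior and of the exterior disk tangent at
  \<open>s\<close> (maximum principle) encloses \<open>k(\<cdot>, z\<^sub>1)\<close> between two functions
  whose gap at \<open>z\<^sub>1\<close> is of order \<open>d\<close>, where \<open>d\<close> is the distance
  from \<open>z\<^sub>1\<close> to the boundary. A nonnegative harmonic function \<open>u\<close> on a disk of
  radius \<open>d\<close> satisfies \<open>|\<nabla>u| \<le> 2u/d\<close> at the centre (Schwarz lemma), so
  the gap of order \<open>d\<close> yields a bounded gap for the gradients. Since \<open>k\<close> is
  symmetric, half the gradient of \<open>h\<close> is the partial gradient of \<open>k\<close>. The
  interaction with the other dislocations is estimated in the same way from the Green function of the exterior
  disk. Symmetry of \<open>k\<close> is obtained without integral identities: in its second variable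
  \<open>k\<close> is continuous and its discrete Laplacian is \<open>o(h\<^sup>2)\<close>, and the maximum
  principle needs no more than this.
\<close>

section \<open>Second derivatives and harmonic functions\<close>

text \<open>On the diagonal both disk kernels equal \<open>1 / (2 * pi) * ln d\<close> up to a
  bounded term, with the same constant to leading order, so the singular part cancels and the gap is
  \<open>1 / (2 * pi) * ln ((2 * \<rho> + d) / (2 * \<rho> - d))\<close>. The obstacle is the second
  argument of \<open>k\<close>. The Dirichlet problem describes \<open>k\<close> for each fixed
  second argument separately, whereas the self-energy requires a derivative of \<open>k x x\<close>.
  Smoothness in the second argument is replaced by what passes through the maximum principle in the
  first: Lipschitz bounds and the discrete Laplacian, both inherited from the logarithm as boundary
  data. Near a frontier point, \<open>k x y\<close> and \<open>k y x\<close> are squeezed between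
  the logarithm and the kernel of an exterior disk touching there, so their difference tends to 0.
  The constants of the theorem are larger than what the argument yields, so separate inequalities
  show that they dominate. The pair term is delicate: its denominator
  \<open>(\<gamma> - 2 * \<sigma> * \<rho>)\<^sup>2\<close> vanishes at one value of \<gamma>, where
  boundedness needs a bound of another form.\<close>

lemma GDERIV_along_line:
  assumes "GDERIV u (x + t *\<^sub>R e) :> g"
  shows "((\<lambda>t. u (x + t *\<^sub>R e)) has_real_derivative e \<bullet> g) (at t)"
proof -
  have "((\<lambda>t. x + t *\<^sub>R e) has_derivative (\<lambda>h. h *\<^sub>R e)) (at t)"
    by (auto intro!: derivative_eq_intros)
  from has_derivative_compose[OF this assms[unfolded gderiv_def]]
  show ?thesis
    by (simp add: has_field_derivative_def mult.commute[of _ "e \<bullet> g"])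
qed

lemma has_derivative_along_line:
  assumes "(g has_derivative H) (at (x + t *\<^sub>R e))"
  shows "((\<lambda>t. e' \<bullet> g (x + t *\<^sub>R e)) has_real_derivative e' \<bullet> H e) (at t)"
proof -
  have 1: "((\<lambda>t. x + t *\<^sub>R e) has_derivative (\<lambda>h. h *\<^sub>R e)) (at t)"
    by (auto intro!: derivative_eq_intros)
  have "((\<lambda>t. g (x + t *\<^sub>R e)) has_derivative (\<lambda>h. H (h *\<^sub>R e))) (at t)"
    using has_derivative_compose[OF 1 assms] .
  then have "((\<lambda>t. e' \<bullet> g (x + t *\<^sub>R e)) has_derivative (\<lambda>h. e' \<bullet> H (h *\<^sub>R e))) (at t)"
    by (rule has_derivative_inner_right)
  moreover have "linear H" using assms has_derivative_linear by blast
  then have "(\<lambda>h. e' \<bullet> H (h *\<^sub>R e)) = (*) (e' \<bullet> H e)"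
    by (auto simp: fun_eq_iff linear_cmul)
  ultimately show ?thesis by (simp add: has_field_derivative_def)
qed

lemma eventually_line_in_open:
  fixes x e :: "'a::real_normed_vector"
  assumes "open S" "x \<in> S"
  shows "\<forall>\<^sub>F t in nhds 0. x + t *\<^sub>R e \<in> S"
proof -
  have "((\<lambda>t. x + t *\<^sub>R e) \<longlongrightarrow> x + 0 *\<^sub>R e) (nhds 0)"
    by (intro tendsto_intros filterlim_ident)
  then show ?thesis using assms topological_tendstoD[of _ "x" "nhds 0" S] by auto
qed

lemma laplacian_eq_trace:
  fixes u :: "'a::euclidean_space \<Rightarrow> real"
  assumes S: "open S" "x \<in> S" and g: "\<And>y. y \<in> S \<Longrightarrow> GDERIV u y :> g y"
    and H: "(g has_derivative H) (at x)"
  shows "laplacian u x = (\<Sum>e\<in>Basis. e \<bullet> H e)"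
  unfolding laplacian_def
proof (rule sum.cong[OF refl])
  fix e :: 'a assume "e \<in> Basis"
  \<comment> \<open>\<open>deriv\<close> depends only on values near the point, so agreement for
    small \<open>t\<close> determines the outer derivative.\<close>
  have "\<forall>\<^sub>F t in nhds 0. deriv (\<lambda>t. u (x + t *\<^sub>R e)) t = e \<bullet> g (x + t *\<^sub>R e)"
    using eventually_line_in_open[OF S, of e]
    by eventually_elim (intro DERIV_imp_deriv GDERIV_along_line g)
  then have "deriv (deriv (\<lambda>t. u (x + t *\<^sub>R e))) 0 = deriv (\<lambda>t. e \<bullet> g (x + t *\<^sub>R e)) 0"
    by (rule deriv_cong_ev) simp
  also have "\<dots> = e \<bullet> H e"
    by (rule DERIV_imp_deriv[OF has_derivative_along_line]) (use H in simp)
  finally show "deriv (deriv (\<lambda>t. u (x + t *\<^sub>R e))) 0 = e \<bullet> H e" .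
qed

lemma harmonic_onE:
  fixes u :: "'a::euclidean_space \<Rightarrow> real"
  assumes "open S" "harmonic_on S u"
  obtains g H where "\<And>x. x \<in> S \<Longrightarrow> GDERIV u x :> g x"
    "\<And>x. x \<in> S \<Longrightarrow> (g has_derivative H x) (at x)"
    "\<And>x. x \<in> S \<Longrightarrow> (\<Sum>e\<in>Basis. e \<bullet> H x e) = 0"
    "\<And>v. continuous_on S (\<lambda>x. H x v)"
proof -
  from assms obtain g H where *: "\<And>x. x \<in> S \<Longrightarrow> GDERIV u x :> g x"
    "\<And>x. x \<in> S \<Longrightarrow> (g has_derivative H x) (at x)" "\<And>v. continuous_on S (\<lambda>x. H x v)"
    unfolding harmonic_on_def C2_on_def by blast
  show thesis
  proof (rule that[OF *(1,2) _ *(3)])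
    fix x assume "x \<in> S"
    then show "(\<Sum>e\<in>Basis. e \<bullet> H x e) = 0"
      using laplacian_eq_trace[OF assms(1) \<open>x \<in> S\<close> *(1) *(2)] assms(2)
      by (auto simp: harmonic_on_def)
  qed
qed

lemma harmonic_onI:
  fixes u :: "'a::euclidean_space \<Rightarrow> real"
  assumes "open S" "\<And>x. x \<in> S \<Longrightarrow> GDERIV u x :> g x"
    "\<And>x. x \<in> S \<Longrightarrow> (g has_derivative H x) (at x)"
    "\<And>x. x \<in> S \<Longrightarrow> (\<Sum>e\<in>Basis. e \<bullet> H x e) = 0"
    "\<And>v. continuous_on S (\<lambda>x. H x v)"
  shows "harmonic_on S u"
proof -
  have "laplacian u x = 0" if "x \<in> S" for x
    using laplacian_eq_trace[of S x u g "H x"] assms(1-4) that by simp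
  moreover have "C2_on S u"
    unfolding C2_on_def using assms(2,3,5) by blast
  ultimately show ?thesis by (simp add: harmonic_on_def)
qed

lemma harmonic_on_subset:
  fixes u :: "'a::euclidean_space \<Rightarrow> real"
  assumes "harmonic_on S u" "T \<subseteq> S"
  shows "harmonic_on T u"
  using assms unfolding harmonic_on_def C2_on_def by (meson continuous_on_subset subsetD)

lemma harmonic_on_const: "open S \<Longrightarrow> harmonic_on S (\<lambda>x. c)"
  by (rule harmonic_onI[where g="\<lambda>x. 0" and H="\<lambda>x h. 0"]) (auto intro: GDERIV_const)

lemma harmonic_on_lincomb:
  fixes u v :: "'a::euclidean_space \<Rightarrow> real"
  assumes S: "open S" and u: "harmonic_on S u" and v: "harmonic_on S v"
  shows "harmonic_on S (\<lambda>x. a * u x + b * v x)"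
proof -
  obtain g H where 1: "\<And>x. x \<in> S \<Longrightarrow> GDERIV u x :> g x"
    "\<And>x. x \<in> S \<Longrightarrow> (g has_derivative H x) (at x)"
    "\<And>x. x \<in> S \<Longrightarrow> (\<Sum>e\<in>Basis. e \<bullet> H x e) = 0"
    "\<And>v. continuous_on S (\<lambda>x. H x v)" using harmonic_onE[OF S u] by blast
  obtain g' H' where 2: "\<And>x. x \<in> S \<Longrightarrow> GDERIV v x :> g' x"
    "\<And>x. x \<in> S \<Longrightarrow> (g' has_derivative H' x) (at x)"
    "\<And>x. x \<in> S \<Longrightarrow> (\<Sum>e\<in>Basis. e \<bullet> H' x e) = 0"
    "\<And>v. continuous_on S (\<lambda>x. H' x v)" using harmonic_onE[OF S v] by blast
  show ?thesis
  proof (rule harmonic_onI[OF S, where g="\<lambda>x. a *\<^sub>R g x + b *\<^sub>R g' x"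
        and H="\<lambda>x h. a *\<^sub>R H x h + b *\<^sub>R H' x h"])
    fix x assume x: "x \<in> S"
    show "GDERIV (\<lambda>x. a * u x + b * v x) x :> a *\<^sub>R g x + b *\<^sub>R g' x"
      using 1(1)[OF x] 2(1)[OF x] unfolding gderiv_def
      by (auto intro!: derivative_eq_intros simp: inner_add_right)
    show "((\<lambda>x. a *\<^sub>R g x + b *\<^sub>R g' x) has_derivative (\<lambda>h. a *\<^sub>R H x h + b *\<^sub>R H' x h)) (at x)"
      using 1(2)[OF x] 2(2)[OF x] by (auto intro!: derivative_eq_intros)
    show "(\<Sum>e\<in>Basis. e \<bullet> (a *\<^sub>R H x e + b *\<^sub>R H' x e)) = 0"
      using 1(3)[OF x] 2(3)[OF x]
      by (simp add: inner_add_right sum.distrib sum_distrib_left[symmetric])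
  next
    fix w show "continuous_on S (\<lambda>x. a *\<^sub>R H x w + b *\<^sub>R H' x w)"
      by (intro continuous_intros 1 2)
  qed
qed

lemma harmonic_on_cmult:
  "open S \<Longrightarrow> harmonic_on S u \<Longrightarrow> harmonic_on S (\<lambda>x. a * u x)"
  using harmonic_on_lincomb[of S u u a 0] by simp

lemma harmonic_on_add:
  "open S \<Longrightarrow> harmonic_on S u \<Longrightarrow> harmonic_on S v \<Longrightarrow> harmonic_on S (\<lambda>x. u x + v x)"
  using harmonic_on_lincomb[of S u v 1 1] by simp

lemma harmonic_on_diff:
  "open S \<Longrightarrow> harmonic_on S u \<Longrightarrow> harmonic_on S v \<Longrightarrow> harmonic_on S (\<lambda>x. u x - v x)"
  using harmonic_on_lincomb[of S u v 1 "-1"] by simp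

lemma GDERIV_unique: "GDERIV f x :> a \<Longrightarrow> GDERIV f x :> b \<Longrightarrow> a = b"
proof -
  assume "GDERIV f x :> a" "GDERIV f x :> b"
  then have "(\<lambda>h. h \<bullet> a) = (\<lambda>h. h \<bullet> b)"
    unfolding gderiv_def by (rule has_derivative_unique)
  then have "(a - b) \<bullet> a = (a - b) \<bullet> b" by meson
  then have "(a - b) \<bullet> (a - b) = 0" by (simp add: inner_diff_right)
  then show "a = b" by simp
qed

lemma gradient_eqI: "GDERIV f x :> g \<Longrightarrow> gradient f x = g"
  unfolding gradient_def by (rule the_equality) (auto intro: GDERIV_unique)

lemma has_derivative_norm_bound:
  assumes "(f has_derivative f') (at x)" "\<epsilon> > 0"
  obtains d where "d > 0" "\<And>y. norm (y - x) < d \<Longrightarrow> norm (f y - f x - f' (y - x)) \<le> \<epsilon> * norm (y - x)"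
  using assms unfolding has_derivative_at_alt by blast

text \<open>The mean value theorem in direction \<open>a\<close> turns the second difference into a
  difference of \<open>g\<close> at two points, and both values are linearised at \<open>x\<close>.
  There are two uses: with \<open>a\<close> and \<open>b\<close> interchanged for the symmetry of
  the Hessian, and with \<open>b = - a\<close> for the centred second difference.\<close>

lemma second_derivative_diff_bound:
  fixes u :: "'a::euclidean_space \<Rightarrow> real"
  assumes S: "open S" "x \<in> S" and g: "\<And>y. y \<in> S \<Longrightarrow> GDERIV u y :> g y"
    and H: "(g has_derivative H) (at x)" and \<epsilon>: "\<epsilon> > 0"
  shows "\<forall>\<^sub>F h in at_right 0. \<bar>(u (x + h *\<^sub>R a + h *\<^sub>R b) - u (x + h *\<^sub>R a) - u (x + h *\<^sub>R b) + u x)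
            - h\<^sup>2 * (a \<bullet> H b)\<bar> \<le> \<epsilon> * h\<^sup>2"
proof -
  \<comment> \<open>The two linearisation errors add up to at most
    \<open>\<epsilon>/M * (h * (2 * norm a + norm b))\<close>; multiplied by \<open>norm a\<close>
    this is \<open>\<epsilon>/M * h * (M - 1)\<close>. The summand 1 keeps \<open>M\<close> positive
    when \<open>a = 0\<close>.\<close>
  define M where "M = 1 + norm a * (2 * norm a + norm b)"
  have M: "M > 0" unfolding M_def by (smt (verit) mult_nonneg_nonneg norm_ge_zero)
  obtain d where d: "d > 0" "\<And>y. norm (y - x) < d \<Longrightarrow> norm (g y - g x - H (y - x)) \<le> \<epsilon>/M * norm (y - x)"
    using has_derivative_norm_bound[OF H, of "\<epsilon>/M"] \<epsilon> M by (metis divide_pos_pos)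
  obtain r where r: "r > 0" "ball x r \<subseteq> S" using S open_contains_ball by blast
  have lin: "linear H" using H has_derivative_linear by blast
  define m where "m = min d r"
  have m: "m > 0" using d r by (simp add: m_def)
  define q where "q = m / (1 + norm a + norm b)"
  have q: "q > 0" using m unfolding q_def by (smt (verit) divide_pos_pos norm_ge_zero)
  have "\<forall>\<^sub>F h in at_right 0. h \<in> {0<..<q}" using q eventually_at_right_real by blast
  then show ?thesis
  proof eventually_elim
    case (elim h)
    then have h: "0 < h" "h < q" by auto
    have hm: "h * (1 + norm a + norm b) < m"
      using h unfolding q_def by (simp add: pos_less_divide_eq add_pos_nonneg)
    have close: "norm (t *\<^sub>R a + s *\<^sub>R b) \<le> h * (norm a + norm b) \<and> norm (t *\<^sub>R a + s *\<^sub>R b) < m"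
      if "0 \<le> t" "t \<le> h" "0 \<le> s" "s \<le> h" for t s
    proof -
      have "norm (t *\<^sub>R a + s *\<^sub>R b) \<le> t * norm a + s * norm b"
        using norm_triangle_ineq[of "t *\<^sub>R a" "s *\<^sub>R b"] that by simp
      also have "\<dots> \<le> h * (norm a + norm b)"
        using that by (simp add: distrib_left add_mono mult_right_mono)
      finally have "norm (t *\<^sub>R a + s *\<^sub>R b) \<le> h * (norm a + norm b)" .
      then show ?thesis using hm h(1) by (auto simp: algebra_simps)
    qed
    have inS: "x + t *\<^sub>R a + s *\<^sub>R b \<in> S" if "0 \<le> t" "t \<le> h" "0 \<le> s" "s \<le> h" for t s
    proof -
      have "dist x (x + w) = norm w" for w
        by (metis add_diff_cancel_left' dist_commute dist_norm)
      then have "x + t *\<^sub>R a + s *\<^sub>R b \<in> ball x r"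
        using close[OF that] by (simp add: m_def add.assoc)
      then show ?thesis using r by blast
    qed
    define \<phi> where "\<phi> t = u ((x + h *\<^sub>R b) + t *\<^sub>R a) - u (x + t *\<^sub>R a)" for t
    have der: "(\<phi> has_real_derivative (a \<bullet> g ((x + h *\<^sub>R b) + t *\<^sub>R a) - a \<bullet> g (x + t *\<^sub>R a))) (at t)"
      if "0 \<le> t" "t \<le> h" for t
    proof -
      have "(x + h *\<^sub>R b) + t *\<^sub>R a \<in> S" "x + t *\<^sub>R a \<in> S"
        using inS[of t h] inS[of t 0] that h by (simp_all add: add_ac)
      then show ?thesis unfolding \<phi>_def
        by (intro DERIV_diff GDERIV_along_line g)
    qed
    obtain \<xi> where \<xi>: "0 < \<xi>" "\<xi> < h"
      "\<phi> h - \<phi> 0 = (h - 0) * (a \<bullet> g ((x + h *\<^sub>R b) + \<xi> *\<^sub>R a) - a \<bullet> g (x + \<xi> *\<^sub>R a))"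
      using MVT2[of 0 h \<phi> "\<lambda>t. a \<bullet> g ((x + h *\<^sub>R b) + t *\<^sub>R a) - a \<bullet> g (x + t *\<^sub>R a)"] der h by auto
    define p1 where "p1 = g ((x + h *\<^sub>R b) + \<xi> *\<^sub>R a) - g x - H (\<xi> *\<^sub>R a + h *\<^sub>R b)"
    define p2 where "p2 = g (x + \<xi> *\<^sub>R a) - g x - H (\<xi> *\<^sub>R a)"
    have em: "\<epsilon>/M > 0" using \<epsilon> M by simp
    have n1: "norm p1 \<le> \<epsilon>/M * (h * (norm a + norm b))"
    proof -
      have "norm p1 \<le> \<epsilon>/M * norm (\<xi> *\<^sub>R a + h *\<^sub>R b)"
        using d(2)[of "(x + h *\<^sub>R b) + \<xi> *\<^sub>R a"] close[of \<xi> h] \<xi> h unfolding p1_def m_def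
        by (simp add: add.commute add.left_commute)
      also have "\<dots> \<le> \<epsilon>/M * (h * (norm a + norm b))"
        using close[of \<xi> h] \<xi> h em by (intro mult_left_mono) auto
      finally show ?thesis .
    qed
    have n2: "norm p2 \<le> \<epsilon>/M * (h * norm a)"
    proof -
      have "norm p2 \<le> \<epsilon>/M * norm (\<xi> *\<^sub>R a)"
        using d(2)[of "x + \<xi> *\<^sub>R a"] close[of \<xi> 0] \<xi> h unfolding p2_def m_def by simp
      also have "\<dots> \<le> \<epsilon>/M * (h * norm a)"
        using \<xi> h em by (intro mult_left_mono) (auto simp: mult_right_mono)
      finally show ?thesis .
    qed
    have Hab: "H (\<xi> *\<^sub>R a + h *\<^sub>R b) - H (\<xi> *\<^sub>R a) = h *\<^sub>R H b"
      using lin by (simp add: linear_add linear_cmul)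
    have "g ((x + h *\<^sub>R b) + \<xi> *\<^sub>R a) - g (x + \<xi> *\<^sub>R a) = p1 - p2 + h *\<^sub>R H b"
      unfolding p1_def p2_def Hab[symmetric] by simp
    then have "\<phi> h - \<phi> 0 = h * (a \<bullet> (p1 - p2 + h *\<^sub>R H b))"
      using \<xi>(3) by (simp add: inner_diff_right[symmetric])
    then have eq: "\<phi> h - \<phi> 0 - h\<^sup>2 * (a \<bullet> H b) = h * (a \<bullet> (p1 - p2))"
      by (simp add: inner_add_right distrib_left power2_eq_square)
    have "\<bar>a \<bullet> (p1 - p2)\<bar> \<le> norm a * norm (p1 - p2)" by (rule Cauchy_Schwarz_ineq2)
    also have "\<dots> \<le> norm a * (\<epsilon>/M * (h * (2 * norm a + norm b)))"
    proof (rule mult_left_mono)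
      have "norm (p1 - p2) \<le> norm p1 + norm p2" by (rule norm_triangle_ineq4)
      also have "\<dots> \<le> \<epsilon>/M * (h * (norm a + norm b)) + \<epsilon>/M * (h * norm a)" using n1 n2 by linarith
      also have "\<dots> = \<epsilon>/M * (h * (2 * norm a + norm b))" by (simp add: algebra_simps)
      finally show "norm (p1 - p2) \<le> \<epsilon>/M * (h * (2 * norm a + norm b))" .
    qed simp
    also have "\<dots> = \<epsilon>/M * h * (M - 1)" by (simp add: M_def)
    also have "\<dots> \<le> \<epsilon>/M * h * M" using em h by (intro mult_left_mono mult_nonneg_nonneg) linarith+
    also have "\<dots> = \<epsilon> * h" using M by simp
    finally have "\<bar>h * (a \<bullet> (p1 - p2))\<bar> \<le> \<epsilon> * h\<^sup>2"
      using h by (simp add: abs_mult power2_eq_square mult_left_mono)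
    then show ?case using eq unfolding \<phi>_def by (simp add: algebra_simps)
  qed
qed

text \<open>The second difference does not change when \<open>a\<close> and \<open>b\<close> are
  swapped, but it approximates both \<open>h\<^sup>2 * (a \<bullet> H b)\<close> and
  \<open>h\<^sup>2 * (b \<bullet> H a)\<close> up to \<open>\<epsilon> * h\<^sup>2\<close>. With a
  third of their gap as \<epsilon> this is contradictory.\<close>

lemma second_derivative_symmetric:
  fixes u :: "'a::euclidean_space \<Rightarrow> real"
  assumes S: "open S" "x \<in> S" and g: "\<And>y. y \<in> S \<Longrightarrow> GDERIV u y :> g y"
    and H: "(g has_derivative H) (at x)"
  shows "a \<bullet> H b = b \<bullet> H a"
proof (rule ccontr)
  assume "a \<bullet> H b \<noteq> b \<bullet> H a"
  define \<epsilon> where "\<epsilon> = \<bar>a \<bullet> H b - b \<bullet> H a\<bar> / 3"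
  have \<epsilon>: "\<epsilon> > 0" using \<open>a \<bullet> H b \<noteq> b \<bullet> H a\<close> by (simp add: \<epsilon>_def)
  have bd: "\<forall>\<^sub>F h in at_right 0. \<bar>(u (x + h *\<^sub>R a + h *\<^sub>R b) - u (x + h *\<^sub>R a) - u (x + h *\<^sub>R b) + u x)
            - h\<^sup>2 * (a \<bullet> H b)\<bar> \<le> \<epsilon> * h\<^sup>2" for a b
    by (rule second_derivative_diff_bound[OF S _ H \<epsilon>]) (rule g)
  have "\<forall>\<^sub>F h in at_right (0::real). False"
    using bd[of a b] bd[of b a] eventually_at_right_less[of "0::real"]
  proof eventually_elim
    case (elim h)
    define D where "D = u (x + h *\<^sub>R a + h *\<^sub>R b) - u (x + h *\<^sub>R a) - u (x + h *\<^sub>R b) + u x"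
    have D': "u (x + h *\<^sub>R b + h *\<^sub>R a) - u (x + h *\<^sub>R b) - u (x + h *\<^sub>R a) + u x = D"
      unfolding D_def by (simp add: algebra_simps)
    have "\<bar>h\<^sup>2 * (a \<bullet> H b) - h\<^sup>2 * (b \<bullet> H a)\<bar> \<le> 2 * (\<epsilon> * h\<^sup>2)"
      using elim(1,2) unfolding D' D_def[symmetric] by linarith
    moreover have "\<bar>h\<^sup>2 * (a \<bullet> H b) - h\<^sup>2 * (b \<bullet> H a)\<bar> = h\<^sup>2 * \<bar>a \<bullet> H b - b \<bullet> H a\<bar>"
      by (simp add: right_diff_distrib[symmetric] abs_mult)
    ultimately have "h\<^sup>2 * \<bar>a \<bullet> H b - b \<bullet> H a\<bar> \<le> h\<^sup>2 * (2 * \<epsilon>)"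
      by (simp add: mult.commute mult.left_commute)
    then have "\<bar>a \<bullet> H b - b \<bullet> H a\<bar> \<le> 2 * \<epsilon>"
      using elim(3) by (simp add: mult_le_cancel_left)
    then show False using \<epsilon> by (simp add: \<epsilon>_def)
  qed
  then show False by simp
qed

section \<open>The gradient of a nonnegative harmonic function\<close>

definition complex_to_plane :: "complex \<Rightarrow> real ^ 2" where
  "complex_to_plane w = vector [Re w, Im w]"

lemma complex_to_plane_nth [simp]:
  "complex_to_plane w $ 1 = Re w" "complex_to_plane w $ 2 = Im w"
  by (simp_all add: complex_to_plane_def)

lemma plane_eq_iff: "(x::real^2) = y \<longleftrightarrow> x $ 1 = y $ 1 \<and> x $ 2 = y $ 2"
  by (auto simp: vec_eq_iff forall_2)

lemma inner_plane: "(x::real^2) \<bullet> y = x $ 1 * y $ 1 + x $ 2 * y $ 2"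
  by (simp add: inner_vec_def sum_2)

lemma norm_plane: "(norm (x::real^2))\<^sup>2 = (x $ 1)\<^sup>2 + (x $ 2)\<^sup>2"
  by (simp only: power2_norm_eq_inner inner_plane) (simp add: power2_eq_square)

lemma norm_complex_to_plane [simp]: "norm (complex_to_plane w) = norm w"
  by (rule power2_eq_imp_eq) (simp_all add: norm_plane cmod_power2)

lemma linear_complex_to_plane: "linear complex_to_plane"
  by (rule linearI) (simp_all add: plane_eq_iff)

lemma Basis_plane: "Basis = {axis 1 1, axis 2 1 :: real^2}"
  by (auto simp: Basis_vec_def) (metis exhaust_2)

lemma sum_Basis_plane:
  "(\<Sum>e\<in>(Basis::(real^2) set). f e) = f (axis 1 1) + f (axis 2 1)"
  by (simp add: Basis_plane axis_eq_axis)

text \<open>The function \<open>q\<close>, the x-derivative of \<open>u\<close> minus \<i> times the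
  y-derivative, is holomorphic: its Cauchy-Riemann equations are the symmetry and the vanishing
  trace of the Hessian. A primitive of \<open>q\<close> on the disk has real part \<open>u\<close>
  up to a constant, and its derivative at 0 is the conjugate of the gradient.\<close>

lemma harmonic_on_ball_eq_Re:
  fixes u :: "real ^ 2 \<Rightarrow> real"
  assumes r: "r > 0" and u: "harmonic_on (ball z r) u" and grad: "GDERIV u z :> c"
  obtains F where "F holomorphic_on ball 0 r"
    "\<And>w. w \<in> ball 0 r \<Longrightarrow> u (z + complex_to_plane w) = Re (F w)"
    "norm (deriv F 0) = norm c"
proof -
  let ?\<phi> = "complex_to_plane"
  obtain g H where g: "\<And>x. x \<in> ball z r \<Longrightarrow> GDERIV u x :> g x"
    and H: "\<And>x. x \<in> ball z r \<Longrightarrow> (g has_derivative H x) (at x)"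
    and tr: "\<And>x. x \<in> ball z r \<Longrightarrow> (\<Sum>e\<in>Basis. e \<bullet> H x e) = 0"
    by (rule harmonic_onE[OF open_ball u]) blast
  have c: "c = g z" using GDERIV_unique[OF grad g] r by simp
  have inb: "z + ?\<phi> w \<in> ball z r" if "w \<in> ball 0 r" for w
  proof -
    have "dist z (z + ?\<phi> w) = norm (?\<phi> w)" by (metis add_diff_cancel_left' dist_commute dist_norm)
    then show ?thesis using that by simp
  qed
  have \<phi>': "((\<lambda>w. z + ?\<phi> w) has_derivative ?\<phi>) (at w)" for w
    using linear_imp_has_derivative[OF linear_complex_to_plane, of "at w"]
    by (auto intro!: derivative_eq_intros)
  define q where "q w = complex_of_real (g (z + ?\<phi> w) $ 1) - \<i> * complex_of_real (g (z + ?\<phi> w) $ 2)" for w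
  have q': "\<exists>d. (q has_field_derivative d) (at w)" if w: "w \<in> ball 0 r" for w
  proof -
    define x where "x = z + ?\<phi> w"
    have x: "x \<in> ball z r" using inb[OF w] by (simp add: x_def)
    have lin: "linear (H x)" using H[OF x] has_derivative_linear by blast
    define a b where "a = H x (axis 1 1) $ 1" and "b = H x (axis 1 1) $ 2"
    have sym: "H x (axis 2 1) $ 1 = b"
      using second_derivative_symmetric[OF open_ball x _ H[OF x], of u "axis 1 1" "axis 2 1"] g
      by (simp add: inner_axis' b_def)
    have trace: "H x (axis 2 1) $ 2 = - a"
      using tr[OF x] by (simp add: sum_Basis_plane inner_axis' a_def)
    have Hh: "H x (?\<phi> h) = vector [a * Re h + b * Im h, b * Re h - a * Im h]" for h
    proof -
      have "?\<phi> h = Re h *\<^sub>R axis 1 1 + Im h *\<^sub>R axis 2 1"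
        by (simp add: plane_eq_iff axis_def)
      then have "H x (?\<phi> h) = Re h *\<^sub>R H x (axis 1 1) + Im h *\<^sub>R H x (axis 2 1)"
        using lin by (simp add: linear_add linear_cmul)
      then show ?thesis by (simp add: plane_eq_iff sym trace a_def[symmetric] b_def[symmetric])
    qed
    have "((\<lambda>w. g (z + ?\<phi> w)) has_derivative (\<lambda>h. H x (?\<phi> h))) (at w)"
      using has_derivative_compose[OF \<phi>' H[OF x, unfolded x_def]] by (simp add: x_def)
    then have 1: "((\<lambda>w. g (z + ?\<phi> w) $ i) has_derivative (\<lambda>h. H x (?\<phi> h) $ i)) (at w)" for i
      by (rule bounded_linear.has_derivative[OF bounded_linear_vec_nth])
    have "(q has_derivative (\<lambda>h. complex_of_real (H x (?\<phi> h) $ 1) - \<i> * complex_of_real (H x (?\<phi> h) $ 2))) (at w)"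
      unfolding q_def by (intro has_derivative_diff has_derivative_mult_right has_derivative_of_real 1)
    moreover have "(\<lambda>h. complex_of_real (H x (?\<phi> h) $ 1) - \<i> * complex_of_real (H x (?\<phi> h) $ 2))
        = (*) (Complex a (-b))"
      by (auto simp: Hh fun_eq_iff complex_eq_iff)
    ultimately show ?thesis unfolding has_field_derivative_def by metis
  qed
  then have "q holomorphic_on ball 0 r"
    by (simp add: holomorphic_on_open)
  then obtain Q where Q: "\<And>w. w \<in> ball 0 r \<Longrightarrow> (Q has_field_derivative q w) (at w within ball 0 r)"
    by (rule holomorphic_convex_primitive'[OF convex_ball open_ball]) blast
  then have Q: "(Q has_field_derivative q w) (at w)" if "w \<in> ball 0 r" for w
    using that by (metis at_within_open open_ball)
  have const: "((\<lambda>w. Re (Q w) - u (z + ?\<phi> w)) has_derivative (\<lambda>h. 0)) (at w within ball 0 r)"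
    if w: "w \<in> ball 0 r" for w
  proof -
    have 1: "((\<lambda>w. Re (Q w)) has_derivative (\<lambda>h. Re (q w * h))) (at w)"
      by (rule has_derivative_Re) (use Q[OF w] in \<open>simp add: has_field_derivative_def\<close>)
    have 2: "((\<lambda>w. u (z + ?\<phi> w)) has_derivative (\<lambda>h. ?\<phi> h \<bullet> g (z + ?\<phi> w))) (at w)"
      using has_derivative_compose[OF \<phi>' g[OF inb[OF w], unfolded gderiv_def]] .
    have "((\<lambda>w. Re (Q w) - u (z + ?\<phi> w)) has_derivative (\<lambda>h. Re (q w * h) - ?\<phi> h \<bullet> g (z + ?\<phi> w))) (at w)"
      by (intro has_derivative_diff 1 2)
    moreover have "(\<lambda>h. Re (q w * h) - ?\<phi> h \<bullet> g (z + ?\<phi> w)) = (\<lambda>h. 0)"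
      by (auto simp: q_def inner_plane fun_eq_iff algebra_simps)
    ultimately show ?thesis by (simp add: has_derivative_at_withinI)
  qed
  have "continuous_on (ball 0 r) (\<lambda>w. Re (Q w) - u (z + ?\<phi> w))"
    by (rule has_derivative_continuous_on[OF const])
  then have eq: "Re (Q w) - u (z + ?\<phi> w) = Re (Q 0) - u (z + ?\<phi> 0)" if "w \<in> ball 0 r" for w
    using has_derivative_zero_unique_strong_convex[of "ball 0 r" "{}" "\<lambda>w. Re (Q w) - u (z + ?\<phi> w)" 0 _ w]
      const that r by simp
  define F where "F w = Q w - complex_of_real (Re (Q 0) - u (z + ?\<phi> 0))" for w
  have F': "(F has_field_derivative q w) (at w)" if "w \<in> ball 0 r" for w
    unfolding F_def using Q[OF that] by (auto intro!: derivative_eq_intros)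
  show thesis
  proof (rule that[of F])
    show "F holomorphic_on ball 0 r" unfolding holomorphic_on_open[OF open_ball] using F' by blast
    show "u (z + ?\<phi> w) = Re (F w)" if "w \<in> ball 0 r" for w
      using eq[OF that] by (simp add: F_def)
    have z0: "z + ?\<phi> 0 = z" by (simp add: linear_0[OF linear_complex_to_plane])
    have "deriv F 0 = q 0" using F'[of 0] r by (simp add: DERIV_imp_deriv)
    also have "norm \<dots> = norm c"
      by (rule power2_eq_imp_eq) (simp_all add: cmod_power2 q_def z0 c norm_plane)
    finally show "norm (deriv F 0) = norm c" .
  qed
qed

text \<open>\<open>F\<close> takes values in the right half plane. The Cayley transform that sends
  \<open>F 0\<close> to 0 maps this half plane into the unit disk, where the Schwarz lemma
  applies.\<close>

lemma harmonic_gradient_bound_pos: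
  fixes u :: "real ^ 2 \<Rightarrow> real"
  assumes r: "r > 0" and u: "harmonic_on (ball z r) u" and grad: "GDERIV u z :> c"
    and pos: "\<And>x. x \<in> ball z r \<Longrightarrow> u x > 0"
  shows "norm c \<le> 2 / r * u z"
proof -
  obtain F where F: "F holomorphic_on ball 0 r"
    "\<And>w. w \<in> ball 0 r \<Longrightarrow> u (z + complex_to_plane w) = Re (F w)"
    "norm (deriv F 0) = norm c"
    by (rule harmonic_on_ball_eq_Re[OF r u grad]) blast
  have z0: "z + complex_to_plane 0 = z" by (simp add: linear_0[OF linear_complex_to_plane])
  have F0: "Re (F 0) = u z" using F(2)[of 0] r z0 by simp
  have Fpos: "Re (F w) > 0" if "w \<in> ball 0 r" for w
  proof -
    have "dist z (z + complex_to_plane w) = norm (complex_to_plane w)"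
      by (metis add_diff_cancel_left' dist_commute dist_norm)
    then show ?thesis using that pos[of "z + complex_to_plane w"] F(2)[OF that] by simp
  qed
  have uz: "u z > 0" using pos r by simp
  define f where "f w = (F (of_real r * w) - F 0) / (F (of_real r * w) + cnj (F 0))" for w
  have rb: "of_real r * w \<in> ball 0 r" if "w \<in> ball 0 1" for w :: complex
    using that r by (simp add: norm_mult)
  have nz: "F (of_real r * w) + cnj (F 0) \<noteq> 0" if "w \<in> ball 0 1" for w
  proof -
    have "Re (F (of_real r * w) + cnj (F 0)) > 0" using Fpos[OF rb[OF that]] uz F0 by simp
    then show ?thesis by fastforce
  qed
  have hol: "(\<lambda>w. F (of_real r * w)) holomorphic_on ball 0 1"
    by (rule holomorphic_on_compose_gen[OF _ F(1), unfolded o_def]) (auto intro!: holomorphic_intros simp: rb[simplified])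
  have fhol: "f holomorphic_on ball 0 1"
    unfolding f_def using nz by (intro holomorphic_intros hol) auto
  have lt: "norm (f w) < 1" if "norm w < 1" for w
  proof -
    have w: "w \<in> ball 0 1" using that by simp
    define A B where "A = F (of_real r * w)" and "B = F 0"
    have "Re A > 0" "Re B > 0" using Fpos[OF rb[OF w]] uz F0 by (auto simp: A_def B_def)
    then have "0 < Re A * Re B" by simp
    \<comment> \<open>The two squares differ by \<open>4 * Re A * Re B\<close>.\<close>
    then have "(norm (A - B))\<^sup>2 < (norm (A + cnj B))\<^sup>2"
      unfolding cmod_power2 by (simp add: power2_eq_square algebra_simps)
    then have "norm (A - B) < norm (A + cnj B)" by (rule power2_less_imp_less) simp
    moreover have "norm (A + cnj B) > 0" using nz[OF w] by (simp add: A_def B_def)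
    ultimately show ?thesis by (simp add: f_def A_def B_def norm_divide)
  qed
  have "norm (deriv f 0) \<le> 1"
    by (rule Schwarz_Lemma(2)[OF fhol _ lt, of 0]) (auto simp: f_def)
  \<comment> \<open>The numerator of \<open>f\<close> vanishes at 0, so only its derivative counts,
    divided by \<open>F 0 + cnj (F 0)\<close>, which is \<open>2 * u z\<close>. This is where the
    factor 2 of the bound comes from.\<close>
  moreover have "(f has_field_derivative (of_real r * deriv F 0 / of_real (2 * u z))) (at 0)"
  proof -
    have "(F has_field_derivative deriv F 0) (at 0)"
      using F(1) r by (simp add: holomorphic_derivI)
    then have d: "((\<lambda>w. F (of_real r * w)) has_field_derivative (deriv F 0 * of_real r)) (at 0)"
      by (intro DERIV_chain2[where f=F and g="\<lambda>w. of_real r * w"]) (auto intro!: derivative_eq_intros)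
    have s: "F 0 + cnj (F 0) = of_real (2 * u z)" by (simp add: complex_add_cnj F0)
    show ?thesis unfolding f_def
      by (rule derivative_eq_intros d | use s uz in \<open>simp add: s field_simps\<close>)+
  qed
  then have "deriv f 0 = of_real r * deriv F 0 / of_real (2 * u z)" by (rule DERIV_imp_deriv)
  ultimately have "r * norm c / (2 * u z) \<le> 1"
    using r uz F(3) by (simp add: norm_divide norm_mult)
  then show ?thesis using r uz by (simp add: field_simps)
qed

text \<open>Adding a small constant makes \<open>u\<close> strictly positive, keeps the gradient,
  and costs arbitrarily little on the right.\<close>

lemma harmonic_gradient_bound:
  fixes u :: "real ^ 2 \<Rightarrow> real"
  assumes r: "r > 0" and u: "harmonic_on (ball z r) u" and grad: "GDERIV u z :> c"
    and nonneg: "\<And>x. x \<in> ball z r \<Longrightarrow> u x \<ge> 0"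
  shows "norm c \<le> 2 / r * u z"
proof (rule field_le_epsilon)
  fix e :: real assume e: "e > 0"
  define \<epsilon> where "\<epsilon> = e * r / 2"
  have \<epsilon>: "\<epsilon> > 0" using e r by (simp add: \<epsilon>_def)
  have "norm c \<le> 2 / r * (u z + \<epsilon>)"
  proof (rule harmonic_gradient_bound_pos[OF r, where u="\<lambda>x. u x + \<epsilon>"])
    show "harmonic_on (ball z r) (\<lambda>x. u x + \<epsilon>)"
      by (intro harmonic_on_add harmonic_on_const u open_ball)
    show "GDERIV (\<lambda>x. u x + \<epsilon>) z :> c"
      using GDERIV_add[OF grad GDERIV_const] by simp
  qed (use nonneg \<epsilon> in \<open>simp add: add_nonneg_pos\<close>)
  also have "\<dots> = 2 / r * u z + e" using r by (simp add: \<epsilon>_def field_simps)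
  finally show "norm c \<le> 2 / r * u z + e" .
qed

section \<open>The discrete Laplacian and the maximum principle\<close>

definition discrete_laplacian :: "('a::euclidean_space \<Rightarrow> real) \<Rightarrow> 'a \<Rightarrow> real \<Rightarrow> real" where
  "discrete_laplacian u x h = (\<Sum>e\<in>Basis. u (x + h *\<^sub>R e) + u (x - h *\<^sub>R e) - 2 * u x)"

text \<open>The quotient is the analogue of the symmetric second derivative in several variables.
  The notion asks for no differentiability, so it can be verified for \<open>k\<close> in its second
  argument. Continuity up to the boundary is included because the comparison principle needs both
  parts.\<close>

definition weakly_harmonic_on :: "'a::euclidean_space set \<Rightarrow> ('a \<Rightarrow> real) \<Rightarrow> bool" where
  "weakly_harmonic_on S u \<longleftrightarrow> continuous_on (closure S) u \<and>
     (\<forall>x\<in>S. ((\<lambda>h. discrete_laplacian u x h / h\<^sup>2) \<longlongrightarrow> 0) (at_right 0))"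

lemma discrete_laplacian_lincomb:
  "discrete_laplacian (\<lambda>x. a * u x + b * v x) x h
     = a * discrete_laplacian u x h + b * discrete_laplacian v x h"
  unfolding discrete_laplacian_def sum_distrib_left sum.distrib[symmetric]
  by (rule sum.cong) (auto simp: algebra_simps)

lemma discrete_laplacian_diff:
  "discrete_laplacian (\<lambda>x. u x - v x) x h = discrete_laplacian u x h - discrete_laplacian v x h"
  using discrete_laplacian_lincomb[of 1 u "-1" v] by simp

lemma discrete_laplacian_const: "discrete_laplacian (\<lambda>x. c) x h = 0"
  by (simp add: discrete_laplacian_def)

lemma weakly_harmonic_on_lincomb:
  assumes "weakly_harmonic_on S u" "weakly_harmonic_on S v"
  shows "weakly_harmonic_on S (\<lambda>x. a * u x + b * v x)"
  unfolding weakly_harmonic_on_def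
proof (intro conjI ballI)
  show "continuous_on (closure S) (\<lambda>x. a * u x + b * v x)"
    using assms unfolding weakly_harmonic_on_def by (intro continuous_intros) auto
  fix x assume "x \<in> S"
  then have "((\<lambda>h. a * (discrete_laplacian u x h / h\<^sup>2) + b * (discrete_laplacian v x h / h\<^sup>2))
      \<longlongrightarrow> a * 0 + b * 0) (at_right 0)"
    using assms unfolding weakly_harmonic_on_def by (intro tendsto_intros) auto
  then show "((\<lambda>h. discrete_laplacian (\<lambda>x. a * u x + b * v x) x h / h\<^sup>2) \<longlongrightarrow> 0) (at_right 0)"
    by (simp add: discrete_laplacian_lincomb add_divide_distrib)
qed

lemma weakly_harmonic_on_const: "weakly_harmonic_on S (\<lambda>x. c)"
  by (simp add: weakly_harmonic_on_def discrete_laplacian_const)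

lemma weakly_harmonic_on_add:
  "weakly_harmonic_on S u \<Longrightarrow> weakly_harmonic_on S v \<Longrightarrow> weakly_harmonic_on S (\<lambda>x. u x + v x)"
  using weakly_harmonic_on_lincomb[of S u v 1 1] by simp

lemma weakly_harmonic_on_diff:
  "weakly_harmonic_on S u \<Longrightarrow> weakly_harmonic_on S v \<Longrightarrow> weakly_harmonic_on S (\<lambda>x. u x - v x)"
  using weakly_harmonic_on_lincomb[of S u v 1 "-1"] by simp

lemma weakly_harmonic_on_cmult:
  "weakly_harmonic_on S u \<Longrightarrow> weakly_harmonic_on S (\<lambda>x. a * u x)"
  using weakly_harmonic_on_lincomb[of S u u a 0] by simp

lemma weakly_harmonic_on_subset:
  assumes "weakly_harmonic_on S u" "T \<subseteq> S" shows "weakly_harmonic_on T u"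
  using assms closure_mono[of T S] unfolding weakly_harmonic_on_def
  by (meson continuous_on_subset subsetD)

lemma weakly_harmonic_on_sum:
  "finite I \<Longrightarrow> (\<And>i. i \<in> I \<Longrightarrow> weakly_harmonic_on S (u i)) \<Longrightarrow> weakly_harmonic_on S (\<lambda>x. \<Sum>i\<in>I. u i x)"
  by (induction I rule: finite_induct) (auto intro: weakly_harmonic_on_const weakly_harmonic_on_add)

lemma discrete_laplacian_sq:
  "discrete_laplacian (\<lambda>x. (norm x)\<^sup>2) (x::'a::euclidean_space) h = 2 * real DIM('a) * h\<^sup>2"
proof -
  have "(norm (x + h *\<^sub>R e))\<^sup>2 + (norm (x - h *\<^sub>R e))\<^sup>2 - 2 * (norm x)\<^sup>2 = 2 * h\<^sup>2" if "e \<in> Basis" for e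
    using that by (simp add: power2_norm_eq_inner algebra_simps inner_commute) (simp add: power2_eq_square)
  then show ?thesis by (simp add: discrete_laplacian_def)
qed

lemma eventually_neighbours_in_open:
  fixes y :: "'a::euclidean_space"
  assumes "open S" "y \<in> S"
  shows "\<forall>\<^sub>F h in at_right 0. \<forall>e\<in>Basis. y + h *\<^sub>R e \<in> S \<and> y - h *\<^sub>R e \<in> S"
proof -
  have "\<forall>\<^sub>F h in at_right 0. y + h *\<^sub>R e \<in> S \<and> y - h *\<^sub>R e \<in> S" for e
  proof -
    have "\<forall>\<^sub>F h in nhds 0. y + h *\<^sub>R e \<in> S" "\<forall>\<^sub>F h in nhds 0. y + h *\<^sub>R (- e) \<in> S"
      by (rule eventually_line_in_open[OF assms])+
    then show ?thesis
      by (auto simp: eventually_at_filter elim: eventually_elim2)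
  qed
  then show ?thesis by (simp add: eventually_ball_finite)
qed

text \<open>At an interior minimum of \<open>u - \<epsilon> |x|\<^sup>2\<close> the discrete Laplacian of \<open>u\<close> would be at least
  \<open>2 \<epsilon> d h\<^sup>2\<close> in dimension \<open>d\<close>.\<close>

lemma weak_minimum_principle:
  fixes u :: "'a::euclidean_space \<Rightarrow> real"
  assumes U: "open U" "bounded U" and u: "weakly_harmonic_on U u"
    and bd: "\<And>x. x \<in> frontier U \<Longrightarrow> u x \<ge> 0" and x: "x \<in> closure U"
  shows "u x \<ge> 0"
proof (rule ccontr)
  assume neg: "\<not> u x \<ge> 0"
  obtain R where R: "R > 0" "\<And>y. y \<in> closure U \<Longrightarrow> norm y \<le> R"
    using bounded_closure[OF U(2)] bounded_pos by blast
  \<comment> \<open>With this choice the quadratic term is at most \<open>- u x / 2\<close> on the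
    closure, so \<open>w\<close> is at least \<open>u x / 2\<close> on the frontier. That exceeds
    \<open>w x\<close>, and the minimum of \<open>w\<close> is forced into the interior.\<close>
  define \<epsilon> where "\<epsilon> = - u x / (2 * R\<^sup>2)"
  have \<epsilon>: "\<epsilon> > 0" using neg R by (simp add: \<epsilon>_def divide_neg_pos)
  define w where "w y = u y - \<epsilon> * (norm y)\<^sup>2" for y
  have cpt: "compact (closure U)" using U(2) by (simp add: compact_closure)
  have cont: "continuous_on (closure U) w"
    unfolding w_def using u by (auto intro!: continuous_intros simp: weakly_harmonic_on_def)
  have "\<exists>y\<in>closure U. \<forall>v\<in>closure U. w y \<le> w v"
    by (rule continuous_attains_inf[OF cpt _ cont]) (use x in auto)
  then obtain y where y: "y \<in> closure U" "\<And>v. v \<in> closure U \<Longrightarrow> w y \<le> w v"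
    by auto
  have "y \<in> U"
  proof (rule ccontr)
    assume "y \<notin> U"
    then have "y \<in> frontier U" using y(1) U(1) by (simp add: frontier_def interior_open)
    then have "w y \<ge> - \<epsilon> * (norm y)\<^sup>2" using bd[of y] by (simp add: w_def)
    moreover have "\<epsilon> * (norm y)\<^sup>2 \<le> \<epsilon> * R\<^sup>2"
      using R(2)[OF y(1)] \<epsilon> by (intro mult_left_mono power_mono) auto
    moreover have "\<epsilon> * R\<^sup>2 = - u x / 2" using R by (simp add: \<epsilon>_def)
    moreover have "w x \<le> u x" using \<epsilon> by (simp add: w_def)
    ultimately show False using y(2)[OF x] neg by linarith
  qed
  have "\<forall>\<^sub>F h in at_right 0. \<forall>e\<in>Basis. y + h *\<^sub>R e \<in> U \<and> y - h *\<^sub>R e \<in> U"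
    using U(1) \<open>y \<in> U\<close> by (rule eventually_neighbours_in_open)
  then have "\<forall>\<^sub>F h in at_right 0. discrete_laplacian u y h / h\<^sup>2 \<ge> 2 * real DIM('a) * \<epsilon>"
    using eventually_at_right_less[of "0::real"]
  proof eventually_elim
    case (elim h)
    have "w (y + h *\<^sub>R e) \<ge> w y \<and> w (y - h *\<^sub>R e) \<ge> w y" if "e \<in> Basis" for e
      using elim(1) that y(2) closure_subset by blast
    then have "discrete_laplacian w y h \<ge> 0"
      unfolding discrete_laplacian_def by (intro sum_nonneg) (smt (verit))
    moreover have "discrete_laplacian w y h = discrete_laplacian u y h - \<epsilon> * (2 * real DIM('a) * h\<^sup>2)"
      using discrete_laplacian_lincomb[of 1 u "-\<epsilon>" "\<lambda>x. (norm x)\<^sup>2" y h]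
      unfolding w_def[abs_def] using discrete_laplacian_sq[of y h] by simp
    ultimately show ?case using elim(2) by (simp add: pos_le_divide_eq algebra_simps)
  qed
  moreover have "((\<lambda>h. discrete_laplacian u y h / h\<^sup>2) \<longlongrightarrow> 0) (at_right 0)"
    using u \<open>y \<in> U\<close> by (simp add: weakly_harmonic_on_def)
  ultimately have "2 * real DIM('a) * \<epsilon> \<le> 0"
    by (intro tendsto_lowerbound) auto
  moreover have "2 * real DIM('a) * \<epsilon> > 0" using \<epsilon> by simp
  ultimately show False by linarith
qed

lemma weak_comparison:
  fixes u v :: "'a::euclidean_space \<Rightarrow> real"
  assumes "open U" "bounded U" "weakly_harmonic_on U u" "weakly_harmonic_on U v"
    and "\<And>x. x \<in> frontier U \<Longrightarrow> u x \<le> v x" "x \<in> closure U"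
  shows "u x \<le> v x"
  using weak_minimum_principle[OF assms(1,2) weakly_harmonic_on_diff[OF assms(4,3)], of x] assms by simp

lemma weak_abs_bound:
  fixes u :: "'a::euclidean_space \<Rightarrow> real"
  assumes "open U" "bounded U" "weakly_harmonic_on U u"
    and "\<And>x. x \<in> frontier U \<Longrightarrow> \<bar>u x\<bar> \<le> M" "x \<in> closure U"
  shows "\<bar>u x\<bar> \<le> M"
proof -
  have "u x \<le> M"
    by (rule weak_comparison[OF assms(1,2,3) weakly_harmonic_on_const _ assms(5)]) (use assms(4) in fastforce)
  moreover have "- M \<le> u x"
    by (rule weak_comparison[OF assms(1,2) weakly_harmonic_on_const assms(3) _ assms(5)]) (use assms(4) in fastforce)
  ultimately show ?thesis by simp
qed

text \<open>For \<open>b = - a\<close> the fourth vertex of the second difference returns to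
  \<open>x\<close>, which leaves the centred difference with the opposite sign. Summation over the
  basis produces the trace of the Hessian.\<close>

lemma harmonic_on_discrete_laplacian:
  fixes u :: "'a::euclidean_space \<Rightarrow> real"
  assumes S: "open S" "harmonic_on S u" "x \<in> S"
  shows "((\<lambda>h. discrete_laplacian u x h / h\<^sup>2) \<longlongrightarrow> 0) (at_right 0)"
proof -
  obtain g H where g: "\<And>x. x \<in> S \<Longrightarrow> GDERIV u x :> g x"
    and H: "\<And>x. x \<in> S \<Longrightarrow> (g has_derivative H x) (at x)"
    and tr: "\<And>x. x \<in> S \<Longrightarrow> (\<Sum>e\<in>Basis. e \<bullet> H x e) = 0"
    by (rule harmonic_onE[OF S(1,2)]) blast
  have lin: "linear (H x)" using H[OF S(3)] has_derivative_linear by blast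
  have "((\<lambda>h. (u (x + h *\<^sub>R e) + u (x - h *\<^sub>R e) - 2 * u x) / h\<^sup>2) \<longlongrightarrow> e \<bullet> H x e) (at_right 0)"
    for e :: 'a
  proof (rule tendstoI)
    fix \<epsilon> :: real assume "\<epsilon> > 0"
    then have "\<epsilon> / 2 > 0" by simp
    have "\<forall>\<^sub>F h in at_right 0. \<bar>(u (x + h *\<^sub>R e + h *\<^sub>R (- e)) - u (x + h *\<^sub>R e) - u (x + h *\<^sub>R (- e)) + u x)
            - h\<^sup>2 * (e \<bullet> H x (- e))\<bar> \<le> \<epsilon> / 2 * h\<^sup>2"
      by (rule second_derivative_diff_bound[OF S(1,3) _ H[OF S(3)] \<open>\<epsilon> / 2 > 0\<close>]) (rule g)
    then show "\<forall>\<^sub>F h in at_right 0. dist ((u (x + h *\<^sub>R e) + u (x - h *\<^sub>R e) - 2 * u x) / h\<^sup>2) (e \<bullet> H x e) < \<epsilon>"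
      using eventually_at_right_less[of "0::real"]
    proof eventually_elim
      case (elim h)
      have "\<bar>(u (x + h *\<^sub>R e) + u (x - h *\<^sub>R e) - 2 * u x) - h\<^sup>2 * (e \<bullet> H x e)\<bar> \<le> \<epsilon> / 2 * h\<^sup>2"
      proof -
        have "(u (x + h *\<^sub>R e + h *\<^sub>R (- e)) - u (x + h *\<^sub>R e) - u (x + h *\<^sub>R (- e)) + u x) - h\<^sup>2 * (e \<bullet> H x (- e))
            = - ((u (x + h *\<^sub>R e) + u (x - h *\<^sub>R e) - 2 * u x) - h\<^sup>2 * (e \<bullet> H x e))"
          by (simp add: linear_neg[OF lin])
        with elim(1) show ?thesis by (metis abs_minus_cancel)
      qed
      moreover have "(u (x + h *\<^sub>R e) + u (x - h *\<^sub>R e) - 2 * u x) - h\<^sup>2 * (e \<bullet> H x e)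
          = h\<^sup>2 * ((u (x + h *\<^sub>R e) + u (x - h *\<^sub>R e) - 2 * u x) / h\<^sup>2 - e \<bullet> H x e)"
        using elim(2) by (simp add: field_simps)
      ultimately have "h\<^sup>2 * \<bar>(u (x + h *\<^sub>R e) + u (x - h *\<^sub>R e) - 2 * u x) / h\<^sup>2 - e \<bullet> H x e\<bar> \<le> h\<^sup>2 * (\<epsilon> / 2)"
        by (simp add: abs_mult mult.commute)
      then have "\<bar>(u (x + h *\<^sub>R e) + u (x - h *\<^sub>R e) - 2 * u x) / h\<^sup>2 - e \<bullet> H x e\<bar> \<le> \<epsilon> / 2"
        using elim(2) by (simp only: mult_le_cancel_left_pos zero_less_power)
      then show ?case using \<open>\<epsilon> > 0\<close> by (simp add: dist_real_def)
    qed
  qed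
  then have "((\<lambda>h. \<Sum>e\<in>Basis. (u (x + h *\<^sub>R e) + u (x - h *\<^sub>R e) - 2 * u x) / h\<^sup>2)
      \<longlongrightarrow> (\<Sum>e\<in>Basis. e \<bullet> H x e)) (at_right 0)"
    by (intro tendsto_sum)
  then show ?thesis by (simp add: discrete_laplacian_def sum_divide_distrib tr[OF S(3)])
qed

lemma harmonic_on_imp_continuous_on:
  fixes u :: "'a::euclidean_space \<Rightarrow> real"
  assumes "harmonic_on S u" shows "continuous_on S u"
  using assms unfolding harmonic_on_def C2_on_def gderiv_def
  by (meson continuous_at_imp_continuous_on has_derivative_continuous)

lemma harmonic_on_imp_weakly:
  assumes "open S" "harmonic_on S u" "continuous_on (closure S) u"
  shows "weakly_harmonic_on S u"
  using assms harmonic_on_discrete_laplacian unfolding weakly_harmonic_on_def by blast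

section \<open>The logarithm of the distance to a point\<close>

lemma GDERIV_ln_norm:
  assumes "x \<noteq> p"
  shows "GDERIV (\<lambda>x. ln (norm (x - p))) x :> (x - p) /\<^sub>R (norm (x - p))\<^sup>2"
proof -
  have n: "norm (x - p) > 0" using assms by simp
  have "((\<lambda>x. x - p) has_derivative (\<lambda>h. h)) (at x)" by (auto intro!: derivative_eq_intros)
  moreover have "(norm has_derivative (\<lambda>h. h \<bullet> sgn (x - p))) (at (x - p))"
    using assms by (intro has_derivative_norm) simp
  ultimately have "GDERIV (\<lambda>x. norm (x - p)) x :> sgn (x - p)"
    unfolding gderiv_def by (rule has_derivative_compose)
  from GDERIV_DERIV_compose[OF this DERIV_ln[OF n]]
  show ?thesis by (simp add: sgn_div_norm power2_eq_square)
qed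

text \<open>The trace of the Hessian is the dimension minus 2, divided by
  \<open>(norm (x - p))\<^sup>2\<close>, hence 0 in the plane.\<close>

lemma harmonic_on_ln_norm:
  fixes p :: "real ^ 2"
  shows "harmonic_on (- {p}) (\<lambda>x. ln (norm (x - p)))"
proof (rule harmonic_onI[where g="\<lambda>x. (x - p) /\<^sub>R (norm (x - p))\<^sup>2" and
      H="\<lambda>x h. h /\<^sub>R (norm (x - p))\<^sup>2 - (2 * ((x - p) \<bullet> h) / (norm (x - p))^4) *\<^sub>R (x - p)"])
  fix x :: "real ^ 2" assume "x \<in> - {p}"
  then have x: "x \<noteq> p" by simp
  then have n: "norm (x - p) > 0" by simp
  show "GDERIV (\<lambda>x. ln (norm (x - p))) x :> (x - p) /\<^sub>R (norm (x - p))\<^sup>2"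
    using x by (rule GDERIV_ln_norm)
  define D where "D y = (norm (y - p))\<^sup>2" for y
  have D: "(D has_derivative (\<lambda>h. 2 * ((x - p) \<bullet> h))) (at x)"
    unfolding D_def[abs_def] power2_norm_eq_inner
    by (auto intro!: derivative_eq_intros simp: inner_commute fun_eq_iff)
  have D0: "D x \<noteq> 0" using x by (simp add: D_def)
  have "((\<lambda>x. inverse (D x) *\<^sub>R (x - p)) has_derivative
      (\<lambda>h. h /\<^sub>R D x - (2 * ((x - p) \<bullet> h) / (D x)\<^sup>2) *\<^sub>R (x - p))) (at x)"
    using D0 by (auto intro!: derivative_eq_intros D simp: power2_eq_square divide_inverse fun_eq_iff mult_ac)
  then show "((\<lambda>x. (x - p) /\<^sub>R (norm (x - p))\<^sup>2) has_derivative
      (\<lambda>h. h /\<^sub>R (norm (x - p))\<^sup>2 - (2 * ((x - p) \<bullet> h) / (norm (x - p))^4) *\<^sub>R (x - p))) (at x)"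
    by (simp add: D_def)
  define v where "v = x - p"
  define s t where "s = v $ 1" and "t = v $ 2"
  define M where "M = (norm v)\<^sup>2"
  have st: "M = s\<^sup>2 + t\<^sup>2" by (simp add: norm_plane s_def t_def M_def)
  have st4: "(norm v)^4 = M\<^sup>2" unfolding M_def by simp
  have "M > 0" using n unfolding M_def v_def by simp
  then have "inverse M - 2 * s / M\<^sup>2 * s + (inverse M - 2 * t / M\<^sup>2 * t) = 0"
    by (simp add: divide_simps) (simp add: st algebra_simps power2_eq_square)
  then show "(\<Sum>e\<in>Basis. e \<bullet> (e /\<^sub>R (norm (x - p))\<^sup>2
      - (2 * ((x - p) \<bullet> e) / (norm (x - p))^4) *\<^sub>R (x - p))) = 0"
    unfolding sum_Basis_plane v_def[symmetric] M_def[symmetric] st4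
    by (simp add: inner_diff_right inner_axis' inner_axis flip: s_def t_def)
next
  show "continuous_on (- {p}) (\<lambda>x. v /\<^sub>R (norm (x - p))\<^sup>2 - (2 * ((x - p) \<bullet> v) / (norm (x - p))^4) *\<^sub>R (x - p))" for v
    by (auto intro!: continuous_intros)
qed (simp add: open_Compl)

text \<open>In complex notation the product of \<open>|w \<plusminus> h|\<close> and \<open>|w \<plusminus> \<i> h|\<close> is \<open>|w^4 - h^4|\<close>.\<close>

lemma discrete_laplacian_ln_norm:
  fixes w :: "real ^ 2"
  assumes h: "h > 0" "2 * h \<le> norm w"
  shows "\<bar>discrete_laplacian (\<lambda>x. ln (norm x)) w h\<bar> \<le> 2 * (h / norm w)^4"
proof -
  define a b where "a = w $ 1" and "b = w $ 2"
  define N where "N = a\<^sup>2 + b\<^sup>2"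
  have nw: "(norm w)\<^sup>2 = N" by (simp add: norm_plane a_def b_def N_def)
  have w0: "norm w > 0" using h by linarith
  then have N: "N > 0" using nw by (metis zero_less_power)
  \<comment> \<open>\<open>P\<close> is the real part of the fourth power of \<open>w\<close> as a
    complex number, hence at most \<open>N\<^sup>2\<close> in absolute value. It is the mixed term
    in the squared modulus \<open>N^4 - 2 * h^4 * P + h^8\<close>.\<close>
  define P where "P = a^4 - 6 * a\<^sup>2 * b\<^sup>2 + b^4"
  have P: "\<bar>P\<bar> \<le> N\<^sup>2"
  proof -
    have "N\<^sup>2 - P = 8 * (a * b)\<^sup>2" "N\<^sup>2 + P = 2 * (a\<^sup>2 - b\<^sup>2)\<^sup>2"
      unfolding P_def N_def by algebra+
    then show ?thesis using zero_le_power2[of "a * b"] zero_le_power2[of "a\<^sup>2 - b\<^sup>2"] by linarith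
  qed
  define \<tau> where "\<tau> = h^4 / N\<^sup>2"
  have \<tau>_eq: "\<tau> = (h / norm w)^4"
    by (simp add: \<tau>_def nw[symmetric] power_divide flip: power_mult)
  have "h / norm w \<le> 1/2" using h w0 by (simp add: field_simps)
  then have "\<tau> \<le> (1/2)^4" unfolding \<tau>_eq using h by (intro power_mono) auto
  then have \<tau>: "\<tau> \<le> 1/16" "\<tau> > 0" using h N by (simp_all add: \<tau>_def power_divide)
  have nz: "norm (w + v) > 0" if "norm v = h" for v
  proof -
    have "norm w \<le> norm (w + v) + norm v" using norm_triangle_ineq4[of "w + v" v] by simp
    then show ?thesis using h that by linarith
  qed
  have L: "ln (norm v) = ln ((norm v)\<^sup>2) / 2" if "norm v > 0" for v :: "real^2"
    using that by (simp add: ln_realpow)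
  define A1 A2 B1 B2 where "A1 = (a + h)\<^sup>2 + b\<^sup>2" and "A2 = (a - h)\<^sup>2 + b\<^sup>2"
    and "B1 = a\<^sup>2 + (b + h)\<^sup>2" and "B2 = a\<^sup>2 + (b - h)\<^sup>2"
  have n1: "norm (w + h *\<^sub>R axis 1 1) > 0" using h by (intro nz) simp
  have n2: "norm (w - h *\<^sub>R axis 1 1) > 0" using h nz[of "- (h *\<^sub>R axis 1 1)"] by simp
  have n3: "norm (w + h *\<^sub>R axis 2 1) > 0" using h by (intro nz) simp
  have n4: "norm (w - h *\<^sub>R axis 2 1) > 0" using h nz[of "- (h *\<^sub>R axis 2 1)"] by simp
  have e: "(norm (w + h *\<^sub>R axis 1 1))\<^sup>2 = A1" "(norm (w - h *\<^sub>R axis 1 1))\<^sup>2 = A2"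
    "(norm (w + h *\<^sub>R axis 2 1))\<^sup>2 = B1" "(norm (w - h *\<^sub>R axis 2 1))\<^sup>2 = B2"
    by (simp_all add: norm_plane axis_def a_def b_def A1_def A2_def B1_def B2_def)
  have pos: "A1 > 0" "A2 > 0" "B1 > 0" "B2 > 0"
    using n1 n2 n3 n4 e by (metis zero_less_power)+
  have "discrete_laplacian (\<lambda>x. ln (norm x)) w h = (ln A1 + ln A2 + ln B1 + ln B2 - 4 * ln N) / 2"
    unfolding discrete_laplacian_def sum_Basis_plane
    using L[OF n1] L[OF n2] L[OF n3] L[OF n4] L[OF w0] by (simp add: e nw)
  also have "ln A1 + ln A2 + ln B1 + ln B2 - 4 * ln N = ln (A1 * A2 * B1 * B2 / N^4)"
    using pos N by (simp add: ln_mult ln_div ln_realpow)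
  also have "A1 * A2 * B1 * B2 / N^4 = 1 - 2 * \<tau> * (P / N\<^sup>2) + \<tau>\<^sup>2"
  proof -
    have "A1 * A2 * B1 * B2 = N^4 - 2 * h^4 * P + h^8"
      unfolding A1_def A2_def B1_def B2_def N_def P_def by algebra
    moreover have "h^8 / N^4 = \<tau>\<^sup>2" by (simp add: \<tau>_def power_divide flip: power_mult)
    moreover have "2 * h^4 * P / N^4 = 2 * \<tau> * (P / N\<^sup>2)" by (simp add: \<tau>_def flip: power_add)
    ultimately show ?thesis using N by (simp add: add_divide_distrib diff_divide_distrib)
  qed
  finally have eq: "discrete_laplacian (\<lambda>x. ln (norm x)) w h = ln (1 - 2 * \<tau> * (P / N\<^sup>2) + \<tau>\<^sup>2) / 2" .
  define \<theta> where "\<theta> = P / N\<^sup>2"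
  have \<theta>: "\<bar>\<theta>\<bar> \<le> 1" using P N by (simp add: \<theta>_def)
  have "\<tau> * \<theta> \<le> \<tau>" "- \<tau> \<le> \<tau> * \<theta>"
    using \<tau>(2) \<theta> mult_left_mono[of \<theta> 1 \<tau>] mult_left_mono[of "-1" \<theta> \<tau>] by auto
  then have b1: "(1 - \<tau>)\<^sup>2 \<le> 1 - 2 * \<tau> * \<theta> + \<tau>\<^sup>2" and b2: "1 - 2 * \<tau> * \<theta> + \<tau>\<^sup>2 \<le> (1 + \<tau>)\<^sup>2"
    by (simp_all add: power2_eq_square algebra_simps)
  have p: "(1 - \<tau>)\<^sup>2 > 0" using \<tau> by simp
  then have "ln (1 - 2 * \<tau> * \<theta> + \<tau>\<^sup>2) \<le> ln ((1 + \<tau>)\<^sup>2)" using b1 b2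
    by (subst ln_le_cancel_iff) linarith+
  also have "\<dots> = 2 * ln (1 + \<tau>)" using \<tau> by (simp add: ln_realpow)
  also have "\<dots> \<le> 2 * \<tau>" using \<tau> ln_add_one_self_le_self[of \<tau>] by simp
  finally have u1: "ln (1 - 2 * \<tau> * \<theta> + \<tau>\<^sup>2) \<le> 2 * \<tau>" .
  \<comment> \<open>The lower bound for \<open>ln (1 - \<tau>)\<close> is
    \<open>- \<tau> - 2 * \<tau>\<^sup>2\<close>; smallness of \<tau> absorbs the square into the
    linear term.\<close>
  have "\<tau>\<^sup>2 \<le> \<tau> * (1/16)" using \<tau> by (simp add: power2_eq_square mult_left_mono)
  then have "- 2 * \<tau> \<le> ln (1 - \<tau>)"
    using ln_one_minus_pos_lower_bound[of \<tau>] \<tau> by linarith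
  moreover have "2 * ln (1 - \<tau>) = ln ((1 - \<tau>)\<^sup>2)" using \<tau> by (simp add: ln_realpow)
  moreover have "ln ((1 - \<tau>)\<^sup>2) \<le> ln (1 - 2 * \<tau> * \<theta> + \<tau>\<^sup>2)" using b1 p
    by (subst ln_le_cancel_iff) linarith+
  ultimately have "- 4 * \<tau> \<le> ln (1 - 2 * \<tau> * \<theta> + \<tau>\<^sup>2)" by linarith
  then show ?thesis using u1 \<tau> unfolding eq \<theta>_def[symmetric] \<tau>_eq[symmetric] by linarith
qed

section \<open>The kernel of a disk\<close>

lemma GDERIV_transform_open:
  assumes "GDERIV f x :> g" "open S" "x \<in> S" "\<And>y. y \<in> S \<Longrightarrow> f y = f' y"
  shows "GDERIV f' x :> g"
  using assms unfolding gderiv_def by (rule has_derivative_transform_within_open)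

lemma GDERIV_affine:
  assumes "GDERIV f x :> g" shows "GDERIV (\<lambda>x. a * f x + b) x :> a *\<^sub>R g"
proof -
  have "((\<lambda>x. a * f x + b) has_derivative (\<lambda>h. a * (h \<bullet> g) + 0)) (at x)"
    by (intro has_derivative_add has_derivative_mult_right has_derivative_const)
      (use assms in \<open>simp add: gderiv_def\<close>)
  then show ?thesis by (simp add: gderiv_def)
qed

lemma harmonic_on_cong:
  fixes u :: "'a::euclidean_space \<Rightarrow> real"
  assumes S: "open S" and u: "harmonic_on S u" and eq: "\<And>x. x \<in> S \<Longrightarrow> u x = v x"
  shows "harmonic_on S v"
proof -
  obtain g H where 1: "\<And>x. x \<in> S \<Longrightarrow> GDERIV u x :> g x"
    "\<And>x. x \<in> S \<Longrightarrow> (g has_derivative H x) (at x)"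
    "\<And>x. x \<in> S \<Longrightarrow> (\<Sum>e\<in>Basis. e \<bullet> H x e) = 0"
    "\<And>v. continuous_on S (\<lambda>x. H x v)"
    by (rule harmonic_onE[OF S u]) blast
  show ?thesis
  proof (rule harmonic_onI[OF S _ 1(2-4)])
    fix x assume "x \<in> S"
    then show "GDERIV v x :> g x" using GDERIV_transform_open[OF 1(1) S] eq by blast
  qed
qed

text \<open>For fixed \<open>y\<close> this is the regular part of the Green function of the disk of radius \<open>\<rho>\<close>
  about \<open>c\<close>, and also that of the exterior of the disk, depending on the position of \<open>y\<close>. The
  form chosen is visibly symmetric.\<close>

definition image_kernel :: "'a::real_inner \<Rightarrow> real \<Rightarrow> 'a \<Rightarrow> 'a \<Rightarrow> real" where
  "image_kernel c \<rho> x y = 1 / (4 * pi) *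
     ln ((norm (x - y))\<^sup>2 + ((norm (x - c))\<^sup>2 - \<rho>\<^sup>2) * ((norm (y - c))\<^sup>2 - \<rho>\<^sup>2) / \<rho>\<^sup>2)"

text \<open>This is inversion in the circle of radius \<rho> about \<open>c\<close>. At
  \<open>y = c\<close> division by zero gives the value \<open>c\<close> instead of a point at
  infinity, so that case is excluded wherever the image point matters.\<close>

definition image_point :: "'a::real_inner \<Rightarrow> real \<Rightarrow> 'a \<Rightarrow> 'a" where
  "image_point c \<rho> y = c + (\<rho>\<^sup>2 / (norm (y - c))\<^sup>2) *\<^sub>R (y - c)"

lemma image_kernel_commute: "image_kernel c \<rho> x y = image_kernel c \<rho> y x"
  by (simp add: image_kernel_def norm_minus_commute[of x y] mult.commute)

text \<open>This identity links the symmetric form of the kernel to the classical one with a single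
  logarithmic pole at the inverse point. Both sides are expanded by the law of cosines.\<close>

lemma image_kernel_arg:
  assumes "\<rho> > 0" "y \<noteq> c"
  shows "(norm (x - y))\<^sup>2 + ((norm (x - c))\<^sup>2 - \<rho>\<^sup>2) * ((norm (y - c))\<^sup>2 - \<rho>\<^sup>2) / \<rho>\<^sup>2
    = (norm (y - c) / \<rho>)\<^sup>2 * (norm (x - image_point c \<rho> y))\<^sup>2"
proof -
  define X Y where "X = x - c" and "Y = y - c"
  define N where "N = (norm Y)\<^sup>2"
  have N: "N > 0" using assms by (simp add: N_def Y_def)
  have xy: "x - y = X - Y" and xi: "x - image_point c \<rho> y = X - (\<rho>\<^sup>2 / N) *\<^sub>R Y"
    by (simp_all add: X_def Y_def N_def image_point_def)
  have 1: "(norm (X - Y))\<^sup>2 = (norm X)\<^sup>2 - 2 * (X \<bullet> Y) + N"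
    unfolding N_def power2_norm_eq_inner by (simp add: algebra_simps inner_commute)
  have 2: "(norm (X - (\<rho>\<^sup>2 / N) *\<^sub>R Y))\<^sup>2 = (norm X)\<^sup>2 - 2 * (\<rho>\<^sup>2 / N) * (X \<bullet> Y) + (\<rho>\<^sup>2 / N)\<^sup>2 * N"
    unfolding N_def power2_norm_eq_inner
    by (simp add: algebra_simps inner_commute power2_eq_square)
  have "N * (\<rho>\<^sup>2 / N)\<^sup>2 = \<rho>\<^sup>2 * \<rho>\<^sup>2 / N" using N by (simp add: power2_eq_square)
  then show ?thesis
    unfolding xy xi 1 2 X_def[symmetric] Y_def[symmetric] power_divide N_def[symmetric]
    using N assms(1) by (simp add: field_simps)
qed

lemma image_kernel_eq_ln:
  assumes "\<rho> > 0" "y \<noteq> c" "x \<noteq> image_point c \<rho> y"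
  shows "image_kernel c \<rho> x y
    = 1 / (2 * pi) * ln (norm (x - image_point c \<rho> y)) + 1 / (2 * pi) * ln (norm (y - c) / \<rho>)"
proof -
  have p: "norm (x - image_point c \<rho> y) > 0" "norm (y - c) / \<rho> > 0" using assms by simp_all
  have "ln ((norm (y - c) / \<rho>)\<^sup>2 * (norm (x - image_point c \<rho> y))\<^sup>2)
      = 2 * ln (norm (y - c) / \<rho>) + 2 * ln (norm (x - image_point c \<rho> y))"
    using p assms(1,2) by (simp add: ln_mult ln_realpow del: zero_less_divide_iff)
  then show ?thesis
    unfolding image_kernel_def image_kernel_arg[OF assms(1,2)] by (simp add: field_simps)
qed

lemma harmonic_on_image_kernel:
  fixes c :: "real ^ 2"
  assumes "\<rho> > 0" "y \<noteq> c"
  shows "harmonic_on (- {image_point c \<rho> y}) (\<lambda>x. image_kernel c \<rho> x y)"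
proof (rule harmonic_on_cong)
  show "harmonic_on (- {image_point c \<rho> y})
     (\<lambda>x. 1 / (2 * pi) * ln (norm (x - image_point c \<rho> y)) + 1 / (2 * pi) * ln (norm (y - c) / \<rho>))"
    by (intro harmonic_on_add harmonic_on_cmult harmonic_on_const harmonic_on_ln_norm) (simp_all add: open_Compl)
qed (use assms in \<open>simp_all add: open_Compl image_kernel_eq_ln\<close>)

lemma norm_image_point:
  assumes "y \<noteq> c" shows "norm (image_point c \<rho> y - c) = \<rho>\<^sup>2 / norm (y - c)"
  using assms by (simp add: image_point_def power2_eq_square)

text \<open>The pole lies on the ray from \<open>c\<close> through \<open>z\<close>, so the gradient
  is radial. The sign of the denominator makes it point away from the circle on either side, so the
  force will point towards the boundary.\<close>

lemma image_kernel_gradient: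
  fixes z c :: "'a::real_inner"
  assumes \<rho>: "\<rho> > 0" and z: "z \<noteq> c" "norm (z - c) \<noteq> \<rho>"
  shows "GDERIV (\<lambda>x. image_kernel c \<rho> x z) z :>
           (1 / (2 * pi * ((norm (z - c))\<^sup>2 - \<rho>\<^sup>2))) *\<^sub>R (z - c)"
proof -
  define p where "p = image_point c \<rho> z"
  define N where "N = (norm (z - c))\<^sup>2"
  have N: "N > 0" "N \<noteq> \<rho>\<^sup>2" using z \<rho> by (simp_all add: N_def power2_eq_iff_nonneg)
  have zp: "z - p = (1 - \<rho>\<^sup>2 / N) *\<^sub>R (z - c)"
    by (simp add: p_def image_point_def N_def algebra_simps)
  have nz: "1 - \<rho>\<^sup>2 / N \<noteq> 0" using N by simp
  then have "z \<noteq> p" using zp z(1) by auto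
  have G: "GDERIV (\<lambda>x. 1 / (2 * pi) * ln (norm (x - p)) + 1 / (2 * pi) * ln (norm (z - c) / \<rho>)) z :>
      (1 / (2 * pi)) *\<^sub>R ((z - p) /\<^sub>R (norm (z - p))\<^sup>2)"
    by (intro GDERIV_affine GDERIV_ln_norm \<open>z \<noteq> p\<close>)
  have "GDERIV (\<lambda>x. image_kernel c \<rho> x z) z :> (1 / (2 * pi)) *\<^sub>R ((z - p) /\<^sub>R (norm (z - p))\<^sup>2)"
    by (rule GDERIV_transform_open[OF G, of "- {p}"])
      (use \<open>z \<noteq> p\<close> image_kernel_eq_ln[OF \<rho> z(1)] in \<open>auto simp: p_def open_Compl\<close>)
  moreover have "(1 / (2 * pi)) *\<^sub>R ((z - p) /\<^sub>R (norm (z - p))\<^sup>2) = (1 / (2 * pi * (N - \<rho>\<^sup>2))) *\<^sub>R (z - c)"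
  proof -
    have "(norm (z - p))\<^sup>2 = (1 - \<rho>\<^sup>2 / N)\<^sup>2 * N" by (simp add: zp N_def power_mult_distrib)
    moreover have "(1 - \<rho>\<^sup>2 / N) / ((1 - \<rho>\<^sup>2 / N)\<^sup>2 * N) = 1 / ((1 - \<rho>\<^sup>2 / N) * N)"
      using nz by (simp only: power2_eq_square mult.assoc) simp
    moreover have "(1 - \<rho>\<^sup>2 / N) * N = N - \<rho>\<^sup>2" using N by (simp add: left_diff_distrib)
    ultimately have "(1 - \<rho>\<^sup>2 / N) / (norm (z - p))\<^sup>2 = 1 / (N - \<rho>\<^sup>2)" by metis
    moreover have "(1 / (2 * pi)) *\<^sub>R ((z - p) /\<^sub>R (norm (z - p))\<^sup>2)
        = (1 / (2 * pi) * ((1 - \<rho>\<^sup>2 / N) / (norm (z - p))\<^sup>2)) *\<^sub>R (z - c)"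
    proof -
      have "(1 / (2 * pi)) *\<^sub>R ((m *\<^sub>R (z - c)) /\<^sub>R q) = (1 / (2 * pi) * (m / q)) *\<^sub>R (z - c)" for m q
        by (simp only: scaleR_scaleR divide_inverse mult.assoc mult.commute[of m])
      from this[where m="1 - \<rho>\<^sup>2 / N"] show ?thesis unfolding zp[symmetric] .
    qed
    ultimately show ?thesis by simp
  qed
  ultimately show ?thesis by (simp add: N_def)
qed

lemma image_kernel_diag:
  assumes "\<rho> > 0" "norm (z - c) \<noteq> \<rho>"
  shows "image_kernel c \<rho> z z = 1 / (2 * pi) * ln (\<bar>(norm (z - c))\<^sup>2 - \<rho>\<^sup>2\<bar> / \<rho>)"
proof -
  have nz: "(norm (z - c))\<^sup>2 - \<rho>\<^sup>2 \<noteq> 0" using assms by (simp add: power2_eq_iff_nonneg)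
  have "((norm (z - c))\<^sup>2 - \<rho>\<^sup>2) * ((norm (z - c))\<^sup>2 - \<rho>\<^sup>2) / \<rho>\<^sup>2
    = (\<bar>(norm (z - c))\<^sup>2 - \<rho>\<^sup>2\<bar> / \<rho>)\<^sup>2"
    by (simp add: power_divide power2_eq_square)
  moreover have "\<bar>(norm (z - c))\<^sup>2 - \<rho>\<^sup>2\<bar> / \<rho> > 0" using nz assms by simp
  ultimately show ?thesis by (simp add: image_kernel_def ln_realpow del: zero_less_divide_iff)
qed

lemma ln_norm_sq: "x \<noteq> y \<Longrightarrow> 1 / (4 * pi) * ln ((norm (x - y))\<^sup>2) = 1 / (2 * pi) * ln (norm (x - y))"
  by (simp add: ln_realpow)

lemma image_kernel_sphere:
  assumes "norm (x - c) = \<rho>" "x \<noteq> y"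
  shows "image_kernel c \<rho> x y = 1 / (2 * pi) * ln (norm (x - y))"
  using assms ln_norm_sq[of x y] by (simp add: image_kernel_def)

text \<open>The left side is the Green function of the exterior of the disk. Written as the
  logarithm of 1 plus a nonnegative term, it shows positivity and its decay at the circle, which is
  what makes the interaction term bounded.\<close>

lemma image_kernel_minus_ln:
  assumes "\<rho> > 0" "x \<noteq> y" "norm (x - c) \<ge> \<rho>" "norm (y - c) \<ge> \<rho>"
  shows "image_kernel c \<rho> x y - 1 / (2 * pi) * ln (norm (x - y)) = 1 / (4 * pi) *
     ln (1 + ((norm (x - c))\<^sup>2 - \<rho>\<^sup>2) * ((norm (y - c))\<^sup>2 - \<rho>\<^sup>2) / (\<rho>\<^sup>2 * (norm (x - y))\<^sup>2))"
proof -
  have n: "(norm (x - y))\<^sup>2 > 0" using assms by simp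
  define B where "B = ((norm (x - c))\<^sup>2 - \<rho>\<^sup>2) * ((norm (y - c))\<^sup>2 - \<rho>\<^sup>2) / \<rho>\<^sup>2"
  have B: "B \<ge> 0" unfolding B_def using assms by (intro divide_nonneg_nonneg mult_nonneg_nonneg) (auto simp: power_mono)
  have "ln ((norm (x - y))\<^sup>2 + B) = ln ((norm (x - y))\<^sup>2 * (1 + B / (norm (x - y))\<^sup>2))"
    using n by (simp add: distrib_left)
  also have "\<dots> = ln ((norm (x - y))\<^sup>2) + ln (1 + B / (norm (x - y))\<^sup>2)"
    using n B by (intro ln_mult_pos) (auto intro!: add_pos_nonneg divide_nonneg_nonneg)
  finally have "1 / (4 * pi) * ln ((norm (x - y))\<^sup>2 + B)
    = 1 / (2 * pi) * ln (norm (x - y)) + 1 / (4 * pi) * ln (1 + B / (norm (x - y))\<^sup>2)"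
    using ln_norm_sq[OF assms(2)] by (simp add: distrib_left)
  moreover have "B / (norm (x - y))\<^sup>2 = ((norm (x - c))\<^sup>2 - \<rho>\<^sup>2) * ((norm (y - c))\<^sup>2 - \<rho>\<^sup>2) / (\<rho>\<^sup>2 * (norm (x - y))\<^sup>2)"
    by (simp add: B_def)
  ultimately show ?thesis unfolding image_kernel_def B_def[symmetric] by simp
qed

lemma image_kernel_ge_ln:
  assumes "\<rho> > 0" "x \<noteq> y" "norm (x - c) \<ge> \<rho>" "norm (y - c) \<ge> \<rho>"
  shows "image_kernel c \<rho> x y \<ge> 1 / (2 * pi) * ln (norm (x - y))"
proof -
  have "((norm (x - c))\<^sup>2 - \<rho>\<^sup>2) * ((norm (y - c))\<^sup>2 - \<rho>\<^sup>2) / (\<rho>\<^sup>2 * (norm (x - y))\<^sup>2) \<ge> 0"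
    using assms by (intro divide_nonneg_nonneg mult_nonneg_nonneg) (auto simp: power_mono)
  then have "1 / (4 * pi) * ln (1 + ((norm (x - c))\<^sup>2 - \<rho>\<^sup>2) * ((norm (y - c))\<^sup>2 - \<rho>\<^sup>2)
      / (\<rho>\<^sup>2 * (norm (x - y))\<^sup>2)) \<ge> 0"
    by (intro mult_nonneg_nonneg ln_ge_zero) auto
  then show ?thesis using image_kernel_minus_ln[OF assms] by linarith
qed

section \<open>The kernel of a domain with the exterior disk condition\<close>

text \<open>Exterior disks belong to the setting because they give an explicit upper barrier at
  every frontier point. Interior disks are passed to the individual lemmas that compare from
  below.\<close>

locale dirichlet_kernel =
  fixes \<Omega> :: "(real ^ 2) set" and k :: "real ^ 2 \<Rightarrow> real ^ 2 \<Rightarrow> real" and \<rho> :: real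
  assumes open_domain: "open \<Omega>" and bounded_domain: "bounded \<Omega>" and kernel: "is_k \<Omega> k"
    and radius_pos: "\<rho> > 0"
    and exterior_disk: "s \<in> frontier \<Omega> \<Longrightarrow> \<exists>c. ball c \<rho> \<inter> \<Omega> = {} \<and> norm (s - c) = \<rho>"
begin

lemma kernel_harmonic: "y \<in> \<Omega> \<Longrightarrow> harmonic_on \<Omega> (\<lambda>x. k x y)"
  and kernel_continuous: "y \<in> \<Omega> \<Longrightarrow> continuous_on (closure \<Omega>) (\<lambda>x. k x y)"
  and kernel_frontier: "y \<in> \<Omega> \<Longrightarrow> x \<in> frontier \<Omega> \<Longrightarrow> k x y = 1 / (2 * pi) * ln (norm (x - y))"
  using kernel unfolding is_k_def by auto

lemma kernel_weakly_harmonic: "y \<in> \<Omega> \<Longrightarrow> weakly_harmonic_on \<Omega> (\<lambda>x. k x y)"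
  using harmonic_on_imp_weakly[OF open_domain] kernel_harmonic kernel_continuous by blast

lemma frontier_disjoint: "x \<in> frontier \<Omega> \<Longrightarrow> x \<notin> \<Omega>"
  using open_domain by (simp add: frontier_def interior_open)

text \<open>This is nonnegativity of the Green function. The logarithm tends to minus infinity at
  \<open>y\<close> while \<open>k\<close> stays bounded, so once a small disk about \<open>y\<close>
  is excised, the inequality is evident on the whole frontier of the remainder.\<close>

lemma kernel_ge_ln:
  assumes y: "y \<in> \<Omega>" and x: "x \<in> closure \<Omega>" "x \<noteq> y"
  shows "1 / (2 * pi) * ln (norm (x - y)) \<le> k x y"
proof -
  have "compact (closure \<Omega>)" using bounded_domain by (simp add: compact_closure)
  then have "bounded ((\<lambda>x. k x y) ` closure \<Omega>)"
    using kernel_continuous[OF y] compact_continuous_image compact_imp_bounded by blast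
  then obtain B where B: "\<And>v. v \<in> closure \<Omega> \<Longrightarrow> \<bar>k v y\<bar> \<le> B"
    unfolding bounded_iff by auto
  \<comment> \<open>The exponential pushes the logarithm below \<open>- B\<close> on the excised
    circle; the other entry keeps \<open>x\<close> outside the excised disk.\<close>
  define \<epsilon> where "\<epsilon> = min (norm (x - y) / 2) (exp (- (2 * pi * B)))"
  have \<epsilon>: "\<epsilon> > 0" "\<epsilon> < norm (x - y)" using x(2) by (auto simp: \<epsilon>_def min_less_iff_disj)
  have "ln \<epsilon> \<le> ln (exp (- (2 * pi * B)))" using \<epsilon>(1) by (subst ln_le_cancel_iff) (auto simp: \<epsilon>_def)
  then have ln\<epsilon>: "1 / (2 * pi) * ln \<epsilon> \<le> - B" by (simp add: field_simps)
  define U where "U = \<Omega> \<inter> - cball y \<epsilon>"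
  have U: "open U" "bounded U"
    using open_domain bounded_domain by (simp_all add: U_def open_Int open_Compl bounded_Int)
  have clU: "v \<in> closure \<Omega> \<and> \<epsilon> \<le> norm (v - y)" if "v \<in> closure U" for v
  proof -
    have "U \<subseteq> - ball y \<epsilon>" by (auto simp: U_def)
    then have "closure U \<subseteq> - ball y \<epsilon>" by (intro closure_minimal) (auto simp: closed_Compl)
    then show ?thesis using that closure_mono[of U \<Omega>] by (auto simp: U_def dist_norm norm_minus_commute)
  qed
  show ?thesis
  proof (rule weak_comparison[OF U, where u="\<lambda>x. 1 / (2 * pi) * ln (norm (x - y))" and v="\<lambda>x. k x y"])
    have "harmonic_on U (\<lambda>x. ln (norm (x - y)))"
      by (rule harmonic_on_subset[OF harmonic_on_ln_norm]) (use \<epsilon> in \<open>auto simp: U_def\<close>)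
    moreover have "continuous_on (closure U) (\<lambda>x. ln (norm (x - y)))"
      by (rule continuous_on_subset[OF harmonic_on_imp_continuous_on[OF harmonic_on_ln_norm]])
        (use clU \<epsilon> in fastforce)
    ultimately show "weakly_harmonic_on U (\<lambda>x. 1 / (2 * pi) * ln (norm (x - y)))"
      using U(1) by (intro weakly_harmonic_on_cmult harmonic_on_imp_weakly)
    show "weakly_harmonic_on U (\<lambda>x. k x y)"
      by (rule weakly_harmonic_on_subset[OF kernel_weakly_harmonic[OF y]]) (auto simp: U_def)
    show "x \<in> closure U"
      using x(1) \<epsilon>(2) open_Int_closure_subset[of "- cball y \<epsilon>" \<Omega>]
      by (auto simp: U_def open_Compl Int_commute dist_norm norm_minus_commute)
    fix v assume "v \<in> frontier U"
    then have v: "v \<in> closure U" "v \<notin> U" using U(1) by (auto simp: frontier_def interior_open)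
    show "1 / (2 * pi) * ln (norm (v - y)) \<le> k v y"
    proof (cases "v \<in> \<Omega>")
      case True
      then have "norm (v - y) = \<epsilon>"
        using v clU[OF v(1)] by (auto simp: U_def dist_norm norm_minus_commute)
      then show ?thesis using ln\<epsilon> B[of v] clU[OF v(1)] by auto
    next
      case False
      then have "v \<in> frontier \<Omega>"
        using clU[OF v(1)] open_domain by (auto simp: frontier_def interior_open)
      then show ?thesis using kernel_frontier[OF y] by simp
    qed
  qed
qed

lemma norm_gt_of_exterior:
  assumes "ball c \<rho> \<inter> \<Omega> = {}" "y \<in> \<Omega>"
  shows "norm (y - c) > \<rho>"
proof -
  have "\<Omega> \<inter> closure (ball c \<rho>) = {}"
    using assms(1) open_domain open_Int_closure_eq_empty[of \<Omega> "ball c \<rho>"] by (simp add: Int_commute)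
  then show ?thesis using assms(2) radius_pos by (force simp: dist_norm norm_minus_commute)
qed

lemma norm_ge_of_exterior:
  assumes "ball c \<rho> \<inter> \<Omega> = {}" "x \<in> closure \<Omega>"
  shows "norm (x - c) \<ge> \<rho>"
proof -
  have "ball c \<rho> \<inter> closure \<Omega> = {}"
    using assms(1) open_Int_closure_eq_empty[of "ball c \<rho>" \<Omega>] by simp
  then show ?thesis using assms(2) by (force simp: dist_norm norm_minus_commute)
qed

text \<open>Inversion sends \<open>y\<close>, which lies strictly outside the closed exterior disk,
  into the open disk, so the pole stays away from \<open>closure \<Omega>\<close>.\<close>

lemma exterior_image_kernel_harmonic:
  assumes c: "ball c \<rho> \<inter> \<Omega> = {}" and y: "y \<in> \<Omega>"
  shows "harmonic_on \<Omega> (\<lambda>x. image_kernel c \<rho> x y)"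
    and "continuous_on (closure \<Omega>) (\<lambda>x. image_kernel c \<rho> x y)"
proof -
  have n: "norm (y - c) > \<rho>" using norm_gt_of_exterior[OF c y] .
  then have yc: "y \<noteq> c" using radius_pos by auto
  have "\<rho>\<^sup>2 / norm (y - c) < \<rho>" using n radius_pos yc by (simp add: power2_eq_square pos_divide_less_eq)
  then have "norm (image_point c \<rho> y - c) < \<rho>" by (simp add: norm_image_point[OF yc])
  then have sub: "closure \<Omega> \<subseteq> - {image_point c \<rho> y}" using norm_ge_of_exterior[OF c] by fastforce
  note h = harmonic_on_image_kernel[OF radius_pos yc]
  show "harmonic_on \<Omega> (\<lambda>x. image_kernel c \<rho> x y)"
    using h by (rule harmonic_on_subset) (use sub closure_subset in blast)
  show "continuous_on (closure \<Omega>) (\<lambda>x. image_kernel c \<rho> x y)"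
    using harmonic_on_imp_continuous_on[OF h] sub by (rule continuous_on_subset)
qed

text \<open>On the frontier \<open>k\<close> is the logarithm, and there the kernel of the exterior
  disk is at least as large by positivity of its Green function.\<close>

lemma kernel_le_exterior:
  assumes c: "ball c \<rho> \<inter> \<Omega> = {}" and y: "y \<in> \<Omega>" and x: "x \<in> closure \<Omega>"
  shows "k x y \<le> image_kernel c \<rho> x y"
proof (rule weak_comparison[OF open_domain bounded_domain kernel_weakly_harmonic[OF y] _ _ x])
  show "weakly_harmonic_on \<Omega> (\<lambda>x. image_kernel c \<rho> x y)"
    using harmonic_on_imp_weakly[OF open_domain] exterior_image_kernel_harmonic[OF c y] by blast
  fix v assume v: "v \<in> frontier \<Omega>"
  then have "v \<in> closure \<Omega>" "v \<noteq> y" using frontier_disjoint y by (auto simp: frontier_def)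
  then have "1 / (2 * pi) * ln (norm (v - y)) \<le> image_kernel c \<rho> v y"
    using norm_ge_of_exterior[OF c] norm_gt_of_exterior[OF c y] radius_pos
    by (intro image_kernel_ge_ln) auto
  then show "k v y \<le> image_kernel c \<rho> v y" using kernel_frontier[OF y v] by simp
qed

lemma interior_image_kernel_harmonic:
  fixes c :: "real ^ 2"
  assumes y: "y \<in> ball c r" "y \<noteq> c"
  shows "harmonic_on (ball c r) (\<lambda>x. image_kernel c r x y)"
    and "continuous_on (cball c r) (\<lambda>x. image_kernel c r x y)"
proof -
  have n: "norm (y - c) < r" using y by (simp add: dist_norm norm_minus_commute)
  have n0: "norm (y - c) > 0" using y by simp
  then have r: "r > 0" using n by linarith
  have "r < r\<^sup>2 / norm (y - c)" using n n0 r by (simp add: power2_eq_square pos_less_divide_eq)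
  then have "norm (image_point c r y - c) > r" by (simp add: norm_image_point[OF y(2)])
  then have sub: "cball c r \<subseteq> - {image_point c r y}" by (auto simp: dist_norm norm_minus_commute)
  note h = harmonic_on_image_kernel[OF r y(2)]
  show "harmonic_on (ball c r) (\<lambda>x. image_kernel c r x y)"
    using h by (rule harmonic_on_subset) (use sub ball_subset_cball in blast)
  show "continuous_on (cball c r) (\<lambda>x. image_kernel c r x y)"
    using harmonic_on_imp_continuous_on[OF h] sub by (rule continuous_on_subset)
qed

text \<open>On the circle the disk kernel equals the logarithm, which lies below \<open>k\<close>.
  Since the circle may touch the frontier, \<open>kernel_ge_ln\<close> is needed on the closure of
  \<Omega>.\<close>

lemma kernel_ge_interior:
  assumes c: "ball c r \<subseteq> \<Omega>" and y: "y \<in> ball c r" "y \<noteq> c" and x: "x \<in> ball c r"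
  shows "image_kernel c r x y \<le> k x y"
proof -
  have r: "r > 0" using x by (simp add: order_le_less_trans[OF zero_le_dist])
  have cl: "closure (ball c r) = cball c r" using r by simp
  have y': "y \<in> \<Omega>" using c y by blast
  show ?thesis
  proof (rule weak_comparison[OF open_ball bounded_ball, where u="\<lambda>x. image_kernel c r x y" and v="\<lambda>x. k x y"])
    show "weakly_harmonic_on (ball c r) (\<lambda>x. image_kernel c r x y)"
      by (rule harmonic_on_imp_weakly[OF open_ball]) (simp_all only: interior_image_kernel_harmonic[OF y] cl)
    show "weakly_harmonic_on (ball c r) (\<lambda>x. k x y)"
      by (rule weakly_harmonic_on_subset[OF kernel_weakly_harmonic[OF y'] c])
    show "x \<in> closure (ball c r)" using x closure_subset by blast
    fix v assume "v \<in> frontier (ball c r)"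
    then have v: "norm (v - c) = r" using r by (simp add: dist_norm norm_minus_commute)
    then have "v \<in> closure (ball c r)" using cl by (simp add: dist_norm norm_minus_commute)
    then have "v \<in> closure \<Omega>" using closure_mono[OF c] by blast
    moreover have "v \<noteq> y" using v y by (auto simp: dist_norm norm_minus_commute)
    ultimately show "image_kernel c r v y \<le> k v y"
      using image_kernel_sphere[OF v] kernel_ge_ln[OF y'] by simp
  qed
qed

section \<open>Dependence on the second argument\<close>

text \<open>In the first argument the difference is a solution whose boundary values are differences
  of logarithms, and the logarithm has Lipschitz constant \<open>1 / r\<close> beyond
  \<open>r\<close>. The maximum principle makes the bound uniform in \<open>x\<close>.\<close>

lemma kernel_lipschitz:
  assumes x: "x \<in> closure \<Omega>" and r: "r > 0"
    and y: "y \<in> \<Omega>" "\<And>s. s \<in> frontier \<Omega> \<Longrightarrow> norm (s - y) \<ge> r"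
    and y': "y' \<in> \<Omega>" "\<And>s. s \<in> frontier \<Omega> \<Longrightarrow> norm (s - y') \<ge> r"
  shows "\<bar>k x y - k x y'\<bar> \<le> norm (y - y') / (2 * pi * r)"
proof (rule weak_abs_bound[OF open_domain bounded_domain _ _ x])
  show "weakly_harmonic_on \<Omega> (\<lambda>x. k x y - k x y')"
    by (intro weakly_harmonic_on_diff kernel_weakly_harmonic y y')
  have ln_diff: "ln a - ln b \<le> \<bar>a - b\<bar> / r" if "a \<ge> r" "b \<ge> r" for a b
  proof -
    have "ln a - ln b = ln (a / b)" using that r by (simp add: ln_div)
    also have "\<dots> \<le> a / b - 1" using that r by (intro ln_le_minus_one) simp
    also have "\<dots> = (a - b) / b" using that r by (simp add: field_simps)
    also have "\<dots> \<le> \<bar>a - b\<bar> / b" using that r by (intro divide_right_mono) auto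
    also have "\<dots> \<le> \<bar>a - b\<bar> / r" using that r by (intro divide_left_mono) auto
    finally show ?thesis .
  qed
  fix s assume s: "s \<in> frontier \<Omega>"
  have "\<bar>norm (s - y) - norm (s - y')\<bar> \<le> norm (y - y')"
    using norm_triangle_ineq3[of "s - y" "s - y'"] by (simp add: norm_minus_commute)
  then have "\<bar>norm (s - y) - norm (s - y')\<bar> / r \<le> norm (y - y') / r" using r by (simp add: divide_right_mono)
  then have "\<bar>ln (norm (s - y)) - ln (norm (s - y'))\<bar> \<le> norm (y - y') / r"
    using ln_diff[OF y(2)[OF s] y'(2)[OF s]] ln_diff[OF y'(2)[OF s] y(2)[OF s]] by (simp add: abs_minus_commute)
  then have "1 / (2 * pi) * \<bar>ln (norm (s - y)) - ln (norm (s - y'))\<bar> \<le> 1 / (2 * pi) * (norm (y - y') / r)"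
    by (intro mult_left_mono) auto
  moreover have "\<bar>k s y - k s y'\<bar> = 1 / (2 * pi) * \<bar>ln (norm (s - y)) - ln (norm (s - y'))\<bar>"
    unfolding kernel_frontier[OF y(1) s] kernel_frontier[OF y'(1) s] right_diff_distrib[symmetric]
    by (simp add: abs_mult)
  ultimately show "\<bar>k s y - k s y'\<bar> \<le> norm (y - y') / (2 * pi * r)" by (simp add: mult.assoc)
qed

text \<open>The factor 2 leaves room to move the centre within \<open>ball y r\<close> and still
  have a ball of radius \<open>r\<close> inside \<Omega>.\<close>

lemma inner_radius:
  assumes "y \<in> \<Omega>"
  obtains r where "r > 0" "ball y (2 * r) \<subseteq> \<Omega>"
    "\<And>v s. v \<in> ball y r \<Longrightarrow> s \<in> frontier \<Omega> \<Longrightarrow> norm (s - v) \<ge> r"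
proof -
  obtain q where q: "q > 0" "ball y q \<subseteq> \<Omega>" using assms open_domain open_contains_ball by blast
  show thesis
  proof (rule that[of "q / 2"])
    fix v s assume v: "v \<in> ball y (q / 2)" and s: "s \<in> frontier \<Omega>"
    have "s \<notin> ball y q" using frontier_disjoint[OF s] q by blast
    then have "dist y s \<ge> q" by simp
    moreover have "dist y s \<le> dist y v + dist v s" by (rule dist_triangle)
    ultimately show "norm (s - v) \<ge> q / 2" using v by (simp add: dist_norm norm_minus_commute)
  qed (use q in auto)
qed

lemma kernel_continuous_second:
  assumes x: "x \<in> closure \<Omega>"
  shows "continuous_on \<Omega> (\<lambda>y. k x y)"
proof (rule continuous_at_imp_continuous_on, rule ballI)
  fix y assume y: "y \<in> \<Omega>"
  then obtain r where r: "r > 0" "ball y (2 * r) \<subseteq> \<Omega>"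
    "\<And>v s. v \<in> ball y r \<Longrightarrow> s \<in> frontier \<Omega> \<Longrightarrow> norm (s - v) \<ge> r" using inner_radius by blast
  have "\<forall>\<^sub>F v in at y. dist v y < r" using r(1) by (simp add: eventually_at) blast
  then have "\<forall>\<^sub>F v in at y. norm (k x v - k x y) \<le> norm (v - y) / (2 * pi * r)"
  proof eventually_elim
    case (elim v)
    then have v: "v \<in> ball y r" by (simp add: dist_commute)
    then have "v \<in> \<Omega>" using r by (auto simp: subset_iff)
    then show ?case using kernel_lipschitz[OF x r(1), of v y] y r v by simp
  qed
  moreover have "((\<lambda>v. norm (v - y) / (2 * pi * r)) \<longlongrightarrow> 0) (at y)"
    using r(1) by (auto intro!: tendsto_eq_intros)
  ultimately have "((\<lambda>v. k x v - k x y) \<longlongrightarrow> 0) (at y)"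
    by (rule Lim_null_comparison)
  then show "isCont (\<lambda>y. k x y) y" by (simp add: isCont_def LIM_zero_iff)
qed

text \<open>The discrete Laplacian in the second argument is a finite combination of solutions, so the
  maximum principle in the first argument reduces its smallness to that of the boundary data.\<close>

lemma kernel_discrete_laplacian_second:
  assumes x: "x \<in> closure \<Omega>" and y: "y \<in> \<Omega>"
  shows "((\<lambda>h. discrete_laplacian (k x) y h / h\<^sup>2) \<longlongrightarrow> 0) (at_right 0)"
proof -
  obtain r where r: "r > 0" "ball y (2 * r) \<subseteq> \<Omega>"
    "\<And>v s. v \<in> ball y r \<Longrightarrow> s \<in> frontier \<Omega> \<Longrightarrow> norm (s - v) \<ge> r" using y inner_radius by blast
  \<comment> \<open>The estimate for the logarithm, divided by \<open>2 * pi\<close>, with every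
    frontier point at distance at least \<open>r\<close> from \<open>y\<close>. The condition
    \<open>h < r / 2\<close> is its admissible range, and the fourth power beats the division by
    \<open>h\<^sup>2\<close>.\<close>
  have bound: "\<bar>discrete_laplacian (k x) y h\<bar> \<le> 1 / pi * (h / r)^4" if h: "0 < h" "h < r / 2" for h
  proof -
    have inb: "y + h *\<^sub>R e \<in> \<Omega>" "y - h *\<^sub>R e \<in> \<Omega>" if "e \<in> Basis" for e
      using that h r by (auto simp: dist_norm subset_iff)
    show ?thesis
    proof (rule weak_abs_bound[OF open_domain bounded_domain _ _ x])
      show "weakly_harmonic_on \<Omega> (\<lambda>x. discrete_laplacian (k x) y h)"
        unfolding discrete_laplacian_def
        by (intro weakly_harmonic_on_sum weakly_harmonic_on_diff weakly_harmonic_on_add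
            weakly_harmonic_on_cmult kernel_weakly_harmonic inb y finite_Basis)
      fix s assume s: "s \<in> frontier \<Omega>"
      have n: "norm (y - s) \<ge> r" using r(3)[of y s] r(1) s by (simp add: norm_minus_commute)
      have "discrete_laplacian (k s) y h = 1 / (2 * pi) * discrete_laplacian (\<lambda>x. ln (norm x)) (y - s) h"
        unfolding discrete_laplacian_def sum_distrib_left
      proof (rule sum.cong)
        fix e :: "real ^ 2" assume e: "e \<in> Basis"
        have n: "norm (s - (y + h *\<^sub>R e)) = norm (y - s + h *\<^sub>R e)"
          "norm (s - (y - h *\<^sub>R e)) = norm (y - s - h *\<^sub>R e)"
          unfolding norm_minus_commute[of s "y + h *\<^sub>R e"] norm_minus_commute[of s "y - h *\<^sub>R e"]
          by (simp_all add: algebra_simps)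
        have lin: "a * A + a * B - 2 * (a * C) = a * (A + B - 2 * C)" for a A B C :: real
          by (simp add: algebra_simps)
        show "k s (y + h *\<^sub>R e) + k s (y - h *\<^sub>R e) - 2 * k s y =
          1 / (2 * pi) * (ln (norm (y - s + h *\<^sub>R e)) + ln (norm (y - s - h *\<^sub>R e)) - 2 * ln (norm (y - s)))"
          unfolding kernel_frontier[OF inb(1)[OF e] s] kernel_frontier[OF inb(2)[OF e] s] kernel_frontier[OF y s]
            n norm_minus_commute[of s y]
          by (rule lin)
      qed simp
      then have "\<bar>discrete_laplacian (k s) y h\<bar> = 1 / (2 * pi) * \<bar>discrete_laplacian (\<lambda>x. ln (norm x)) (y - s) h\<bar>"
        by (simp add: abs_mult)
      also have "\<dots> \<le> 1 / (2 * pi) * (2 * (h / norm (y - s))^4)"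
        using h n by (intro mult_left_mono discrete_laplacian_ln_norm) auto
      also have "\<dots> \<le> 1 / (2 * pi) * (2 * (h / r)^4)"
      proof (intro mult_left_mono power_mono)
        show "h / norm (y - s) \<le> h / r" using h n r(1) by (intro divide_left_mono mult_pos_pos) linarith+
      qed (use h in auto)
      finally show "\<bar>discrete_laplacian (k s) y h\<bar> \<le> 1 / pi * (h / r)^4" by simp
    qed
  qed
  have "\<forall>\<^sub>F h in at_right 0. h \<in> {0<..<r / 2}" using r(1) eventually_at_right_real[of 0 "r / 2"] by simp
  then have "\<forall>\<^sub>F h in at_right 0. norm (discrete_laplacian (k x) y h / h\<^sup>2) \<le> 1 / (pi * r^4) * h\<^sup>2"
  proof eventually_elim
    case (elim h)
    then have "\<bar>discrete_laplacian (k x) y h\<bar> / h\<^sup>2 \<le> 1 / pi * (h / r)^4 / h\<^sup>2"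
      using bound by (intro divide_right_mono) auto
    also have "\<dots> = 1 / (pi * r^4) * h\<^sup>2" using elim by (simp add: power_divide power4_eq_xxxx power2_eq_square)
    finally show ?case by simp
  qed
  moreover have "((\<lambda>h. 1 / (pi * r^4) * h\<^sup>2) \<longlongrightarrow> 0) (at_right 0)"
    using r(1) by (auto intro!: tendsto_eq_intros)
  ultimately show ?thesis by (rule Lim_null_comparison)
qed

end

section \<open>Symmetry and the gradient along the diagonal\<close>

lemma GDERIV_zero_of_quadratic:
  assumes r: "r > 0" and Q: "\<And>x. norm (x - z) < r \<Longrightarrow> \<bar>Q x\<bar> \<le> C * (norm (x - z))\<^sup>2"
  shows "GDERIV Q z :> 0"
  unfolding gderiv_def has_derivative_at_alt
proof (intro conjI allI impI)
  have Qz: "Q z = 0" using Q[of z] r by simp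
  fix e :: real assume e: "e > 0"
  define d where "d = min r (e / (\<bar>C\<bar> + 1))"
  show "\<exists>d>0. \<forall>y. norm (y - z) < d \<longrightarrow> norm (Q y - Q z - (y - z) \<bullet> 0) \<le> e * norm (y - z)"
  proof (intro exI[of _ d] conjI allI impI)
    show "d > 0" using r e by (simp add: d_def)
    fix y assume y: "norm (y - z) < d"
    then have "\<bar>Q y\<bar> \<le> C * (norm (y - z))\<^sup>2" by (intro Q) (simp add: d_def)
    also have "\<dots> \<le> (\<bar>C\<bar> + 1) * norm (y - z) * norm (y - z)"
      by (simp add: power2_eq_square mult_right_mono mult.assoc)
    also have "\<dots> \<le> e * norm (y - z)"
    proof (rule mult_right_mono)
      have "norm (y - z) * (\<bar>C\<bar> + 1) \<le> e" using y by (simp add: d_def pos_less_divide_eq less_imp_le)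
      then show "(\<bar>C\<bar> + 1) * norm (y - z) \<le> e" by (simp add: mult.commute)
    qed simp
    finally show "norm (Q y - Q z - (y - z) \<bullet> 0) \<le> e * norm (y - z)" by (simp add: Qz)
  qed
qed simp

context dirichlet_kernel
begin

text \<open>Both \<open>k x y\<close> and \<open>k y x\<close> lie between the logarithm and the
  kernel of the exterior disk, which are themselves symmetric.\<close>

lemma kernel_asymmetry_bound:
  assumes c: "ball c \<rho> \<inter> \<Omega> = {}" and x: "x \<in> \<Omega>" and y: "y \<in> \<Omega>" "x \<noteq> y"
  shows "\<bar>k x y - k y x\<bar> \<le> image_kernel c \<rho> y x - 1 / (2 * pi) * ln (norm (y - x))"
proof -
  have cl: "x \<in> closure \<Omega>" "y \<in> closure \<Omega>" using x y closure_subset by auto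
  have "1 / (2 * pi) * ln (norm (x - y)) \<le> k x y" "k x y \<le> image_kernel c \<rho> x y"
    "1 / (2 * pi) * ln (norm (y - x)) \<le> k y x" "k y x \<le> image_kernel c \<rho> y x"
    using kernel_ge_ln kernel_le_exterior[OF c] x y cl by auto
  then show ?thesis
    unfolding image_kernel_commute[of c \<rho> x y] norm_minus_commute[of x y] by linarith
qed

lemma kernel_symmetric:
  assumes x: "x \<in> \<Omega>" and y: "y \<in> \<Omega>"
  shows "k x y = k y x"
proof -
  have xcl: "x \<in> closure \<Omega>" using x closure_subset by blast
  \<comment> \<open>\<open>is_k\<close> constrains \<open>k x y\<close> only for
    \<open>y \<in> \<Omega>\<close>, so the frontier values are prescribed as 0; that they are
    attained continuously has to be shown.\<close>
  define D where "D y = (if y \<in> \<Omega> then k x y - k y x else 0)" for y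
  have D: "D v = k x v - k v x" if "v \<in> \<Omega>" for v using that by (simp add: D_def)
  have "weakly_harmonic_on \<Omega> D"
    unfolding weakly_harmonic_on_def
  proof (intro conjI ballI)
    fix y assume y: "y \<in> \<Omega>"
    have "((\<lambda>h. discrete_laplacian (k x) y h / h\<^sup>2 - discrete_laplacian (\<lambda>v. k v x) y h / h\<^sup>2) \<longlongrightarrow> 0 - 0) (at_right 0)"
      using kernel_weakly_harmonic[OF x] y unfolding weakly_harmonic_on_def
      by (intro tendsto_diff kernel_discrete_laplacian_second xcl y) blast
    moreover have "\<forall>\<^sub>F h in at_right 0. \<forall>e\<in>Basis. y + h *\<^sub>R e \<in> \<Omega> \<and> y - h *\<^sub>R e \<in> \<Omega>"
      by (rule eventually_neighbours_in_open[OF open_domain y])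
    then have "\<forall>\<^sub>F h in at_right 0. discrete_laplacian (k x) y h / h\<^sup>2 - discrete_laplacian (\<lambda>v. k v x) y h / h\<^sup>2
        = discrete_laplacian D y h / h\<^sup>2"
    proof eventually_elim
      case (elim h)
      have "discrete_laplacian D y h = discrete_laplacian (\<lambda>v. k x v - k v x) y h"
        unfolding discrete_laplacian_def by (rule sum.cong) (use elim y D in auto)
      then show ?case by (simp add: discrete_laplacian_diff diff_divide_distrib)
    qed
    ultimately show "((\<lambda>h. discrete_laplacian D y h / h\<^sup>2) \<longlongrightarrow> 0) (at_right 0)"
      by (simp add: tendsto_cong)
  next
    show "continuous_on (closure \<Omega>) D"
      unfolding continuous_on_eq_continuous_within
    proof
      fix y assume y: "y \<in> closure \<Omega>"
      show "continuous (at y within closure \<Omega>) D"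
      proof (cases "y \<in> \<Omega>")
        case True
        have "continuous_on \<Omega> (\<lambda>v. k x v - k v x)"
          by (intro continuous_on_diff kernel_continuous_second xcl
              continuous_on_subset[OF kernel_continuous[OF x] closure_subset])
        moreover have "continuous_on \<Omega> D \<longleftrightarrow> continuous_on \<Omega> (\<lambda>v. k x v - k v x)"
          by (rule continuous_on_cong) (simp_all add: D)
        ultimately have "isCont D y"
          using True by (simp add: continuous_on_eq_continuous_at[OF open_domain])
        then show ?thesis by (rule continuous_at_imp_continuous_at_within)
      next
        case False
        then have yf: "y \<in> frontier \<Omega>" using y open_domain by (simp add: frontier_def interior_open)
        then obtain c where c: "ball c \<rho> \<inter> \<Omega> = {}" "norm (y - c) = \<rho>" using exterior_disk by blast
        have yx: "y \<noteq> x" using False x by blast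
        \<comment> \<open>The barrier \<open>B\<close> is continuous at \<open>y\<close>, vanishes
          there because the circle about \<open>c\<close> passes through \<open>y\<close>, and
          dominates \<open>D\<close> nearby.\<close>
        define B where "B v = image_kernel c \<rho> v x - 1 / (2 * pi) * ln (norm (v - x))" for v
        have "continuous (at y within closure \<Omega>) (\<lambda>v. image_kernel c \<rho> v x)"
          using exterior_image_kernel_harmonic(2)[OF c(1) x] y by (simp add: continuous_on_eq_continuous_within)
        moreover have "continuous (at y within closure \<Omega>) (\<lambda>v. 1 / (2 * pi) * ln (norm (v - x)))"
          using yx by (intro continuous_intros) auto
        ultimately have "continuous (at y within closure \<Omega>) B"
          unfolding B_def by (rule continuous_diff)
        moreover have "B y = 0" using image_kernel_sphere[OF c(2) yx] by (simp add: B_def)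
        ultimately have "(B \<longlongrightarrow> 0) (at y within closure \<Omega>)" by (simp add: continuous_within)
        moreover have "\<forall>\<^sub>F v in at y within closure \<Omega>. norm (D v) \<le> \<bar>B v\<bar>"
        proof -
          have "\<forall>\<^sub>F v in at y within closure \<Omega>. v \<noteq> x"
            using yx by (intro tendsto_imp_eventually_ne[of "\<lambda>v. v"]) auto
          then show ?thesis
          proof eventually_elim
            case (elim v)
            show ?case
            proof (cases "v \<in> \<Omega>")
              case True
              then show ?thesis
                using kernel_asymmetry_bound[OF c(1) x True] elim by (simp add: D_def B_def)
            qed (simp add: D_def)
          qed
        qed
        ultimately have "(D \<longlongrightarrow> 0) (at y within closure \<Omega>)"
          by (intro Lim_null_comparison[of D "\<lambda>v. \<bar>B v\<bar>"]) (auto intro: tendsto_rabs_zero)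
        then show ?thesis using False by (simp add: continuous_within D_def)
      qed
    qed
  qed
  then have "\<bar>D y\<bar> \<le> 0"
    by (rule weak_abs_bound[OF open_domain bounded_domain])
      (use frontier_disjoint y closure_subset in \<open>auto simp: D_def\<close>)
  then show ?thesis using y by (simp add: D_def)
qed

text \<open>By symmetry \<open>k x x\<close> is \<open>2 * k x z - k z z\<close> plus the mixed
  second difference \<open>Q\<close>. The latter is quadratically small: \<open>R\<close>, the
  change of \<open>k\<close> under moving the second argument, is of the order of
  \<open>norm (x - z)\<close>; being harmonic, it has a gradient of that order, and its increment
  from \<open>z\<close> to \<open>x\<close> gains one more factor.\<close>

lemma kernel_diagonal_gradient:
  assumes z: "z \<in> \<Omega>" and g: "GDERIV (\<lambda>x. k x z) z :> g"
  shows "GDERIV (\<lambda>x. k x x) z :> 2 *\<^sub>R g"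
proof -
  obtain r where r: "r > 0" "ball z (2 * r) \<subseteq> \<Omega>"
    and far: "\<And>v s. v \<in> ball z r \<Longrightarrow> s \<in> frontier \<Omega> \<Longrightarrow> norm (s - v) \<ge> r" using z inner_radius by blast
  \<comment> \<open>This is \<open>4 / r\<close> from the gradient bound times
    \<open>1 / (2 * pi * r)\<close> from the Lipschitz bound.\<close>
  define C where "C = 2 / (pi * r\<^sup>2)"
  define Q where "Q x = (k x x - k x z) - (k z x - k z z)" for x
  have bound: "\<bar>Q x\<bar> \<le> C * (norm (x - z))\<^sup>2" if x: "norm (x - z) < r" for x
  proof -
    have xb: "x \<in> ball z r" using x by (simp add: dist_norm norm_minus_commute)
    have xO: "x \<in> \<Omega>" using xb r by (auto simp: subset_iff)
    define R where "R v = k v x - k v z" for v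
    define M where "M = norm (x - z) / (2 * pi * r)"
    have M: "\<bar>R v\<bar> \<le> M" if "v \<in> \<Omega>" for v
      unfolding R_def M_def
      by (rule kernel_lipschitz) (use that closure_subset r(1) xO z far xb far[of z] in auto)
    have Rh: "harmonic_on \<Omega> R"
      unfolding R_def by (intro harmonic_on_diff open_domain kernel_harmonic xO z)
    obtain G where G: "\<And>v. v \<in> \<Omega> \<Longrightarrow> GDERIV R v :> G v"
      by (rule harmonic_onE[OF open_domain Rh]) blast
    have Gb: "norm (G v) \<le> 4 * M / r" if v: "v \<in> ball z r" for v
    proof -
      have vO: "v \<in> \<Omega>" using v r by (auto simp: subset_iff)
      have sub: "ball v r \<subseteq> \<Omega>"
      proof
        fix w assume "w \<in> ball v r"
        then have "dist z w < 2 * r" using v dist_triangle[of z w v] by (simp add: dist_commute)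
        then show "w \<in> \<Omega>" using r(2) by auto
      qed
      \<comment> \<open>Adding the bound \<open>M\<close> makes the function nonnegative without
        changing its gradient.\<close>
      have "norm (G v) \<le> 2 / r * (R v + M)"
      proof (rule harmonic_gradient_bound[OF r(1), where u="\<lambda>v. R v + M"])
        show "harmonic_on (ball v r) (\<lambda>v. R v + M)"
          by (intro harmonic_on_add harmonic_on_const harmonic_on_subset[OF Rh sub] open_ball)
        show "GDERIV (\<lambda>v. R v + M) v :> G v" using GDERIV_affine[OF G[OF vO], of 1 M] by simp
        show "0 \<le> R w + M" if "w \<in> ball v r" for w using M[of w] sub that by auto
      qed
      also have "\<dots> \<le> 2 / r * (2 * M)" using M[OF vO] r(1) by (intro mult_left_mono) auto
      finally show ?thesis by simp
    qed
    have "norm (R x - R z) \<le> 4 * M / r * norm (x - z)"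
    proof (rule differentiable_bound[OF convex_ball[of z r]])
      fix v assume v: "v \<in> ball z r"
      then have "v \<in> \<Omega>" using r by (auto simp: subset_iff)
      then show "(R has_derivative (\<lambda>h. h \<bullet> G v)) (at v within ball z r)"
        using G by (simp add: gderiv_def has_derivative_at_withinI)
      show "onorm (\<lambda>h. h \<bullet> G v) \<le> 4 * M / r"
      proof (rule onorm_le)
        fix h
        have "norm (h \<bullet> G v) \<le> norm h * norm (G v)" using Cauchy_Schwarz_ineq2 by simp
        also have "\<dots> \<le> norm h * (4 * M / r)" using Gb[OF v] by (rule mult_left_mono) simp
        finally show "norm (h \<bullet> G v) \<le> 4 * M / r * norm h" by (simp add: mult.commute)
      qed
    qed (use xb r in auto)
    then show ?thesis by (simp add: Q_def R_def M_def C_def power2_eq_square)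
  qed
  have "GDERIV Q z :> 0" by (rule GDERIV_zero_of_quadratic[OF r(1) bound])
  moreover have "GDERIV (\<lambda>x. 2 * k x z + (- k z z)) z :> 2 *\<^sub>R g" by (rule GDERIV_affine[OF g])
  ultimately have "GDERIV (\<lambda>x. Q x + (2 * k x z + (- k z z))) z :> 0 + 2 *\<^sub>R g"
    by (rule GDERIV_add)
  then have "GDERIV (\<lambda>x. Q x + (2 * k x z + (- k z z))) z :> 2 *\<^sub>R g" by simp
  then show ?thesis
    by (rule GDERIV_transform_open[OF _ open_domain z]) (use kernel_symmetric[OF z] in \<open>simp add: Q_def\<close>)
qed

end

section \<open>Tangent disks and the outward normal\<close>

text \<open>If the unit vectors \<open>p\<close> and \<open>q\<close> differed, a short step from
  \<open>s\<close> along \<open>q - p\<close> would enter both balls at once.\<close>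

lemma tangent_balls_same_direction:
  fixes s a b :: "'a::real_inner"
  assumes disj: "ball a r1 \<inter> ball b r2 = {}" and r: "r1 > 0" "r2 > 0"
    and sa: "norm (s - a) = r1" and sb: "norm (s - b) = r2"
  shows "(s - a) /\<^sub>R r1 = (b - s) /\<^sub>R r2"
proof (rule ccontr)
  define p q where "p = (s - a) /\<^sub>R r1" and "q = (b - s) /\<^sub>R r2"
  assume "(s - a) /\<^sub>R r1 \<noteq> (b - s) /\<^sub>R r2"
  then have pq: "norm (q - p) > 0" by (simp add: p_def q_def)
  have unit: "norm p = 1" "norm q = 1"
    using r sa sb by (simp_all add: p_def q_def norm_minus_commute)
  have A: "s - a = r1 *\<^sub>R p" and B: "b - s = r2 *\<^sub>R q" using r by (simp_all add: p_def q_def)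
  define e where "e = min r1 r2 / 2"
  have e: "e > 0" "e < r1" "e < r2" using r by (auto simp: e_def)
  \<comment> \<open>For unit vectors \<open>2 * (u \<bullet> v - 1)\<close> equals
    \<open>- (norm (v - u))\<^sup>2\<close>.\<close>
  have key: "(norm (R *\<^sub>R u + e *\<^sub>R (v - u)))\<^sup>2 = R\<^sup>2 - e * (R - e) * (norm (v - u))\<^sup>2"
    if "norm u = 1" "norm v = 1" for R and u v :: 'a
  proof -
    have "u \<bullet> u = 1" "v \<bullet> v = 1" using that by (simp_all add: norm_eq_1)
    then show ?thesis
      by (simp add: power2_norm_eq_inner inner_add_left inner_add_right inner_diff_left inner_diff_right
          inner_commute[of v u]) (simp add: algebra_simps power2_eq_square)
  qed
  define x where "x = s + e *\<^sub>R (q - p)"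
  have "(norm (x - a))\<^sup>2 < r1\<^sup>2"
  proof -
    have "x - a = r1 *\<^sub>R p + e *\<^sub>R (q - p)" using A by (simp add: x_def algebra_simps)
    then show ?thesis using key[OF unit(1,2), of r1] e pq by simp
  qed
  then have xa: "norm (x - a) < r1" using r by (simp add: power2_less_imp_less)
  have "(norm (b - x))\<^sup>2 < r2\<^sup>2"
  proof -
    have "b - x = r2 *\<^sub>R q + e *\<^sub>R (p - q)" using B by (simp add: x_def algebra_simps)
    then show ?thesis using key[OF unit(2,1), of r2] e pq by (simp add: norm_minus_commute)
  qed
  then have "norm (b - x) < r2" using r by (simp add: power2_less_imp_less)
  with xa have "x \<in> ball a r1 \<inter> ball b r2" by (simp add: dist_norm norm_minus_commute)
  with disj show False by blast
qed

text \<open>A direction \<open>v\<close> pointing strictly into the tangent interior ball leads into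
  \<Omega>, where \<psi> is negative; a positive derivative along \<open>v\<close> would make \<psi>
  positive there.\<close>

lemma gradient_defining_function_inward:
  assumes def: "C2_defining_function \<Omega> s U \<psi>" and s: "s \<in> frontier \<Omega>"
    and ball: "ball a r \<subseteq> \<Omega>" "norm (s - a) = r" and v: "v \<bullet> (s - a) < 0"
  shows "v \<bullet> gradient \<psi> s \<le> 0"
proof (rule ccontr)
  assume neg: "\<not> v \<bullet> gradient \<psi> s \<le> 0"
  have U: "open U" "s \<in> U" and C2: "C2_on U \<psi>"
    and lvl: "\<Omega> \<inter> U = {x \<in> U. \<psi> x < 0}" "frontier \<Omega> \<inter> U = {x \<in> U. \<psi> x = 0}"
    using def by (auto simp: C2_defining_function_def)
  obtain g where "GDERIV \<psi> s :> g" using C2 U(2) unfolding C2_on_def by blast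
  then have G: "GDERIV \<psi> s :> gradient \<psi> s" using gradient_eqI by metis
  have "((\<lambda>t. \<psi> (s + t *\<^sub>R v)) has_real_derivative v \<bullet> gradient \<psi> s) (at 0)"
    by (rule GDERIV_along_line) (simp add: G)
  then obtain d where d: "d > 0" "\<And>h. 0 < h \<Longrightarrow> h < d \<Longrightarrow> \<psi> (s + 0 *\<^sub>R v) < \<psi> (s + (0 + h) *\<^sub>R v)"
    using DERIV_pos_inc_right[of "\<lambda>t. \<psi> (s + t *\<^sub>R v)"] neg by (metis not_le)
  have \<psi>s: "\<psi> s = 0" using s U(2) lvl(2) by blast
  \<comment> \<open>The squared distance to \<open>a\<close> changes by
    \<open>t * (2 * (v \<bullet> (s - a)) + t * (norm v)\<^sup>2)\<close>, which is negative for
    \<open>0 < t < 2 * m\<close>.\<close>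
  define m where "m = - (v \<bullet> (s - a)) / (norm v)\<^sup>2"
  have v0: "v \<noteq> 0" using v by auto
  then have m: "m > 0" using v by (simp add: m_def divide_neg_pos)
  have "\<forall>\<^sub>F t in at_right (0::real). s + t *\<^sub>R v \<in> U"
    using eventually_line_in_open[OF U, of v] by (auto simp: eventually_at_filter elim: eventually_mono)
  moreover have "\<forall>\<^sub>F t in at_right (0::real). t \<in> {0<..<min d m}"
    using d(1) m by (intro eventually_at_right_real) simp
  ultimately have "\<forall>\<^sub>F t in at_right (0::real). False"
  proof eventually_elim
    case (elim t)
    then have t: "0 < t" "t < d" "t < m" by auto
    have "(norm (s + t *\<^sub>R v - a))\<^sup>2 = r\<^sup>2 + t * (2 * (v \<bullet> (s - a)) + t * (norm v)\<^sup>2)"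
    proof -
      have "s + t *\<^sub>R v - a = (s - a) + t *\<^sub>R v" by simp
      then show ?thesis
        unfolding ball(2)[symmetric]
        by (simp only: power2_norm_eq_inner inner_add_left inner_add_right inner_scaleR_left
            inner_scaleR_right inner_commute[of "s - a" v]) (simp add: algebra_simps)
    qed
    also have "t * (norm v)\<^sup>2 < m * (norm v)\<^sup>2" using t v0 by (intro mult_strict_right_mono) auto
    then have "2 * (v \<bullet> (s - a)) + t * (norm v)\<^sup>2 < 0" using v v0 by (simp add: m_def)
    then have "r\<^sup>2 + t * (2 * (v \<bullet> (s - a)) + t * (norm v)\<^sup>2) < r\<^sup>2"
      using t(1) by (simp add: mult_pos_neg)
    finally have "norm (s + t *\<^sub>R v - a) < r"
      using ball(2) by (metis norm_ge_zero power2_less_imp_less)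
    then have "s + t *\<^sub>R v \<in> \<Omega>" using ball(1) by (auto simp: dist_norm norm_minus_commute)
    then have "\<psi> (s + t *\<^sub>R v) < 0" using elim(1) lvl(1) by blast
    then show False using d(2)[OF t(1,2)] \<psi>s by simp
  qed
  then show False by simp
qed

text \<open>The gradient of any defining function has nonpositive product with every vector of an
  open half space, hence is a positive multiple of \<nu>. This holds for each defining function, so
  it also supplies the uniqueness demanded by the \<open>THE\<close> in
  \<open>outward_normal\<close>.\<close>

lemma outward_normal_eq:
  fixes \<Omega> :: "'a::euclidean_space set"
  assumes C2: "C2_boundary \<Omega>" and s: "s \<in> frontier \<Omega>" and r: "r > 0"
    and ball: "ball a r \<subseteq> \<Omega>" "norm (s - a) = r"
  shows "outward_normal \<Omega> s = (s - a) /\<^sub>R r"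
proof -
  define \<nu> where "\<nu> = (s - a) /\<^sub>R r"
  have sa: "s - a = r *\<^sub>R \<nu>" using r by (simp add: \<nu>_def)
  have "norm \<nu> = 1" using r ball(2) by (simp add: \<nu>_def)
  then have \<nu>: "\<nu> \<bullet> \<nu> = 1" by (simp add: norm_eq_1)
  have dir: "gradient \<psi> s /\<^sub>R norm (gradient \<psi> s) = \<nu>" if def: "C2_defining_function \<Omega> s U \<psi>" for U \<psi>
  proof -
    define G where "G = gradient \<psi> s"
    have G0: "G \<noteq> 0" using def by (simp add: C2_defining_function_def G_def)
    have inward: "v \<bullet> G \<le> 0" if "v \<bullet> \<nu> < 0" for v
      using gradient_defining_function_inward[OF def s ball, of v] that r by (simp add: G_def sa mult_pos_neg)
    have pos: "\<nu> \<bullet> G \<ge> 0" using inward[of "- \<nu>"] \<nu> by simp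
    define w where "w = G - (G \<bullet> \<nu>) *\<^sub>R \<nu>"
    have w\<nu>: "w \<bullet> \<nu> = 0" using \<nu> by (simp add: w_def inner_diff_left)
    have "w \<bullet> G \<le> 0"
    proof (rule field_le_epsilon)
      fix e :: real assume e: "e > 0"
      define \<epsilon> where "\<epsilon> = e / (\<nu> \<bullet> G + 1)"
      have \<epsilon>: "\<epsilon> > 0" using e pos by (simp add: \<epsilon>_def)
      \<comment> \<open>The tangential part \<open>w\<close> is not strictly inward, so it is tilted
        by \<open>\<epsilon>\<close>.\<close>
      have "(w - \<epsilon> *\<^sub>R \<nu>) \<bullet> G \<le> 0" using inward[of "w - \<epsilon> *\<^sub>R \<nu>"] \<epsilon> \<nu> w\<nu> by (simp add: inner_diff_left)
      then have "w \<bullet> G \<le> \<epsilon> * (\<nu> \<bullet> G)" by (simp add: inner_diff_left)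
      also have "\<dots> \<le> \<epsilon> * (\<nu> \<bullet> G + 1)" using \<epsilon> by (intro mult_left_mono) auto
      also have "\<dots> = e" using pos by (simp add: \<epsilon>_def)
      finally show "w \<bullet> G \<le> 0 + e" by simp
    qed
    moreover have "w \<bullet> G = w \<bullet> w"
    proof -
      have "G = w + (G \<bullet> \<nu>) *\<^sub>R \<nu>" by (simp add: w_def)
      then have "w \<bullet> G = w \<bullet> (w + (G \<bullet> \<nu>) *\<^sub>R \<nu>)" by simp
      then show ?thesis using w\<nu> by (simp add: inner_add_right)
    qed
    ultimately have "w = 0" by (metis inner_eq_zero_iff inner_ge_zero order_antisym)
    then have G: "G = (G \<bullet> \<nu>) *\<^sub>R \<nu>" by (simp add: w_def)
    define l where "l = G \<bullet> \<nu>"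
    have "l > 0" using pos G G0 by (auto simp: l_def inner_commute less_le)
    moreover have "norm \<nu> = 1" using \<nu> by (simp add: norm_eq_1)
    ultimately show ?thesis using G unfolding G_def[symmetric] l_def[symmetric] by simp
  qed
  obtain U \<psi> where def: "C2_defining_function \<Omega> s U \<psi>" using C2 s unfolding C2_boundary_def by blast
  have "outward_normal \<Omega> s = \<nu>"
    unfolding outward_normal_def
  proof (rule the_equality)
    show "\<exists>U \<psi>. C2_defining_function \<Omega> s U \<psi> \<and> \<nu> = gradient \<psi> s /\<^sub>R norm (gradient \<psi> s)"
      using def dir by metis
    show "v = \<nu>" if "\<exists>U \<psi>. C2_defining_function \<Omega> s U \<psi> \<and> v = gradient \<psi> s /\<^sub>R norm (gradient \<psi> s)" for v
      using that dir by metis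
  qed
  then show ?thesis by (simp add: \<nu>_def)
qed

lemma ball_frontier_distance_subset:
  fixes \<Omega> :: "'a::euclidean_space set"
  assumes "z \<in> \<Omega>" "d \<le> infdist z (frontier \<Omega>)"
  shows "ball z d \<subseteq> \<Omega>"
proof
  fix x assume x: "x \<in> ball z d"
  show "x \<in> \<Omega>"
  proof (rule ccontr)
    assume "x \<notin> \<Omega>"
    have "z \<in> ball z d" using x by (metis centre_in_ball dist_not_less_zero mem_ball not_le order_le_less_trans)
    then have "ball z d \<inter> frontier \<Omega> \<noteq> {}"
      using connected_Int_frontier[OF connected_ball, of z d \<Omega>] x \<open>x \<notin> \<Omega>\<close> assms(1) by blast
    then obtain f where "dist z f < d" "f \<in> frontier \<Omega>" by auto
    then show False using infdist_le[of f "frontier \<Omega>" z] assms(2) by linarith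
  qed
qed

section \<open>The numerical constant of the self-force\<close>

text \<open>The series starts with \<open>a + a^3 / 12\<close>. The larger coefficient 1/9 gives the
  difference of both sides a derivative with numerator \<open>x\<^sup>2 * (1 - x\<^sup>2)\<close>,
  which is nonnegative on the whole range.\<close>

lemma ln_ratio_le:
  fixes a :: real
  assumes "0 \<le> a" "a \<le> 1"
  shows "ln ((2 + a) / (2 - a)) \<le> a + a^3 / 9"
proof -
  define f where "f x = x + x^3 / 9 - ln (2 + x) + ln (2 - x)" for x :: real
  have "f 0 \<le> f a"
  proof (rule DERIV_nonneg_imp_nondecreasing[OF assms(1)])
    fix x assume x: "0 \<le> x" "x \<le> a"
    have "(f has_real_derivative 1 + x\<^sup>2 / 3 - 1 / (2 + x) - 1 / (2 - x)) (at x)"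
      unfolding f_def using x assms by (auto intro!: derivative_eq_intros simp: power2_eq_square)
    moreover have "1 + x\<^sup>2 / 3 - 1 / (2 + x) - 1 / (2 - x) = x\<^sup>2 * (1 - x\<^sup>2) / (3 * ((2 + x) * (2 - x)))"
      using x assms by (simp add: field_simps) (simp add: algebra_simps power2_eq_square power4_eq_xxxx)
    moreover have "\<dots> \<ge> 0"
      using x assms by (intro divide_nonneg_nonneg mult_nonneg_nonneg) (auto simp: power_le_one)
    ultimately show "\<exists>y. (f has_real_derivative y) (at x) \<and> 0 \<le> y" by metis
  qed
  then show ?thesis using assms by (simp add: f_def ln_div)
qed

text \<open>Here \<open>a\<close> is \<open>d / \<rho>\<close>, and the left side is
  \<open>2 * pi * \<rho>\<close> times the self-force estimate. It is at most
  \<open>1 + 5 / 18 * \<sigma>\<close>, with 5/18 = 1/9 + 1/6; as \<open>ln 2\<close> covers 2/3,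
  only a polynomial inequality in \<sigma> remains.\<close>

lemma C_sig_lower_bound:
  assumes "0 < a" "a < \<sigma>" "\<sigma> < 1"
  shows "ln ((2 + a) / (2 - a)) / a + a / (2 * (4 - a\<^sup>2)) \<le> C_sig \<sigma>"
proof -
  have "ln ((2 + a) / (2 - a)) / a \<le> (a + a^3 / 9) / a"
    using ln_ratio_le[of a] assms by (intro divide_right_mono) auto
  also have "\<dots> = 1 + a\<^sup>2 / 9" using assms by (simp add: field_simps power2_eq_square power3_eq_cube)
  finally have 1: "ln ((2 + a) / (2 - a)) / a \<le> 1 + a\<^sup>2 / 9" .
  have "a\<^sup>2 \<le> \<sigma> * 1" unfolding power2_eq_square using assms by (intro mult_mono) auto
  then have asq: "a\<^sup>2 \<le> \<sigma>" "a\<^sup>2 \<le> 1" using assms by auto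
  have "a / (2 * (4 - a\<^sup>2)) \<le> \<sigma> / 6" using assms asq by (intro frac_le) auto
  then have 2: "ln ((2 + a) / (2 - a)) / a + a / (2 * (4 - a\<^sup>2)) \<le> 1 + 5 / 18 * \<sigma>" using 1 asq by linarith
  define M where "M = 4 * (1 - \<sigma>) * (2 - \<sigma>)\<^sup>2"
  have M: "M > 0" using assms by (simp add: M_def)
  \<comment> \<open>The tangent line of the fourth power at 1/2.\<close>
  have "\<sigma>^4 \<ge> \<sigma> / 2 - 3/16"
  proof -
    have "\<sigma>^4 - (\<sigma> / 2 - 3/16) = (\<sigma>\<^sup>2 - 1/4)\<^sup>2 + (\<sigma> - 1/2)\<^sup>2 / 2"
      by (simp add: power2_eq_square power4_eq_xxxx field_simps)
    moreover have "\<dots> \<ge> 0" by simp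
    ultimately show ?thesis by linarith
  qed
  moreover have "38 * (\<sigma>\<^sup>2 * (1 - \<sigma>)) \<ge> 0" using assms by simp
  ultimately have "0 \<le> 24 - 25 * \<sigma> + 38 * (\<sigma>\<^sup>2 * (1 - \<sigma>)) + 10 * \<sigma>^4" using assms by linarith
  also have "\<dots> = 9 * ((2 * \<sigma>\<^sup>2 - 9 * \<sigma> + 8) - (1/3 + 5/18 * \<sigma>) * M)"
    by (simp add: M_def power2_eq_square power4_eq_xxxx algebra_simps)
  finally have "(1/3 + 5/18 * \<sigma>) * M \<le> 2 * \<sigma>\<^sup>2 - 9 * \<sigma> + 8" by simp
  then have "1/3 + 5/18 * \<sigma> \<le> (2 * \<sigma>\<^sup>2 - 9 * \<sigma> + 8) / M" using M by (simp add: pos_le_divide_eq)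
  then show ?thesis using 2 ln2_ge_two_thirds unfolding C_sig_def M_def by linarith
qed

section \<open>Force estimates\<close>

text \<open>If \<open>\<gamma> < 2 \<sigma> \<rho>\<close>, then \<open>\<gamma> - 2 \<sigma> \<rho>\<close> is negative and its square may exceed \<open>(\<gamma> - d)\<^sup>2\<close>. Where
  it does so by too much, \<open>d\<close> is comparable to \<open>\<rho>\<close> and \<open>ln (1 + X) \<le> X\<close> is too weak.\<close>

lemma pair_bound:
  assumes \<rho>: "\<rho> > 0" and \<sigma>: "0 < \<sigma>" "\<sigma> < 1" and d: "0 < d" "d < \<sigma> * \<rho>" "2 * d < \<gamma>"
    and \<gamma>: "\<rho> < \<gamma>" "\<gamma> \<noteq> 2 * \<sigma> * \<rho>"
  shows "1 / (2 * pi * d) * ln (1 + d * (2 * \<rho> + d) * (\<gamma> * (\<gamma> + 2 * \<rho>)) / (\<rho>\<^sup>2 * (\<gamma> - d)\<^sup>2))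
    \<le> 2 * (1 + \<sigma>) * \<gamma> * (\<gamma> + 2 * \<rho>) / (pi * \<rho> * (\<gamma> - 2 * \<sigma> * \<rho>)\<^sup>2)" (is "?L \<le> ?R")
proof -
  define P where "P = \<gamma> * (\<gamma> + 2 * \<rho>)"
  define X where "X = d * (2 * \<rho> + d) * P / (\<rho>\<^sup>2 * (\<gamma> - d)\<^sup>2)"
  define w where "w = \<gamma> - 2 * \<sigma> * \<rho>"
  have P: "P > 0" using \<rho> \<gamma> by (simp add: P_def)
  have gd: "\<gamma> - d > 0" using d by linarith
  have X: "X > 0" unfolding X_def using d \<rho> P gd by (intro divide_pos_pos mult_pos_pos zero_less_power) auto
  have w: "w\<^sup>2 > 0" using \<gamma> by (simp add: w_def)
  have R: "?R = 2 * (1 + \<sigma>) * P / (pi * \<rho> * w\<^sup>2)" by (simp add: P_def w_def mult.assoc)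
  have L: "?L = 1 / (2 * pi * d) * ln (1 + X)" by (simp add: X_def P_def)
  show ?thesis
  \<comment> \<open>This is the condition under which \<open>ln (1 + X) \<le> X\<close> and
    \<open>2 * \<rho> + d \<le> (2 + \<sigma>) * \<rho>\<close> already give the claim.\<close>
  proof (cases "(2 + \<sigma>) * w\<^sup>2 \<le> 4 * (1 + \<sigma>) * (\<gamma> - d)\<^sup>2")
    case True
    have "ln (1 + X) \<le> X" using X ln_add_one_self_le_self[of X] by simp
    then have "?L \<le> 1 / (2 * pi * d) * X" unfolding L using d by (intro mult_left_mono) auto
    also have "\<dots> = (2 * \<rho> + d) * (P / (2 * pi * \<rho>\<^sup>2 * (\<gamma> - d)\<^sup>2))" using d by (simp add: X_def)
    also have "\<dots> \<le> ((2 + \<sigma>) * \<rho>) * (P / (2 * pi * \<rho>\<^sup>2 * (\<gamma> - d)\<^sup>2))"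
      using d P by (intro mult_right_mono) (auto simp: distrib_right)
    also have "\<dots> = (P / (2 * pi * \<rho>)) * ((2 + \<sigma>) / (\<gamma> - d)\<^sup>2)" using \<rho> by (simp add: power2_eq_square mult_ac)
    also have "\<dots> \<le> (P / (2 * pi * \<rho>)) * (4 * (1 + \<sigma>) / w\<^sup>2)"
    proof (rule mult_left_mono)
      have "2 + \<sigma> \<le> 4 * (1 + \<sigma>) * (\<gamma> - d)\<^sup>2 / w\<^sup>2" using True w by (simp only: pos_le_divide_eq)
      then show "(2 + \<sigma>) / (\<gamma> - d)\<^sup>2 \<le> 4 * (1 + \<sigma>) / w\<^sup>2"
        using gd by (subst pos_divide_le_eq) auto
    qed (use P \<rho> in auto)
    also have "\<dots> = ?R"
    proof -
      have "P / (2 * pi * \<rho>) * (4 * \<tau> / q) = 2 * \<tau> * P / (pi * \<rho> * q)" if "q > 0" for \<tau> q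
        using that \<rho> by (simp add: divide_simps)
      then show ?thesis unfolding R using w by blast
    qed
    finally show ?thesis .
  next
    case False
    have "w < 0"
    proof (rule ccontr)
      assume "\<not> w < 0"
      have "\<sigma> * \<rho> > 0" using \<sigma> \<rho> by simp
      then have "w \<le> \<gamma> - d" using d unfolding w_def by linarith
      then have "w\<^sup>2 \<le> (\<gamma> - d)\<^sup>2" using \<open>\<not> w < 0\<close> by (intro power_mono) auto
      then have "(2 + \<sigma>) * w\<^sup>2 \<le> 4 * (1 + \<sigma>) * (\<gamma> - d)\<^sup>2" using \<sigma> by (intro mult_mono) auto
      with False show False by simp
    qed
    have \<sigma>\<rho>: "\<sigma> * \<rho> < \<rho>" using \<sigma> \<rho> by simp
    have d\<rho>: "d < \<rho>" using \<sigma>\<rho> d by linarith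
    have w\<rho>: "- w < \<rho>" using \<sigma>\<rho> \<gamma> unfolding w_def by linarith
    have wsq: "w\<^sup>2 \<le> \<rho>\<^sup>2" using power_mono[of "- w" \<rho> 2] \<open>w < 0\<close> w\<rho> by simp
    have "\<rho> < 2 * (\<sigma> * \<rho>)" using \<open>w < 0\<close> \<gamma> unfolding w_def by linarith
    then have \<sigma>2: "1 / 2 < \<sigma>" using \<rho> by (simp add: field_simps)
    \<comment> \<open>Otherwise \<open>\<gamma> - d\<close> is at least
      \<open>3 / 4 * \<rho>\<close>; then \<open>6 * 9 / 16\<close> exceeds 3, and
      \<open>w\<^sup>2 \<le> \<rho>\<^sup>2\<close> contradicts the case assumption.\<close>
    have "d > \<rho> / 4"
    proof (rule ccontr)
      assume "\<not> d > \<rho> / 4"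
      then have "3 / 4 * \<rho> \<le> \<gamma> - d" using \<gamma> by linarith
      then have "(3 / 4 * \<rho>)\<^sup>2 \<le> (\<gamma> - d)\<^sup>2" using \<rho> by (intro power_mono) auto
      then have "6 * (9 / 16 * \<rho>\<^sup>2) \<le> 4 * (1 + \<sigma>) * (\<gamma> - d)\<^sup>2"
        using \<sigma>2 by (intro mult_mono) (auto simp: power2_eq_square)
      moreover have "(2 + \<sigma>) * w\<^sup>2 \<le> 3 * \<rho>\<^sup>2" using wsq \<sigma> by (intro mult_mono) auto
      moreover have "\<rho>\<^sup>2 \<ge> 0" by simp
      ultimately have "(2 + \<sigma>) * w\<^sup>2 \<le> 4 * (1 + \<sigma>) * (\<gamma> - d)\<^sup>2" by linarith
      with False show False by simp
    qed
    \<comment> \<open>Since \<open>2 * d < \<gamma>\<close>, the value \<open>\<gamma> / 2\<close>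
      bounds \<open>d\<close> from above and \<open>\<gamma> - d\<close> from below. With
      \<open>\<gamma> \<le> 2 * \<rho>\<close> this yields \<open>X \<le> 24\<close>, so
      \<open>1 + X\<close> is below \<open>2 ^ 5\<close>.\<close>
    have "X \<le> (\<gamma> / 2) * (3 * \<rho>) * P / (\<rho>\<^sup>2 * (\<gamma> / 2)\<^sup>2)"
      unfolding X_def
    proof (rule frac_le)
      show "d * (2 * \<rho> + d) * P \<le> \<gamma> / 2 * (3 * \<rho>) * P"
        using d(1,3) d\<rho> \<rho> \<gamma> P by (intro mult_right_mono mult_mono) auto
      show "\<rho>\<^sup>2 * (\<gamma> / 2)\<^sup>2 \<le> \<rho>\<^sup>2 * (\<gamma> - d)\<^sup>2"
        using d \<rho> \<gamma> by (intro mult_left_mono power_mono) auto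
    qed (use d \<rho> \<gamma> P in auto)
    also have "\<dots> = 6 * (\<gamma> + 2 * \<rho>) / \<rho>" using \<rho> \<gamma> by (simp add: P_def field_simps power2_eq_square)
    also have "\<dots> \<le> 24"
    proof -
      have "\<gamma> \<le> 2 * \<rho>" using \<open>w < 0\<close> \<sigma>\<rho> unfolding w_def by linarith
      then show ?thesis using \<rho> by (simp add: divide_le_eq)
    qed
    finally have "ln (1 + X) \<le> ln (2 ^ 5)" using X by (subst ln_le_cancel_iff) auto
    also have "\<dots> = 5 * ln 2" by (subst ln_realpow) auto
    also have "\<dots> \<le> 7 / 2" using ln2_le_25_over_36 by linarith
    finally have lnX: "ln (1 + X) \<le> 7 / 2" .
    have "?L \<le> 1 / (2 * pi * d) * (7 / 2)" unfolding L using lnX d by (intro mult_left_mono) auto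
    also have "\<dots> \<le> 1 / (2 * pi * (\<rho> / 4)) * (7 / 2)"
      using \<open>d > \<rho> / 4\<close> \<rho> by (intro mult_right_mono divide_left_mono) auto
    also have "\<dots> = 7 / (pi * \<rho>)" by simp
    \<comment> \<open>The number 9 is what the right side guarantees:
      \<open>P \<ge> 3 * \<rho>\<^sup>2\<close>, \<open>2 * (1 + \<sigma>) \<ge> 3\<close> and
      \<open>w\<^sup>2 \<le> \<rho>\<^sup>2\<close>.\<close>
    also have "\<dots> \<le> 9 / (pi * \<rho>)" using \<rho> by (intro divide_right_mono) auto
    also have "\<dots> = 9 * \<rho>\<^sup>2 / (pi * \<rho> * \<rho>\<^sup>2)" using \<rho> by simp
    also have "\<dots> \<le> ?R" unfolding R
    proof (rule frac_le)
      have "\<rho> * (3 * \<rho>) \<le> P" unfolding P_def using \<gamma> \<rho> by (intro mult_mono) auto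
      then have "3 * (\<rho> * (3 * \<rho>)) \<le> 2 * (1 + \<sigma>) * P" using \<sigma>2 \<rho> by (intro mult_mono) auto
      then show "9 * \<rho>\<^sup>2 \<le> 2 * (1 + \<sigma>) * P" by (simp add: power2_eq_square)
      show "pi * \<rho> * w\<^sup>2 \<le> pi * \<rho> * \<rho>\<^sup>2" using wsq \<rho> by (intro mult_left_mono) auto
    qed (use \<rho> P \<sigma> w in auto)
    finally show ?thesis .
  qed
qed

text \<open>Replacing \<open>\<gamma> - d\<close> by \<open>\<gamma> / 2\<close> removes
  \<open>d\<close> and leaves no denominator that can vanish, so the bound also serves
  \<open>\<gamma> = 2 * \<sigma> * \<rho>\<close>.\<close>

lemma pair_bound_uniform:
  assumes \<rho>: "\<rho> > 0" and d: "0 < d" "d < \<rho>" "2 * d < \<gamma>"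
  shows "1 / (2 * pi * d) * ln (1 + d * (2 * \<rho> + d) * (\<gamma> * (\<gamma> + 2 * \<rho>)) / (\<rho>\<^sup>2 * (\<gamma> - d)\<^sup>2))
    \<le> 3 * \<rho> * (\<gamma> * (\<gamma> + 2 * \<rho>)) / (2 * pi * (\<rho>\<^sup>2 * (\<gamma> / 2)\<^sup>2))" (is "?L \<le> ?R")
proof -
  define P where "P = \<gamma> * (\<gamma> + 2 * \<rho>)"
  define X where "X = d * (2 * \<rho> + d) * P / (\<rho>\<^sup>2 * (\<gamma> - d)\<^sup>2)"
  have \<gamma>: "\<gamma> > 0" using d by linarith
  have P: "P > 0" using \<rho> \<gamma> by (simp add: P_def)
  have gd: "\<gamma> - d > 0" using d by linarith
  have X: "X > 0" unfolding X_def using d \<rho> P gd by (intro divide_pos_pos mult_pos_pos zero_less_power) auto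
  have "ln (1 + X) \<le> X" using X ln_add_one_self_le_self[of X] by simp
  then have "1 / (2 * pi * d) * ln (1 + X) \<le> 1 / (2 * pi * d) * X" using d by (intro mult_left_mono) auto
  also have "\<dots> = (2 * \<rho> + d) * P / (2 * pi * (\<rho>\<^sup>2 * (\<gamma> - d)\<^sup>2))" using d by (simp add: X_def)
  also have "\<dots> \<le> 3 * \<rho> * P / (2 * pi * (\<rho>\<^sup>2 * (\<gamma> / 2)\<^sup>2))"
  proof (rule frac_le)
    show "(2 * \<rho> + d) * P \<le> 3 * \<rho> * P" using d P by (intro mult_right_mono) auto
    show "2 * pi * (\<rho>\<^sup>2 * (\<gamma> / 2)\<^sup>2) \<le> 2 * pi * (\<rho>\<^sup>2 * (\<gamma> - d)\<^sup>2)"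
      using d \<gamma> by (intro mult_left_mono power_mono) auto
  qed (use \<rho> P \<gamma> in auto)
  finally show ?thesis by (simp only: X_def P_def)
qed

lemma GDERIV_sum:
  assumes "\<And>i. i \<in> I \<Longrightarrow> GDERIV (f i) x :> g i"
  shows "GDERIV (\<lambda>x. \<Sum>i\<in>I. f i x) x :> (\<Sum>i\<in>I. g i)"
  using assms unfolding gderiv_def inner_sum_right by (rule has_derivative_sum)

lemma energy_first_position:
  assumes n: "n \<ge> 1" and b1: "(b 1)\<^sup>2 = 1"
  obtains E where "\<And>x. energy n b k (z(1 := x)) =
      (\<Sum>j\<in>{2..n}. b 1 * b j * (k x (z j) - 1 / (2 * pi) * ln (norm (x - z j)))) + 1 / 2 * k x x + E"
proof -
  let ?P = "{(i, j). 1 \<le> i \<and> i < j \<and> j \<le> n}"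
  let ?Q = "{(i, j). 2 \<le> i \<and> i < j \<and> j \<le> n}"
  define t where "t z = (\<lambda>(i, j). b i * b j * (k (z i) (z j) - 1 / (2 * pi) * ln (norm (z i - z j))))" for z
  have finQ: "finite ?Q" by (rule finite_subset[of _ "{2..n} \<times> {2..n}"]) auto
  have split: "?P = Pair 1 ` {2..n} \<union> ?Q" by (auto simp: image_iff)
  have sum: "sum (t y) ?P = (\<Sum>j\<in>{2..n}. t y (1, j)) + sum (t y) ?Q" for y
    unfolding split using finQ by (subst sum.union_disjoint) (auto simp: sum.reindex inj_on_def)
  have self: "(\<Sum>i=1..n. (b i)\<^sup>2 * h_of k (y i)) = h_of k (y 1) + (\<Sum>i=2..n. (b i)\<^sup>2 * h_of k (y i))" for y
    using n b1 by (simp add: sum.atLeast_Suc_atMost numeral_2_eq_2)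
  show thesis
  proof (rule that[of "sum (t z) ?Q + 1 / 2 * (\<Sum>i=2..n. (b i)\<^sup>2 * h_of k (z i))"])
    fix x
    let ?y = "z(1 := x)"
    have "(\<Sum>j\<in>{2..n}. t ?y (1, j)) = (\<Sum>j\<in>{2..n}. b 1 * b j * (k x (z j) - 1 / (2 * pi) * ln (norm (x - z j))))"
      by (rule sum.cong) (auto simp: t_def)
    moreover have "sum (t ?y) ?Q = sum (t z) ?Q" by (rule sum.cong) (auto simp: t_def)
    moreover have "(\<Sum>i=2..n. (b i)\<^sup>2 * h_of k (?y i)) = (\<Sum>i=2..n. (b i)\<^sup>2 * h_of k (z i))"
      by (rule sum.cong) auto
    ultimately show "energy n b k ?y =
      (\<Sum>j\<in>{2..n}. b 1 * b j * (k x (z j) - 1 / (2 * pi) * ln (norm (x - z j)))) + 1 / 2 * k x x +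
      (sum (t z) ?Q + 1 / 2 * (\<Sum>i=2..n. (b i)\<^sup>2 * h_of k (z i)))"
      unfolding energy_def t_def[symmetric] sum self by (simp add: h_of_def distrib_left)
  qed
qed

context dirichlet_kernel
begin

text \<open>The gradient is compared with the mean of the gradients for the interior and the exterior
  disk, for which the terms of order \<open>d\<^sup>0\<close> cancel.\<close>

lemma self_force_estimate:
  assumes int: "ball a \<rho> \<subseteq> \<Omega>" and ext: "ball c \<rho> \<inter> \<Omega> = {}" and z: "z \<in> \<Omega>" and d: "0 < d" "d < \<rho>"
    and \<nu>: "norm \<nu> = 1" and za: "z - a = (\<rho> - d) *\<^sub>R \<nu>" and zc: "z - c = - ((\<rho> + d) *\<^sub>R \<nu>)"
    and g: "GDERIV (\<lambda>x. k x z) z :> g"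
  shows "norm (g + (1 / (4 * pi * d)) *\<^sub>R \<nu>)
    \<le> 1 / (2 * pi * d) * ln ((2 * \<rho> + d) / (2 * \<rho> - d)) + d / (4 * pi * (4 * \<rho>\<^sup>2 - d\<^sup>2))"
proof -
  have na: "norm (z - a) = \<rho> - d" and nc: "norm (z - c) = \<rho> + d" using \<nu> d by (simp_all add: za zc)
  have ne: "z \<noteq> a" "z \<noteq> c" using na nc d by auto
  have zb: "z \<in> ball a \<rho>" using na d by (simp add: dist_norm norm_minus_commute)
  have sub: "ball z d \<subseteq> ball a \<rho>"
  proof
    fix x assume "x \<in> ball z d"
    then have "norm (x - z) < d" by (simp add: dist_norm norm_minus_commute)
    moreover have "norm (x - a) \<le> norm (x - z) + norm (z - a)"
      using norm_triangle_ineq[of "x - z" "z - a"] by simp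
    ultimately show "x \<in> ball a \<rho>" using na by (simp add: dist_norm norm_minus_commute)
  qed
  define A where "A = - ((\<rho> - d) / (2 * pi * (d * (2 * \<rho> - d)))) *\<^sub>R \<nu>"
  define B where "B = - ((\<rho> + d) / (2 * pi * (d * (2 * \<rho> + d)))) *\<^sub>R \<nu>"
  have sqa: "(norm (z - a))\<^sup>2 - \<rho>\<^sup>2 = - (d * (2 * \<rho> - d))" and sqc: "(norm (z - c))\<^sup>2 - \<rho>\<^sup>2 = d * (2 * \<rho> + d)"
    by (simp_all add: na nc power2_eq_square algebra_simps)
  have GA: "GDERIV (\<lambda>x. image_kernel a \<rho> x z) z :> A"
  proof -
    have "norm (z - a) \<noteq> \<rho>" using na d by simp
    from image_kernel_gradient[OF radius_pos ne(1) this, unfolded sqa] show ?thesis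
      unfolding A_def by (simp add: za)
  qed
  have GB: "GDERIV (\<lambda>x. image_kernel c \<rho> x z) z :> B"
  proof -
    have "norm (z - c) \<noteq> \<rho>" using nc d by simp
    from image_kernel_gradient[OF radius_pos ne(2) this, unfolded sqc] show ?thesis
      unfolding B_def by (simp add: zc)
  qed
  define v where "v x = k x z - image_kernel a \<rho> x z" for x
  define w where "w x = image_kernel c \<rho> x z - k x z" for x
  have vb: "norm (g - A) \<le> 2 / d * v z"
  proof (rule harmonic_gradient_bound[OF d(1)])
    show "harmonic_on (ball z d) v" unfolding v_def
      using sub int by (intro harmonic_on_diff open_ball harmonic_on_subset[OF kernel_harmonic[OF z]]
          harmonic_on_subset[OF interior_image_kernel_harmonic(1)[OF zb ne(1)]]) auto
    show "GDERIV v z :> g - A" unfolding v_def by (rule GDERIV_diff[OF g GA])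
    show "v x \<ge> 0" if "x \<in> ball z d" for x
      using kernel_ge_interior[OF int zb ne(1), of x] sub that by (auto simp: v_def)
  qed
  have wb: "norm (B - g) \<le> 2 / d * w z"
  proof (rule harmonic_gradient_bound[OF d(1)])
    show "harmonic_on (ball z d) w" unfolding w_def
      using sub int by (intro harmonic_on_diff open_ball harmonic_on_subset[OF kernel_harmonic[OF z]]
          harmonic_on_subset[OF exterior_image_kernel_harmonic(1)[OF ext z]]) auto
    show "GDERIV w z :> B - g" unfolding w_def by (rule GDERIV_diff[OF GB g])
    show "w x \<ge> 0" if "x \<in> ball z d" for x
      using kernel_le_exterior[OF ext z, of x] sub int that closure_subset by (force simp: w_def)
  qed
  \<comment> \<open>Only the sum of the two gaps is computable: in it the unknown
    \<open>k z z\<close> cancels, and so does \<open>ln d\<close>.\<close>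
  have V: "v z + w z = 1 / (2 * pi) * ln ((2 * \<rho> + d) / (2 * \<rho> - d))"
  proof -
    have p: "d * (2 * \<rho> - d) / \<rho> > 0" "d * (2 * \<rho> + d) / \<rho> > 0" using d by auto
    have ia: "image_kernel a \<rho> z z = 1 / (2 * pi) * ln (d * (2 * \<rho> - d) / \<rho>)"
      using image_kernel_diag[OF radius_pos, of z a, unfolded sqa] na d by (simp add: abs_mult)
    have ic: "image_kernel c \<rho> z z = 1 / (2 * pi) * ln (d * (2 * \<rho> + d) / \<rho>)"
      using image_kernel_diag[OF radius_pos, of z c, unfolded sqc] nc d by (simp add: abs_mult)
    have "v z + w z = 1 / (2 * pi) * (ln (d * (2 * \<rho> + d) / \<rho>) - ln (d * (2 * \<rho> - d) / \<rho>))"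
      unfolding v_def w_def ia ic right_diff_distrib[of "1 / (2 * pi)"] by simp
    also have "ln (d * (2 * \<rho> + d) / \<rho>) - ln (d * (2 * \<rho> - d) / \<rho>)
        = ln ((d * (2 * \<rho> + d) / \<rho>) / (d * (2 * \<rho> - d) / \<rho>))"
      using p by (intro ln_divide_pos[symmetric])
    also have "(d * (2 * \<rho> + d) / \<rho>) / (d * (2 * \<rho> - d) / \<rho>) = (2 * \<rho> + d) / (2 * \<rho> - d)"
      using d by simp
    finally show ?thesis .
  qed
  define q where "q = d / (4 * pi * (4 * \<rho>\<^sup>2 - d\<^sup>2))"
  have dsq: "d\<^sup>2 < 4 * \<rho>\<^sup>2"
    using power_strict_mono[of d "2 * \<rho>" 2] d by (simp add: power_mult_distrib)
  have mean: "(1 / 2) *\<^sub>R (A + B) + (1 / (4 * pi * d)) *\<^sub>R \<nu> = q *\<^sub>R \<nu>"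
  proof -
    have m1: "2 * \<rho> - d > 0" and m2: "2 * \<rho> + d > 0" using d by auto
    have fac: "4 * \<rho>\<^sup>2 - d\<^sup>2 = (2 * \<rho> - d) * (2 * \<rho> + d)" by (simp add: power2_eq_square algebra_simps)
    have "1 / 2 * (- ((\<rho> - d) / (2 * pi * (d * (2 * \<rho> - d)))) + - ((\<rho> + d) / (2 * pi * (d * (2 * \<rho> + d)))))
        + 1 / (4 * pi * d) = q"
      unfolding q_def fac using m1 m2 d by (simp add: divide_simps) (simp add: algebra_simps)
    then show ?thesis unfolding A_def B_def by (simp only: scaleR_left_distrib[symmetric] scaleR_scaleR)
  qed
  \<comment> \<open>Comparing with the mean of \<open>A\<close> and \<open>B\<close> makes the two
    gradient bounds enter through half their sum, so \<open>v z + w z\<close> is all that has to be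
    known.\<close>
  have "g + (1 / (4 * pi * d)) *\<^sub>R \<nu> = (1 / 2) *\<^sub>R ((g - A) - (B - g)) + q *\<^sub>R \<nu>"
  proof -
    have "g = (1 / 2) *\<^sub>R ((g - A) - (B - g)) + (1 / 2) *\<^sub>R (A + B)"
      by (simp add: scaleR_2[symmetric] flip: scaleR_add_right)
    then show ?thesis using mean by (metis add.assoc)
  qed
  then have "norm (g + (1 / (4 * pi * d)) *\<^sub>R \<nu>) \<le> norm ((1 / 2) *\<^sub>R ((g - A) - (B - g))) + norm (q *\<^sub>R \<nu>)"
    by (metis norm_triangle_ineq)
  also have "norm ((1 / 2) *\<^sub>R ((g - A) - (B - g))) \<le> 1 / 2 * (norm (g - A) + norm (B - g))"
    using norm_triangle_ineq4[of "g - A" "B - g"] by simp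
  also have "1 / 2 * (norm (g - A) + norm (B - g)) \<le> 1 / d * (v z + w z)"
    using vb wb by (simp add: distrib_left)
  also have "\<dots> = 1 / (2 * pi * d) * ln ((2 * \<rho> + d) / (2 * \<rho> - d))" unfolding V by simp
  also have "norm (q *\<^sub>R \<nu>) = q" using dsq d \<nu> by (simp add: q_def)
  finally show ?thesis unfolding q_def by simp
qed

text \<open>After the substitution \<open>d = t * \<rho>\<close> the estimate is
  \<open>1 / (2 * pi * \<rho>)\<close> times a function of \<open>t\<close> alone.\<close>

lemma self_force_bound:
  assumes int: "ball a \<rho> \<subseteq> \<Omega>" and ext: "ball c \<rho> \<inter> \<Omega> = {}" and z: "z \<in> \<Omega>"
    and \<sigma>: "\<sigma> < 1" and d: "0 < d" "d < \<sigma> * \<rho>"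
    and \<nu>: "norm \<nu> = 1" and za: "z - a = (\<rho> - d) *\<^sub>R \<nu>" and zc: "z - c = - ((\<rho> + d) *\<^sub>R \<nu>)"
    and g: "GDERIV (\<lambda>x. k x z) z :> g"
  shows "norm (g + (1 / (4 * pi * d)) *\<^sub>R \<nu>) \<le> C_sig \<sigma> / (2 * pi * \<rho>)"
proof -
  note \<rho> = radius_pos
  have "\<sigma> * \<rho> < \<rho>" using \<sigma> \<rho> by simp
  then have d\<rho>: "d < \<rho>" using d by linarith
  define t where "t = d / \<rho>"
  have t: "0 < t" "t < \<sigma>" "d = t * \<rho>" using d \<rho> by (simp_all add: t_def pos_divide_less_eq)
  have t1: "t < 1" using t \<sigma> by simp
  have e1: "(2 * \<rho> + d) / (2 * \<rho> - d) = (2 + t) / (2 - t)"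
  proof -
    have "2 * \<rho> + d = (2 + t) * \<rho>" "2 * \<rho> - d = (2 - t) * \<rho>" by (simp_all add: t(3) algebra_simps)
    then show ?thesis using \<rho> by simp
  qed
  have e2: "d / (4 * pi * (4 * \<rho>\<^sup>2 - d\<^sup>2)) = 1 / (2 * pi * \<rho>) * (t / (2 * (4 - t\<^sup>2)))"
  proof -
    have "4 * \<rho>\<^sup>2 - d\<^sup>2 = \<rho> * \<rho> * (4 - t\<^sup>2)" by (simp add: t(3) power2_eq_square algebra_simps)
    then show ?thesis using \<rho> by (simp add: t(3))
  qed
  have "norm (g + (1 / (4 * pi * d)) *\<^sub>R \<nu>)
    \<le> 1 / (2 * pi * d) * ln ((2 * \<rho> + d) / (2 * \<rho> - d)) + d / (4 * pi * (4 * \<rho>\<^sup>2 - d\<^sup>2))"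
    by (rule self_force_estimate[OF int ext z d(1) d\<rho> \<nu> za zc g])
  also have "\<dots> = 1 / (2 * pi * \<rho>) * (ln ((2 + t) / (2 - t)) / t + t / (2 * (4 - t\<^sup>2)))"
    unfolding e1 e2 distrib_left by (simp add: t(3) mult_ac)
  also have "\<dots> \<le> 1 / (2 * pi * \<rho>) * C_sig \<sigma>"
    using C_sig_lower_bound[OF t(1,2) \<sigma>] \<rho> by (intro mult_left_mono) auto
  finally show ?thesis by simp
qed

text \<open>The potential is the Green function with pole \<open>y\<close>, harmonic and nonnegative
  on \<open>ball z d\<close> because \<open>y\<close> is farther than \<open>d\<close> from
  \<open>z\<close>. Its value at \<open>z\<close> is at most that of the exterior disk, which is of
  order \<open>d\<close> since \<open>z\<close> is at distance \<open>d\<close> from the circle; the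
  factor \<open>2 / d\<close> of the gradient bound is thereby compensated.\<close>

lemma pair_force_estimate:
  assumes ext: "ball c \<rho> \<inter> \<Omega> = {}" and z: "z \<in> \<Omega>" and y: "y \<in> \<Omega>"
    and d: "0 < d" "2 * d < \<gamma>" and zd: "ball z d \<subseteq> \<Omega>" and nc: "norm (z - c) = \<rho> + d" and far: "norm (z - y) \<ge> \<gamma> - d"
    and g: "GDERIV (\<lambda>x. k x y - 1 / (2 * pi) * ln (norm (x - y))) z :> g"
  shows "norm g \<le> 1 / (2 * pi * d) * ln (1 + d * (2 * \<rho> + d) * (\<gamma> * (\<gamma> + 2 * \<rho>)) / (\<rho>\<^sup>2 * (\<gamma> - d)\<^sup>2))"
proof -
  note \<rho> = radius_pos
  define t where "t = norm (z - y)"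
  have t: "t \<ge> \<gamma> - d" "\<gamma> - d > d" using far d by (auto simp: t_def)
  then have t0: "t > 0" "d < t" using d by auto
  then have zy: "z \<noteq> y" by (auto simp: t_def)
  have zcl: "z \<in> closure \<Omega>" using z closure_subset by blast
  define N where "N = norm (y - c)"
  have N: "N > \<rho>" using norm_gt_of_exterior[OF ext y] by (simp add: N_def)
  define G where "G x = k x y - 1 / (2 * pi) * ln (norm (x - y))" for x
  have noty: "y \<notin> ball z d" using t0 by (simp add: t_def dist_norm)
  have "norm g \<le> 2 / d * G z"
  proof (rule harmonic_gradient_bound[OF d(1)])
    show "harmonic_on (ball z d) G" unfolding G_def
      using noty zd by (intro harmonic_on_diff harmonic_on_cmult open_ball harmonic_on_subset[OF kernel_harmonic[OF y]]
          harmonic_on_subset[OF harmonic_on_ln_norm]) auto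
    show "GDERIV G z :> g" unfolding G_def by (rule g)
    show "G x \<ge> 0" if "x \<in> ball z d" for x
      using kernel_ge_ln[OF y, of x] that noty zd closure_subset by (force simp: G_def)
  qed
  also have "\<dots> \<le> 2 / d * (image_kernel c \<rho> z y - 1 / (2 * pi) * ln (norm (z - y)))"
    unfolding G_def using kernel_le_exterior[OF ext y zcl] d by (intro mult_left_mono) auto
  also have "\<dots> = 1 / (2 * pi * d) * ln (1 + ((\<rho> + d)\<^sup>2 - \<rho>\<^sup>2) * (N\<^sup>2 - \<rho>\<^sup>2) / (\<rho>\<^sup>2 * t\<^sup>2))"
  proof -
    have "image_kernel c \<rho> z y - 1 / (2 * pi) * ln (norm (z - y))
        = 1 / (4 * pi) * ln (1 + ((\<rho> + d)\<^sup>2 - \<rho>\<^sup>2) * (N\<^sup>2 - \<rho>\<^sup>2) / (\<rho>\<^sup>2 * t\<^sup>2))"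
      using image_kernel_minus_ln[OF \<rho> zy, of c] nc N d unfolding N_def t_def by simp
    then show ?thesis by simp
  qed
  also have "\<dots> \<le> 1 / (2 * pi * d) * ln (1 + d * (2 * \<rho> + d) * (\<gamma> * (\<gamma> + 2 * \<rho>)) / (\<rho>\<^sup>2 * (\<gamma> - d)\<^sup>2))"
  proof -
    have sq: "(\<rho> + d)\<^sup>2 - \<rho>\<^sup>2 = d * (2 * \<rho> + d)" by (simp add: power2_eq_square algebra_simps)
    \<comment> \<open>This controls \<open>N\<close> by \<open>t\<close>. The resulting quotient
      \<open>(t + d) * (t + d + 2 * \<rho>) / t\<^sup>2\<close> decreases in \<open>t\<close>, so
      its worst case is \<open>t = \<gamma> - d\<close>, where \<open>t + d\<close> becomes
      \<gamma>.\<close>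
    have "N \<le> t + (\<rho> + d)"
      using norm_triangle_ineq[of "y - z" "z - c"] nc by (simp add: N_def t_def norm_minus_commute)
    then have "N\<^sup>2 \<le> (t + (\<rho> + d))\<^sup>2" using N \<rho> by (intro power_mono) auto
    then have "N\<^sup>2 - \<rho>\<^sup>2 \<le> (t + d) * (t + d + 2 * \<rho>)" by (simp add: power2_eq_square algebra_simps)
    then have "(N\<^sup>2 - \<rho>\<^sup>2) / t\<^sup>2 \<le> (t + d) * (t + d + 2 * \<rho>) / t\<^sup>2" by (intro divide_right_mono) auto
    also have "\<dots> = (1 + d / t) * (1 + (d + 2 * \<rho>) / t)" using t0 by (simp add: field_simps power2_eq_square)
    also have "\<dots> \<le> (1 + d / (\<gamma> - d)) * (1 + (d + 2 * \<rho>) / (\<gamma> - d))"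
      using t t0 d \<rho> by (intro mult_mono add_left_mono divide_left_mono) auto
    also have "\<dots> = \<gamma> * (\<gamma> + 2 * \<rho>) / (\<gamma> - d)\<^sup>2"
    proof -
      have "1 + d / (\<gamma> - d) = \<gamma> / (\<gamma> - d)" "1 + (d + 2 * \<rho>) / (\<gamma> - d) = (\<gamma> + 2 * \<rho>) / (\<gamma> - d)"
        using t d by (simp_all add: field_simps)
      then show ?thesis by (simp add: power2_eq_square)
    qed
    finally have "d * (2 * \<rho> + d) / \<rho>\<^sup>2 * ((N\<^sup>2 - \<rho>\<^sup>2) / t\<^sup>2)
        \<le> d * (2 * \<rho> + d) / \<rho>\<^sup>2 * (\<gamma> * (\<gamma> + 2 * \<rho>) / (\<gamma> - d)\<^sup>2)"
      using d \<rho> by (intro mult_left_mono) auto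
    then have le: "d * (2 * \<rho> + d) * (N\<^sup>2 - \<rho>\<^sup>2) / (\<rho>\<^sup>2 * t\<^sup>2)
        \<le> d * (2 * \<rho> + d) * (\<gamma> * (\<gamma> + 2 * \<rho>)) / (\<rho>\<^sup>2 * (\<gamma> - d)\<^sup>2)" by simp
    have "N\<^sup>2 - \<rho>\<^sup>2 \<ge> 0" using power_mono[of \<rho> N 2] N \<rho> by simp
    then have "d * (2 * \<rho> + d) * (N\<^sup>2 - \<rho>\<^sup>2) / (\<rho>\<^sup>2 * t\<^sup>2) \<ge> 0"
      using d \<rho> by (intro divide_nonneg_nonneg mult_nonneg_nonneg) auto
    then show ?thesis unfolding sq using le d
      by (intro mult_left_mono) (subst ln_le_cancel_iff, auto)
  qed
  finally show ?thesis .
qed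

end

section \<open>Assembly of the force on the first dislocation\<close>

lemma disk_conditionsE:
  assumes "uniform_disk_conditions \<Omega> \<rho>" "s \<in> frontier \<Omega>"
  obtains a c where "ball a \<rho> \<subseteq> \<Omega>" "norm (s - a) = \<rho>" "ball c \<rho> \<inter> \<Omega> = {}" "norm (s - c) = \<rho>"
proof -
  obtain p where p: "ball (fst p) \<rho> \<subseteq> \<Omega>" "ball (snd p) \<rho> \<subseteq> - \<Omega>"
    "sphere (fst p) \<rho> \<inter> frontier \<Omega> \<inter> sphere (snd p) \<rho> = {s}"
    using assms unfolding uniform_disk_conditions_def by blast
  then have "s \<in> sphere (fst p) \<rho>" "s \<in> sphere (snd p) \<rho>" by blast+
  then show thesis
    using that[of "fst p" "snd p"] p(1,2) by (auto simp: dist_norm norm_minus_commute)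
qed

lemma D_set_far:
  assumes z: "z \<in> D_set \<Omega> n \<delta> \<gamma>" and j: "j \<in> {2..n}"
  shows "infdist (z j) (frontier \<Omega>) > \<gamma>"
proof -
  have dm: "dm \<Omega> {2..n} z > \<gamma>" using z j by (auto simp: D_set_def)
  have "{norm (z i - z j) | i j. i \<in> {2..n} \<and> j \<in> {2..n} \<and> i \<noteq> j}
      \<subseteq> (\<lambda>(i, j). norm (z i - z j)) ` ({2..n} \<times> {2..n})" by auto
  then have "finite {norm (z i - z j) | i j. i \<in> {2..n} \<and> j \<in> {2..n} \<and> i \<noteq> j}"
    by (rule finite_subset) simp
  then have "dm \<Omega> {2..n} z \<le> infdist (z j) (frontier \<Omega>)"
    unfolding dm_def using j by (intro Min_le) auto
  with dm show ?thesis by linarith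
qed

context dirichlet_kernel
begin

text \<open>The pair bound \<open>B\<close> is a parameter, so that one decomposition of the force
  serves both the explicit bound and the one that survives
  \<open>\<gamma> = 2 * \<sigma> * \<rho>\<close>.\<close>

lemma force1_estimate:
  assumes C2: "C2_boundary \<Omega>" and disks: "uniform_disk_conditions \<Omega> \<rho>"
    and n: "n \<ge> 1" and b: "\<forall>i\<in>{1..n}. b i \<in> {-1, 1}"
    and \<sigma>: "\<sigma> < 1" and \<delta>: "\<delta> < \<sigma> * \<rho>" and \<gamma>: "2 * \<delta> < \<gamma>"
    and z: "z \<in> D_set \<Omega> n \<delta> \<gamma>" and s: "s \<in> frontier \<Omega>" "dist (z 1) s = d1 \<Omega> (z 1)"
    and B: "\<And>d. 0 < d \<Longrightarrow> d < \<delta> \<Longrightarrow>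
      1 / (2 * pi * d) * ln (1 + d * (2 * \<rho> + d) * (\<gamma> * (\<gamma> + 2 * \<rho>)) / (\<rho>\<^sup>2 * (\<gamma> - d)\<^sup>2)) \<le> B"
  shows "norm (force1 n b k z - (1 / (4 * pi * d1 \<Omega> (z 1))) *\<^sub>R outward_normal \<Omega> s)
    \<le> (real n - 1) * B + C_sig \<sigma> / (2 * pi * \<rho>)"
proof -
  note \<rho> = radius_pos
  define x d where "x = z 1" and "d = d1 \<Omega> x"
  have zin: "z j \<in> \<Omega>" if "j \<in> {1..n}" for j using z that by (auto simp: D_set_def)
  have x: "x \<in> \<Omega>" using zin n by (simp add: x_def)
  have d\<delta>: "d < \<delta>" using z by (simp add: D_set_def d_def x_def)
  have xs: "norm (s - x) = d" using s by (simp add: d_def x_def dist_norm norm_minus_commute)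
  have "s \<noteq> x" using s frontier_disjoint x by blast
  then have d: "d > 0" using xs by auto
  have "\<sigma> * \<rho> < \<rho>" using \<sigma> \<rho> by simp
  then have d\<rho>: "d < \<rho>" using d\<delta> \<delta> by linarith
  obtain a c where a: "ball a \<rho> \<subseteq> \<Omega>" "norm (s - a) = \<rho>" and c: "ball c \<rho> \<inter> \<Omega> = {}" "norm (s - c) = \<rho>"
    using disk_conditionsE[OF disks s(1)] by blast
  define \<nu> where "\<nu> = (s - a) /\<^sub>R \<rho>"
  have normal: "outward_normal \<Omega> s = \<nu>"
    unfolding \<nu>_def by (rule outward_normal_eq[OF C2 s(1) \<rho> a])
  have \<nu>: "norm \<nu> = 1" using a \<rho> by (simp add: \<nu>_def)
  have xd: "ball x d \<subseteq> \<Omega>" by (rule ball_frontier_distance_subset[OF x]) (simp add: d_def d1_def)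
  \<comment> \<open>The interior disk and \<open>ball x d\<close> both touch the exterior disk at
    \<open>s\<close>; hence \<open>a\<close>, \<open>x\<close>, \<open>s\<close> and
    \<open>c\<close> lie on one line with direction \<nu>.\<close>
  have dir1: "(s - a) /\<^sub>R \<rho> = (c - s) /\<^sub>R \<rho>"
    by (rule tangent_balls_same_direction) (use a c \<rho> in auto)
  have dir2: "(s - x) /\<^sub>R d = (c - s) /\<^sub>R \<rho>"
    by (rule tangent_balls_same_direction) (use xd c \<rho> d xs in auto)
  have sa: "s - a = \<rho> *\<^sub>R \<nu>" using \<rho> by (simp add: \<nu>_def)
  have cs: "c - s = \<rho> *\<^sub>R \<nu>" using \<rho> by (simp add: \<nu>_def dir1)
  have "(s - x) /\<^sub>R d = \<nu>" using dir1 dir2 unfolding \<nu>_def by metis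
  then have sx: "s - x = d *\<^sub>R \<nu>" using d by auto
  have xa: "x - a = (\<rho> - d) *\<^sub>R \<nu>"
  proof -
    have "x - a = (s - a) - (s - x)" by simp
    then show ?thesis unfolding sa sx by (simp add: scaleR_left_diff_distrib)
  qed
  have xc: "x - c = - ((\<rho> + d) *\<^sub>R \<nu>)"
  proof -
    have "x - c = - ((c - s) + (s - x))" by simp
    then show ?thesis unfolding cs sx by (simp add: scaleR_left_distrib)
  qed
  have kdiff: "\<exists>g. GDERIV (\<lambda>x. k x y) x :> g" if "y \<in> \<Omega>" for y
    by (rule harmonic_onE[OF open_domain kernel_harmonic[OF that]]) (use x in blast)
  obtain g where g: "GDERIV (\<lambda>y. k y x) x :> g" using kdiff[OF x] by blast
  have "\<forall>j\<in>{2..n}. \<exists>g. GDERIV (\<lambda>y. k y (z j) - 1 / (2 * pi) * ln (norm (y - z j))) x :> g \<and> norm g \<le> B"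
  proof
    fix j assume j: "j \<in> {2..n}"
    have zj: "z j \<in> \<Omega>" using zin j by simp
    have "infdist (z j) (frontier \<Omega>) \<le> dist (z j) s" using s(1) by (rule infdist_le)
    then have "norm (z j - s) > \<gamma>" using D_set_far[OF z j] by (simp add: dist_norm)
    moreover have "norm (z j - s) \<le> norm (x - z j) + norm (s - x)"
      using norm_triangle_ineq[of "z j - x" "x - s"] by (simp add: norm_minus_commute)
    ultimately have far: "norm (x - z j) \<ge> \<gamma> - d" using xs by linarith
    then have ne: "x \<noteq> z j" using \<gamma> d\<delta> d by auto
    obtain g' where g': "GDERIV (\<lambda>y. k y (z j)) x :> g'" using kdiff[OF zj] by blast
    have "GDERIV (\<lambda>y. k y (z j) - (1 / (2 * pi) * ln (norm (y - z j)) + 0)) x :>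
        g' - (1 / (2 * pi)) *\<^sub>R ((x - z j) /\<^sub>R (norm (x - z j))\<^sup>2)"
      by (intro GDERIV_diff g' GDERIV_affine GDERIV_ln_norm ne)
    then obtain h where h: "GDERIV (\<lambda>y. k y (z j) - 1 / (2 * pi) * ln (norm (y - z j))) x :> h" by auto
    have "norm h \<le> 1 / (2 * pi * d) * ln (1 + d * (2 * \<rho> + d) * (\<gamma> * (\<gamma> + 2 * \<rho>)) / (\<rho>\<^sup>2 * (\<gamma> - d)\<^sup>2))"
      by (rule pair_force_estimate[OF c(1) x zj d _ xd _ far h]) (use \<gamma> d\<delta> xc \<nu> \<rho> d in auto)
    also note B[OF d d\<delta>]
    finally show "\<exists>g. GDERIV (\<lambda>y. k y (z j) - 1 / (2 * pi) * ln (norm (y - z j))) x :> g \<and> norm g \<le> B"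
      using h by blast
  qed
  from bchoice[OF this] obtain G where G': "\<forall>j\<in>{2..n}.
      GDERIV (\<lambda>y. k y (z j) - 1 / (2 * pi) * ln (norm (y - z j))) x :> G j \<and> norm (G j) \<le> B" ..
  have G: "GDERIV (\<lambda>y. k y (z j) - 1 / (2 * pi) * ln (norm (y - z j))) x :> G j"
    and GB: "norm (G j) \<le> B" if "j \<in> {2..n}" for j
    using bspec[OF G' that] by (rule conjunct1, rule conjunct2)
  have "b 1 \<in> {-1, 1}" using b n by simp
  then have b1: "(b 1)\<^sup>2 = 1" by auto
  obtain E where E: "\<And>y. energy n b k (z(1 := y)) =
      (\<Sum>j\<in>{2..n}. b 1 * b j * (k y (z j) - 1 / (2 * pi) * ln (norm (y - z j)))) + 1 / 2 * k y y + E"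
    by (rule energy_first_position[where b=b and k=k and z=z, OF n b1]) blast
  \<comment> \<open>The \<open>+ 0\<close> fits the summands to the shape of
    \<open>GDERIV_affine\<close>. The weight 1/2 of the self-energy cancels the 2 of
    \<open>kernel_diagonal_gradient\<close>.\<close>
  have "GDERIV (\<lambda>y. (\<Sum>j\<in>{2..n}. b 1 * b j * (k y (z j) - 1 / (2 * pi) * ln (norm (y - z j))) + 0) + (1 / 2 * k y y + E)) x
      :> (\<Sum>j\<in>{2..n}. (b 1 * b j) *\<^sub>R G j) + (1 / 2) *\<^sub>R (2 *\<^sub>R g)"
    by (intro GDERIV_add GDERIV_sum GDERIV_affine G kernel_diagonal_gradient x g)
  then have "GDERIV (\<lambda>y. energy n b k (z(1 := y))) x :> (\<Sum>j\<in>{2..n}. (b 1 * b j) *\<^sub>R G j) + g"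
    unfolding E by (simp add: add.assoc)
  then have f: "force1 n b k z = - ((\<Sum>j\<in>{2..n}. (b 1 * b j) *\<^sub>R G j) + g)"
    unfolding force1_def x_def[symmetric] by (simp only: gradient_eqI)
  have "norm (\<Sum>j\<in>{2..n}. (b 1 * b j) *\<^sub>R G j) \<le> of_nat (card {2..n}) * B"
  proof (rule sum_norm_bound)
    fix j assume j: "j \<in> {2..n}"
    have "b 1 \<in> {-1, 1}" "b j \<in> {-1, 1}" using b n j by auto
    then have "\<bar>b 1 * b j\<bar> = 1" by auto
    then show "norm ((b 1 * b j) *\<^sub>R G j) \<le> B" using GB[OF j] by simp
  qed
  also have "real (card {2..n}) = real n - 1" using n by (simp add: of_nat_diff)
  finally have pairs: "norm (\<Sum>j\<in>{2..n}. (b 1 * b j) *\<^sub>R G j) \<le> (real n - 1) * B" .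
  have self: "norm (g + (1 / (4 * pi * d)) *\<^sub>R \<nu>) \<le> C_sig \<sigma> / (2 * pi * \<rho>)"
    by (rule self_force_bound[OF a(1) c(1) x \<sigma> d _ \<nu> xa xc g]) (use d\<delta> \<delta> in simp)
  have "force1 n b k z - (1 / (4 * pi * d)) *\<^sub>R \<nu>
      = - ((\<Sum>j\<in>{2..n}. (b 1 * b j) *\<^sub>R G j) + (g + (1 / (4 * pi * d)) *\<^sub>R \<nu>))"
    unfolding f by simp
  then have "norm (force1 n b k z - (1 / (4 * pi * d)) *\<^sub>R \<nu>)
      \<le> norm (\<Sum>j\<in>{2..n}. (b 1 * b j) *\<^sub>R G j) + norm (g + (1 / (4 * pi * d)) *\<^sub>R \<nu>)"
    by (simp only: norm_minus_cancel norm_triangle_ineq)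
  then show ?thesis using pairs self unfolding normal d_def[symmetric] x_def[symmetric] by linarith
qed

end

text \<open>For \<open>n \<ge> 2\<close> and \<open>\<gamma> = 2 * \<sigma> * \<rho>\<close> the
  convention \<open>x / 0 = 0\<close> would erase the pair term, so the explicit bound is asserted
  away from this value; the first conjunct retains uniform boundedness for every admissible
  \<gamma>.\<close>

theorem theorem3p1:
  fixes \<Omega> :: "(real ^ 2) set"
    and k :: "real ^ 2 \<Rightarrow> real ^ 2 \<Rightarrow> real"
    and b :: "nat \<Rightarrow> real"
    and n :: nat
    and \<rho> \<sigma> \<delta> \<gamma> :: real
  assumes "open \<Omega>" and "connected \<Omega>" and "bounded \<Omega>" and "\<Omega> \<noteq> {}"
    and "C2_boundary \<Omega>"
    and "\<rho> > 0" and "uniform_disk_conditions \<Omega> \<rho>"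
    and "is_k \<Omega> k"
    and "n \<ge> 1"
    and "\<forall>i\<in>{1..n}. b i \<in> {-1, 1}"
    and "\<sigma> \<in> {0<..<1}"
    and "\<delta> \<in> {0<..<\<sigma> * \<rho>}"
    and "\<gamma> \<in> {max (2 * \<delta>) \<rho><..<diameter \<Omega> / 2}"
  shows "(\<exists>C. \<forall>z\<in>D_set \<Omega> n \<delta> \<gamma>. \<forall>s\<in>frontier \<Omega>. dist (z 1) s = d1 \<Omega> (z 1) \<longrightarrow>
            norm (force1 n b k z - (1 / (4 * pi * d1 \<Omega> (z 1))) *\<^sub>R outward_normal \<Omega> s) \<le> C) \<and>
         ((n \<ge> 2 \<longrightarrow> \<gamma> \<noteq> 2 * \<sigma> * \<rho>) \<longrightarrow>
          (\<forall>z\<in>D_set \<Omega> n \<delta> \<gamma>. \<forall>s\<in>frontier \<Omega>. dist (z 1) s = d1 \<Omega> (z 1) \<longrightarrow>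
            norm (force1 n b k z - (1 / (4 * pi * d1 \<Omega> (z 1))) *\<^sub>R outward_normal \<Omega> s)
              \<le> 2 * (1 + \<sigma>) * (real n - 1) * \<gamma> * (\<gamma> + 2 * \<rho>) / (pi * \<rho> * (\<gamma> - 2 * \<sigma> * \<rho>)\<^sup>2)
                 + C_sig \<sigma> / (2 * pi * \<rho>)) \<and>
          2 * (1 + \<sigma>) * (real n - 1) * \<gamma> * (\<gamma> + 2 * \<rho>) / (pi * \<rho> * (\<gamma> - 2 * \<sigma> * \<rho>)\<^sup>2)
                 + C_sig \<sigma> / (2 * pi * \<rho>)
            = C_nsig n \<sigma> \<rho> \<gamma> / (2 * pi * \<rho>))"
proof -
  interpret dirichlet_kernel \<Omega> k \<rho>
  proof
    show "\<exists>c. ball c \<rho> \<inter> \<Omega> = {} \<and> norm (s - c) = \<rho>" if "s \<in> frontier \<Omega>" for s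
      using disk_conditionsE[OF assms(7) that] by blast
  qed (use assms in auto)
  have \<sigma>: "0 < \<sigma>" "\<sigma> < 1" and \<delta>: "0 < \<delta>" "\<delta> < \<sigma> * \<rho>" and \<gamma>: "2 * \<delta> < \<gamma>" "\<rho> < \<gamma>"
    using assms(11-13) by auto
  have "\<sigma> * \<rho> < \<rho>" using \<sigma> assms(6) by simp
  then have \<delta>\<rho>: "\<delta> < \<rho>" using \<delta> by linarith
  note estimate = force1_estimate[OF assms(5,7,9,10) \<sigma>(2) \<delta>(2) \<gamma>(1)]
  define B where "B = 3 * \<rho> * (\<gamma> * (\<gamma> + 2 * \<rho>)) / (2 * pi * (\<rho>\<^sup>2 * (\<gamma> / 2)\<^sup>2))"
  have uniform: "norm (force1 n b k z - (1 / (4 * pi * d1 \<Omega> (z 1))) *\<^sub>R outward_normal \<Omega> s)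
      \<le> (real n - 1) * B + C_sig \<sigma> / (2 * pi * \<rho>)"
    if "z \<in> D_set \<Omega> n \<delta> \<gamma>" "s \<in> frontier \<Omega>" "dist (z 1) s = d1 \<Omega> (z 1)" for z s
    by (rule estimate[OF that]) (use pair_bound_uniform[OF assms(6)] \<delta>\<rho> \<gamma> in \<open>simp add: B_def\<close>)
  have explicit: "norm (force1 n b k z - (1 / (4 * pi * d1 \<Omega> (z 1))) *\<^sub>R outward_normal \<Omega> s)
      \<le> 2 * (1 + \<sigma>) * (real n - 1) * \<gamma> * (\<gamma> + 2 * \<rho>) / (pi * \<rho> * (\<gamma> - 2 * \<sigma> * \<rho>)\<^sup>2)
                 + C_sig \<sigma> / (2 * pi * \<rho>)"
    if ne: "n \<ge> 2 \<longrightarrow> \<gamma> \<noteq> 2 * \<sigma> * \<rho>"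
      and zs: "z \<in> D_set \<Omega> n \<delta> \<gamma>" "s \<in> frontier \<Omega>" "dist (z 1) s = d1 \<Omega> (z 1)" for z s
  proof (cases "n \<ge> 2")
    case True
    define B' where "B' = 2 * (1 + \<sigma>) * \<gamma> * (\<gamma> + 2 * \<rho>) / (pi * \<rho> * (\<gamma> - 2 * \<sigma> * \<rho>)\<^sup>2)"
    have "norm (force1 n b k z - (1 / (4 * pi * d1 \<Omega> (z 1))) *\<^sub>R outward_normal \<Omega> s)
      \<le> (real n - 1) * B' + C_sig \<sigma> / (2 * pi * \<rho>)"
    proof (rule estimate[OF zs])
      fix d assume "0 < d" "d < \<delta>"
      then show "1 / (2 * pi * d) * ln (1 + d * (2 * \<rho> + d) * (\<gamma> * (\<gamma> + 2 * \<rho>)) / (\<rho>\<^sup>2 * (\<gamma> - d)\<^sup>2)) \<le> B'"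
        unfolding B'_def using ne True \<gamma> \<delta> by (intro pair_bound[OF assms(6) \<sigma>]) auto
    qed
    also have "(real n - 1) * B' = 2 * (1 + \<sigma>) * (real n - 1) * \<gamma> * (\<gamma> + 2 * \<rho>) / (pi * \<rho> * (\<gamma> - 2 * \<sigma> * \<rho>)\<^sup>2)"
      by (simp add: B'_def mult_ac)
    finally show ?thesis .
  next
    case False
    \<comment> \<open>The factor \<open>real n - 1\<close> is 0, so both bounds reduce to the
      self-force term, even if the denominator vanishes.\<close>
    then have "n = 1" using assms(9) by simp
    then show ?thesis using uniform[OF zs] by simp
  qed
  have "2 * (1 + \<sigma>) * (real n - 1) * \<gamma> * (\<gamma> + 2 * \<rho>) / (pi * \<rho> * (\<gamma> - 2 * \<sigma> * \<rho>)\<^sup>2)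
                 + C_sig \<sigma> / (2 * pi * \<rho>) = C_nsig n \<sigma> \<rho> \<gamma> / (2 * pi * \<rho>)"
  proof -
    define Y W where "Y = (1 + \<sigma>) * (real n - 1) * \<gamma> * (\<gamma> + 2 * \<rho>)" and "W = (\<gamma> - 2 * \<sigma> * \<rho>)\<^sup>2"
    have "2 * Y / (pi * \<rho> * W) + C_sig \<sigma> / (2 * pi * \<rho>) = (C_sig \<sigma> + 4 * Y / W) / (2 * pi * \<rho>)"
      by (simp add: add_divide_distrib)
    then show ?thesis by (simp only: C_nsig_def Y_def W_def mult.assoc)
  qed
  then show ?thesis using uniform explicit by blast
qed

end
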